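(* Let $0<p<1$. For every integer $j\ge 1$ there is a continuous, strictly positive, $1$-periodic function $\Psi_j:\mathbb{R}\to(0,\infty)$, with Fourier coefficients $$\widehat\Psi_j(m):=\int_0^1\Psi_j(u)e^{2\pi i m u}\,du=\frac{2p}{a\log\lambda}\,\mathcal{M}_j\bigl(\rho+1+i\chi m\bigr),\qquad m\in\mathbb{Z},$$ such that $$p_k=k^{-1-\rho}\,\Psi_j(\log_\lambda k)+o\bigl(k^{-1-\rho}\bigr),\qquad k\to\infty .$$
   Context: Notation: $0<p<1$, $q=1-p$, $\lambda=1+p$, $a=1+2p$, $\rho=\log(1+2p)/\log(1+p)$ (so $a=\lambda^\rho$ and $1<\rho<2$), $\chi=2\pi/\log\lambda$. The sequence $\{p_k\}$: for an integer $j\ge1$, the functional equation $$(1+2p)\,g(x)=2p\,x^{j}+g\bigl(x-px+px^{2}\bigr),\qquad 0\le x\le1,$$ has a unique solution $g$ that is a probability generating function (a recalled fact); write $g(x)=\sum_{k\ge j}p_kx^k$. Here $p_k$ depends on $p$ and $j$. Branching process: $(D_n)_{n\ge0}$ is the Galton-Watson process with $D_0=1$ and offspring variable $\xi$ with $P(\xi=1)=q$, $P(\xi=2)=p$. $(D^*_n)_{n\ge0}$ is the same process started from $j$ ancestors (sum of $j$ independent copies of $D$). Equivalently to the definition of $p_k$ as the coefficient of $x^k$ in the unique probability generating function solution $g$ of the functional equation $(1+2p)\,g(x)=2p\,x^{j}+g(x-px+px^{2})$, $0\le x\le1$, one has $p_k=\sum_{n\ge0}\frac{2p}{a}a^{-n}P(D^*_n=k)$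 for $k\ge j$. $W=\lim_{n\to\infty}\lambda^{-n}D_n$ is the almost sure martingale limit ($W>0$ a.s., $E[W]=1$, and $W$ has a continuous density). $V_j=W_1+\cdots+W_j$ with $W_1,\dots,W_j$ independent copies of $W$, and $\mathcal{M}_j(s)=E[V_j^{\,s-1}]$ is the Mellin transform of the density of $V_j$. *)

theory Defs
  imports "HOL-Probability.Probability"
begin

section \<open>The sequence of coefficients\<close>

definition pgf :: "nat pmf \<Rightarrow> real \<Rightarrow> real" where
  "pgf P x = (\<Sum>k. pmf P k * x ^ k)"

definition solves_feq :: "real \<Rightarrow> nat \<Rightarrow> nat pmf \<Rightarrow> bool" where
  "solves_feq p j P \<longleftrightarrow>
     (\<forall>x\<in>{0..1}. (1 + 2 * p) * pgf P x = 2 * p * x ^ j + pgf P (x - p * x + p * x\<^sup>2))"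

text \<open>The description operator is justified by \<open>ex1_solves_feq\<close> below.\<close>

definition p_coeff :: "real \<Rightarrow> nat \<Rightarrow> nat \<Rightarrow> real" where
  "p_coeff p j k = pmf (THE P. solves_feq p j P) k"


section \<open>The branching process\<close>

definition offspring_pmf :: "real \<Rightarrow> nat pmf" where
  "offspring_pmf p = map_pmf (\<lambda>b. if b then 2 else 1) (bernoulli_pmf p)"

text \<open>\<open>\<xi> n i\<close> is the number of children of the \<open>i\<close>-th individual of generation \<open>n\<close>.\<close>

primrec generation_size :: "(nat \<Rightarrow> nat \<Rightarrow> 'a \<Rightarrow> nat) \<Rightarrow> nat \<Rightarrow> 'a \<Rightarrow> nat" where
  "generation_size \<xi> 0 \<omega> = 1"
| "generation_size \<xi> (Suc n) \<omega> = (\<Sum>i<generation_size \<xi> n \<omega>. \<xi> n i \<omega>)"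

definition iid_offspring :: "'a measure \<Rightarrow> real \<Rightarrow> (nat \<Rightarrow> nat \<Rightarrow> 'a \<Rightarrow> nat) \<Rightarrow> bool" where
  "iid_offspring M p \<xi> \<longleftrightarrow>
     prob_space.indep_vars M (\<lambda>_. count_space UNIV) (\<lambda>(n, i). \<xi> n i) UNIV \<and>
     (\<forall>n i. distr M (count_space UNIV) (\<xi> n i) = measure_pmf (offspring_pmf p))"

text \<open>
  The Mellin transform, at \<open>s\<close>, of the distribution of the positive random variable \<open>V\<close>; if \<open>V\<close>
  has density \<open>v\<close>, this is the integral of \<open>y powr (s - 1) * v y\<close> over the positive half-line.
\<close>

definition mellin :: "'a measure \<Rightarrow> ('a \<Rightarrow> real) \<Rightarrow> complex \<Rightarrow> complex" where
  "mellin M V s = (\<integral>\<omega>. complex_of_real (V \<omega>) powr (s - 1) \<partial>M)"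

text \<open>The sign of the exponent is positive here.\<close>

definition fourier_coeff :: "(real \<Rightarrow> real) \<Rightarrow> int \<Rightarrow> complex" where
  "fourier_coeff \<Psi> m =
     integral {0..1} (\<lambda>u. complex_of_real (\<Psi> u) * exp (2 * complex_of_real pi * \<i> * of_int m * complex_of_real u))"


section \<open>Existence and uniqueness of the generating function\<close>

lemma pgf_summable:
  assumes "x \<in> {0..1}"
  shows "summable (\<lambda>k. pmf P k * x ^ k)"
proof (rule summable_comparison_test')
  show "summable (\<lambda>k. pmf P k)"
    using integrable_pmf[of UNIV P] by (simp add: integrable_count_space_nat_iff)
  show "norm (pmf P n * x ^ n) \<le> pmf P n" if "n \<ge> 0" for n
    using assms by (auto simp: abs_mult power_le_one mult_left_le)
qed

lemma ennreal_pgf: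
  assumes x: "x \<in> {0..1}"
  shows "ennreal (pgf P x) = (\<integral>\<^sup>+k. ennreal (x ^ k) \<partial>measure_pmf P)"
proof -
  have "(\<integral>\<^sup>+k. ennreal (x ^ k) \<partial>measure_pmf P) = (\<Sum>k. ennreal (pmf P k * x ^ k))"
    using x by (simp add: nn_integral_measure_pmf nn_integral_count_space_nat ennreal_mult')
  also have "\<dots> = ennreal (pgf P x)"
    unfolding pgf_def using x pgf_summable[OF x] by (intro suminf_ennreal2) auto
  finally show ?thesis ..
qed

lemma pgf_bounds:
  assumes x: "x \<in> {0..1}"
  shows "0 \<le> pgf P x" "pgf P x \<le> 1"
proof -
  show "0 \<le> pgf P x"
    unfolding pgf_def using x pgf_summable[OF x] by (intro suminf_nonneg) auto
  have "(\<integral>\<^sup>+k. ennreal (x ^ k) \<partial>measure_pmf P) \<le> (\<integral>\<^sup>+k. 1 \<partial>measure_pmf P)"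
    using x by (intro nn_integral_mono) (auto simp: power_le_one)
  then have "ennreal (pgf P x) \<le> 1"
    using ennreal_pgf[OF x] by simp
  then show "pgf P x \<le> 1" by simp
qed

lemma feq_map_unit_interval:
  fixes x p :: real
  assumes "0 < p" "p < 1" "x \<in> {0..1}"
  shows "x - p * x + p * x\<^sup>2 \<in> {0..1}"
proof -
  have "x - p * x + p * x\<^sup>2 = x * ((1 - p) + p * x)"
    by (simp add: power2_eq_square algebra_simps)
  moreover have "0 \<le> (1 - p) + p * x" "(1 - p) + p * x \<le> 1"
    using assms by (auto simp: mult_left_le)
  ultimately show ?thesis
    using assms by (auto simp: mult_le_one)
qed

lemma pgf_eq_imp_eq:
  assumes eq: "\<And>x. x \<in> {0..1} \<Longrightarrow> pgf P x = pgf Q x"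
  shows "P = Q"
proof (rule pmf_eqI, rule ccontr)
  fix i assume i: "pmf P i \<noteq> pmf Q i"
  define c where "c k = pmf P k - pmf Q k" for k
  define m where "m = (LEAST k. c k \<noteq> 0)"
  have cm: "c m \<noteq> 0"
    unfolding m_def using i by (intro LeastI[of "\<lambda>k. c k \<noteq> 0" i]) (simp add: c_def)
  have less_m: "c k = 0" if "k < m" for k
    using not_less_Least[of k "\<lambda>k. c k \<noteq> 0"] that by (auto simp: m_def)
  have summ: "summable (\<lambda>k. c (k + m) * x ^ k)" if "x \<in> {0..1}" for x
  proof (rule summable_comparison_test')
    show "summable (\<lambda>k. pmf P (k + m) + pmf Q (k + m))"
      using pgf_summable[of 1 P] pgf_summable[of 1 Q]
      by (intro summable_add summable_ignore_initial_segment) auto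
    show "norm (c (n + m) * x ^ n) \<le> pmf P (n + m) + pmf Q (n + m)" if "n \<ge> 0" for n
    proof -
      have "norm (c (n + m) * x ^ n) \<le> \<bar>c (n + m)\<bar>"
        using \<open>x \<in> {0..1}\<close> by (auto simp: abs_mult power_le_one mult_left_le)
      also have "\<dots> \<le> pmf P (n + m) + pmf Q (n + m)"
        using pmf_nonneg[of P "n + m"] pmf_nonneg[of Q "n + m"] by (simp add: c_def abs_le_iff)
      finally show ?thesis .
    qed
  qed
  define h where "h x = (\<Sum>k. c (k + m) * x ^ k)" for x
  have h0: "h x = 0" if x: "x \<in> {0<..1}" for x
  proof -
    have x': "x \<in> {0..1}" using x by simp
    have "0 = pgf P x - pgf Q x" using eq[OF x'] by simp
    also have "\<dots> = (\<Sum>k. c k * x ^ k)"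
      unfolding pgf_def using suminf_diff[OF pgf_summable[OF x', of P] pgf_summable[OF x', of Q]]
      by (simp add: c_def algebra_simps)
    also have "\<dots> = (\<Sum>k. c (k + m) * x ^ (k + m)) + (\<Sum>k<m. c k * x ^ k)"
    proof (rule suminf_split_initial_segment)
      have "summable (\<lambda>k. pmf P k * x ^ k - pmf Q k * x ^ k)"
        by (intro summable_diff pgf_summable x')
      then show "summable (\<lambda>k. c k * x ^ k)" by (simp add: c_def algebra_simps)
    qed
    also have "\<dots> = (\<Sum>k. x ^ m * (c (k + m) * x ^ k))"
      using less_m by (simp add: power_add mult_ac)
    also have "\<dots> = x ^ m * h x"
      unfolding h_def by (rule suminf_mult[OF summ[OF x']])
    finally show ?thesis using x by simp
  qed
  have "isCont h 0"
    unfolding h_def by (rule isCont_powser[of _ 1]) (use summ[of 1] in auto)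
  then have "(h \<longlongrightarrow> h 0) (at_right 0)"
    by (simp add: isCont_def filterlim_at_split)
  moreover have "(h \<longlongrightarrow> 0) (at_right 0)"
    by (rule tendsto_eventually)
       (use h0 in \<open>auto simp: eventually_at_right_field intro!: exI[of _ 1]\<close>)
  ultimately have "h 0 = 0"
    using tendsto_unique trivial_limit_at_right_real by blast
  moreover have "h 0 = c m"
    unfolding h_def by (simp add: powser_zero)
  ultimately show False using cm by simp
qed

lemma solves_feq_unique:
  assumes p: "0 < p" "p < 1" and P: "solves_feq p j P" and Q: "solves_feq p j Q"
  shows "P = Q"
proof (rule pgf_eq_imp_eq)
  define a where "a = 1 + 2 * p"
  have a: "a > 1" using p by (simp add: a_def)
  have bound: "\<bar>pgf P x - pgf Q x\<bar> \<le> (1 / a) ^ n" if "x \<in> {0..1}" for x n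
    using that
  proof (induction n arbitrary: x)
    case 0
    then show ?case using pgf_bounds[of x P] pgf_bounds[of x Q] by simp
  next
    case (Suc n)
    let ?y = "x - p * x + p * x\<^sup>2"
    have "a * (pgf P x - pgf Q x) = pgf P ?y - pgf Q ?y"
      using P Q Suc.prems unfolding solves_feq_def a_def by (auto simp: algebra_simps)
    then have "\<bar>pgf P x - pgf Q x\<bar> = \<bar>pgf P ?y - pgf Q ?y\<bar> / a"
      using a by (metis abs_mult abs_of_pos less_trans nonzero_mult_div_cancel_left less_numeral_extra(1) order_less_irrefl)
    also have "\<dots> \<le> (1 / a) ^ n / a"
      using a Suc.IH[OF feq_map_unit_interval[OF p Suc.prems]] by (intro divide_right_mono) auto
    finally show ?case by simp
  qed
  fix x :: real assume x: "x \<in> {0..1}"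
  have "(\<lambda>n. (1 / a) ^ n) \<longlonglongrightarrow> 0"
    using a by (intro LIMSEQ_power_zero) auto
  then have "\<bar>pgf P x - pgf Q x\<bar> \<le> 0"
    by (rule LIMSEQ_le_const) (use bound[OF x] in auto)
  then show "pgf P x = pgf Q x" by simp
qed

lemma nn_integral_binomial_step:
  assumes p: "0 < p" "p < 1" and x: "x \<in> {0..1::real}"
  shows "(\<integral>\<^sup>+b. ennreal (x ^ (k + b)) \<partial>measure_pmf (binomial_pmf k p)) = ennreal ((x - p * x + p * x\<^sup>2) ^ k)"
proof (induction k)
  case 0
  then show ?case using p by (simp add: binomial_pmf_0)
next
  case (Suc k)
  let ?y = "x - p * x + p * x\<^sup>2"
  let ?I = "\<integral>\<^sup>+b. ennreal (x ^ (k + b)) \<partial>measure_pmf (binomial_pmf k p)"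
  have y: "0 \<le> ?y" using feq_map_unit_interval[OF p x] by simp
  have *: "(\<integral>\<^sup>+b. ennreal (x * (d * x ^ (k + b))) \<partial>measure_pmf (binomial_pmf k p)) = ennreal (x * d) * ?I"
    if "d \<ge> 0" for d
  proof -
    have "(\<integral>\<^sup>+b. ennreal (x * (d * x ^ (k + b))) \<partial>measure_pmf (binomial_pmf k p)) =
          (\<integral>\<^sup>+b. ennreal (x * d) * ennreal (x ^ (k + b)) \<partial>measure_pmf (binomial_pmf k p))"
      using x that by (intro nn_integral_cong) (auto simp: ennreal_mult' [symmetric] mult_ac)
    then show ?thesis by (simp add: nn_integral_cmult)
  qed
  have "(\<integral>\<^sup>+b. ennreal (x ^ (Suc k + b)) \<partial>measure_pmf (binomial_pmf (Suc k) p)) =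
        ennreal (x * x) * ?I * ennreal p + ennreal (x * 1) * ?I * ennreal (1 - p)"
    using p *[of x] *[of 1] x
    by (subst binomial_pmf_Suc) auto
  also have "\<dots> = ennreal ((x * x * p + x * (1 - p)) * ?y ^ k)"
  proof -
    have "ennreal ((x * x * p + x * (1 - p)) * ?y ^ k) =
          ennreal (x * x * ?y ^ k * p + x * 1 * ?y ^ k * (1 - p))"
      by (rule arg_cong[where f = ennreal]) (simp only: ring_distribs mult_ac mult_1_right)
    also have "\<dots> = ennreal (x * x * ?y ^ k * p) + ennreal (x * 1 * ?y ^ k * (1 - p))"
      using p x y by (intro ennreal_plus) auto
    also have "\<dots> = ennreal (x * x) * ennreal (?y ^ k) * ennreal p + ennreal (x * 1) * ennreal (?y ^ k) * ennreal (1 - p)"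
      using p x y by (simp add: ennreal_mult)
    finally show ?thesis unfolding Suc.IH by (rule sym)
  qed
  also have "(x * x * p + x * (1 - p)) * ?y ^ k = ?y ^ Suc k"
    by (simp add: power2_eq_square algebra_simps)
  finally show ?case .
qed

lemma solves_feq_exists:
  assumes p: "0 < p" "p < 1"
  shows "\<exists>P. solves_feq p j P"
proof -
  define s where "s = 2 * p / (1 + 2 * p)"
  have s: "0 < s" "s \<le> 1" "1 - s = 1 / (1 + 2 * p)" using p by (auto simp: s_def field_simps)
  define step where "step k = map_pmf (\<lambda>b. k + b) (binomial_pmf k p)" for k
  define D where "D n = ((\<lambda>R. bind_pmf R step) ^^ n) (return_pmf j)" for n
  define P where "P = bind_pmf (geometric_pmf s) D"
  have D: "D 0 = return_pmf j" "D (Suc n) = bind_pmf (D n) step" for n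
    by (simp_all add: D_def)
  have "P = bind_pmf (bernoulli_pmf s) (\<lambda>b. if b then return_pmf j else bind_pmf P step)"
    unfolding P_def using s
    by (subst geometric_bind_pmf_unfold)
       (auto simp: bind_assoc_pmf D bind_map_pmf bind_return_pmf intro!: bind_pmf_cong)
  note P = this
  have "solves_feq p j P"
    unfolding solves_feq_def
  proof
    fix x :: real assume x: "x \<in> {0..1}"
    let ?y = "x - p * x + p * x\<^sup>2"
    have y: "?y \<in> {0..1}" by (rule feq_map_unit_interval[OF p x])
    have "ennreal (pgf P x) = (\<integral>\<^sup>+k. ennreal (x ^ k) \<partial>measure_pmf
            (bind_pmf (bernoulli_pmf s) (\<lambda>b. if b then return_pmf j else bind_pmf P step)))"
      using ennreal_pgf[OF x] P by simp
    also have "\<dots> = ennreal (x ^ j) * ennreal s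
                     + (\<integral>\<^sup>+k. ennreal (?y ^ k) \<partial>measure_pmf P) * ennreal (1 - s)"
      using s by (simp add: step_def nn_integral_binomial_step[OF p x])
    also have "\<dots> = ennreal (x ^ j * s + pgf P ?y * (1 - s))"
    proof -
      have "ennreal (x ^ j * s + pgf P ?y * (1 - s)) = ennreal (x ^ j * s) + ennreal (pgf P ?y * (1 - s))"
        using s(1,2) x pgf_bounds[OF y] by (intro ennreal_plus) auto
      then show ?thesis
        using s(1,2) x pgf_bounds[OF y] by (simp only: ennreal_pgf[OF y, symmetric]) (simp add: ennreal_mult)
    qed
    finally have "pgf P x = x ^ j * s + pgf P ?y * (1 - s)"
      using s(1,2) x pgf_bounds[OF y] pgf_bounds[OF x] by (subst (asm) ennreal_inj) auto
    then have "(1 + 2 * p) * pgf P x = x ^ j * ((1 + 2 * p) * s) + pgf P ?y * ((1 + 2 * p) * (1 - s))"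
      by (simp only: ring_distribs mult_ac)
    moreover have "(1 + 2 * p) * s = 2 * p" "(1 + 2 * p) * (1 - s) = 1"
      unfolding s(3) using p by (simp_all add: s_def)
    ultimately show "(1 + 2 * p) * pgf P x = 2 * p * x ^ j + pgf P ?y"
      by simp
  qed
  then show ?thesis ..
qed

lemma ex1_solves_feq:
  assumes "0 < p" "p < 1"
  shows "\<exists>!P. solves_feq p j P"
  using solves_feq_exists[OF assms] solves_feq_unique[OF assms] by blast

end

theory Submission
  imports Defs
begin

text \<open>
  Write \<open>f\<close> for the offspring generating function. On the unit circle, the iterates of \<open>f\<close> first leave
  the repelling fixed point 1 at rate \<open>lam\<close> and then approach the attracting fixed point 0 at rate
  \<open>q = 1 - p\<close>. This bounds the \<open>n\<close>-th iterate at \<open>exp (i t / lam ^ n)\<close> by a constant times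
  \<open>\<bar>t\<bar> powr (- \<alpha>)\<close> with \<open>\<alpha> = - ln q / ln lam\<close>, and \<open>\<alpha> > 1\<close> because \<open>lam * q = 1 - p ^ 2 < 1\<close>. By dominated
  convergence in the Fourier integrals, the probabilities that generation \<open>n\<close> has size \<open>k\<close>, multiplied
  by \<open>lam ^ n\<close>, converge uniformly in \<open>k\<close> to \<open>v (k / lam ^ n)\<close>, where \<open>v\<close> is the continuous density of \<open>V\<close>.

  Since \<open>p_coeff p j k\<close> is the mixture of these probabilities with weights \<open>(2 * p / a) * a powr (- n)\<close>
  and \<open>a = lam powr \<rho>\<close>, multiplication by \<open>k powr (1 + \<rho>)\<close> turns it into a sum over the points
  \<open>y = k / lam ^ n\<close>, whose terms tend to \<open>y powr (1 + \<rho>) * v y\<close>. Boundedness of \<open>v y\<close> and of \<open>y ^ 3 * v y\<close>,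
  uniformly on the discrete level, allows the limit to be taken termwise, because \<open>0 < \<rho> < 2\<close>. The
  resulting sum over the integers is \<open>\<Psi>\<close>, and unfolding its Fourier integral gives the Mellin transform.
\<close>

section \<open>Iterating the offspring generating function\<close>

text \<open>The exponent 3 is dictated by the weight: since \<open>1 + \<rho> < 3\<close>, a bound
  of order \<open>y ^ (-3)\<close> makes the terms with large \<open>y = k / lam ^ n\<close> decay
  geometrically, while for small \<open>y\<close> the weight itself decays and boundedness is
  enough. The bound has to hold for single coefficients, because every term contains just one of
  them. Markov's inequality alone loses a factor \<open>lam ^ n\<close>, which is regained by
  convolving with the uniform bound. Positivity of \<open>\<Psi>\<close> is not visible in Fourier
  formulas. As \<open>\<Psi>\<close> sums over all the points \<open>lam powr (u + n)\<close> for
  integer \<open>n\<close>, it suffices to find, for every \<open>y > 0\<close>, one point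
  \<open>y / lam ^ m\<close> of positive density; this follows from closure of the positivity points
  under sums and under division by \<open>lam\<close>. That the law of \<open>V\<close> has the
  density \<open>v\<close> comes from the decay of the iterates, by Fourier inversion. Sign, support
  and bounds of \<open>v\<close> pass over from the coefficients, sampled at
  \<open>\<lfloor>y * lam ^ n\<rfloor>\<close>.\<close>

abbreviation cpoly :: "real poly \<Rightarrow> complex poly" where
  "cpoly \<equiv> map_poly complex_of_real"

lemma cpoly_add: "cpoly (P + Q) = cpoly P + cpoly Q"
  by (rule poly_eqI) (simp add: coeff_map_poly)

lemma cpoly_mult: "cpoly (P * Q) = cpoly P * cpoly Q"
  by (rule poly_eqI) (simp add: coeff_map_poly coeff_mult)

lemma cpoly_smult: "cpoly (smult c P) = smult (complex_of_real c) (cpoly P)"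
  by (rule poly_eqI) (simp add: coeff_map_poly)

lemma cpoly_power: "cpoly (P ^ n) = cpoly P ^ n"
  by (induction n) (simp_all add: cpoly_mult map_poly_1)

lemma poly_cpoly: "poly (cpoly P) z = (\<Sum>k\<le>degree P. complex_of_real (coeff P k) * z ^ k)"
proof -
  have "degree (cpoly P) = degree P"
    by (rule degree_map_poly) simp
  then show ?thesis
    by (simp add: poly_altdef coeff_map_poly)
qed

lemma coeff_mult_nonneg:
  fixes P Q :: "real poly"
  assumes "\<And>k. 0 \<le> coeff P k" "\<And>k. 0 \<le> coeff Q k"
  shows "0 \<le> coeff (P * Q) k"
  using assms by (auto simp: coeff_mult intro!: sum_nonneg)

lemma coeff_sum_le_poly_1:
  fixes P :: "real poly"
  assumes "\<And>k. 0 \<le> coeff P k" "finite S"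
  shows "(\<Sum>k\<in>S. coeff P k) \<le> poly P 1"
proof -
  have "(\<Sum>k\<in>S. coeff P k) \<le> (\<Sum>k\<in>S \<union> {..degree P}. coeff P k)"
    using assms by (intro sum_mono2) auto
  also have "\<dots> = (\<Sum>k\<le>degree P. coeff P k)"
    using assms by (intro sum.mono_neutral_right) (auto simp: coeff_eq_0)
  finally show ?thesis by (simp add: poly_altdef)
qed

locale branching =
  fixes p :: real
  assumes p_pos: "0 < p" and p_less_1: "p < 1"
begin

definition q :: real where "q = 1 - p"
definition lam :: real where "lam = 1 + p"

lemma q_pos: "0 < q" and q_less_1: "q < 1" and lam_gt_1: "1 < lam"
  and lam_pos: "0 < lam"
  using p_pos p_less_1 by (auto simp: q_def lam_def)

definition f :: "complex \<Rightarrow> complex" where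
  "f z = of_real q * z + of_real p * z ^ 2"

primrec gen_poly :: "nat \<Rightarrow> real poly" where
  "gen_poly 0 = [:0, 1:]"
| "gen_poly (Suc n) = smult q (gen_poly n) + smult p (gen_poly n ^ 2)"

text \<open>
  \<open>coef j n k\<close> is the probability that generation \<open>n\<close> has size \<open>k\<close> in the process started
  from \<open>j\<close> ancestors.
\<close>

definition coef :: "nat \<Rightarrow> nat \<Rightarrow> nat \<Rightarrow> real" where
  "coef j n k = coeff (gen_poly n ^ j) k"

lemma poly_gen_poly: "poly (cpoly (gen_poly n)) z = (f ^^ n) z"
  by (induction n)
     (simp_all add: f_def cpoly_add cpoly_smult cpoly_power map_poly_pCons)

lemma poly_gen_poly_1: "poly (gen_poly n) 1 = 1"
  by (induction n) (simp_all add: q_def)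

lemma coeff_gen_poly_nonneg: "0 \<le> coeff (gen_poly n) k"
proof (induction n arbitrary: k)
  case 0 show ?case by (simp add: coeff_pCons split: nat.splits)
next
  case (Suc n)
  have "0 \<le> coeff (gen_poly n * gen_poly n) k"
    by (rule coeff_mult_nonneg) (rule Suc)+
  then show ?case using Suc p_pos q_pos by (simp add: power2_eq_square)
qed

lemma coef_nonneg: "0 \<le> coef j n k"
  unfolding coef_def
proof (induction j arbitrary: k)
  case 0 show ?case by simp
next
  case (Suc j) then show ?case
    by (auto intro!: coeff_mult_nonneg coeff_gen_poly_nonneg)
qed

lemma sum_coef_le_1: "finite S \<Longrightarrow> (\<Sum>k\<in>S. coef j n k) \<le> 1"
  using coeff_sum_le_poly_1[of "gen_poly n ^ j" S] coef_nonneg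
  by (simp add: coef_def poly_gen_poly_1)

lemma coef_le_1: "coef j n k \<le> 1"
  using sum_coef_le_1[of "{k}" j n] by simp

lemma coef_add: "coef (i + j) n k = (\<Sum>l\<le>k. coef i n l * coef j n (k - l))"
  by (simp add: coef_def power_add coeff_mult)

text \<open>Conditions on the children of the ancestor, so \<open>k\<close> stays fixed and only the
  number of ancestors changes. Bounds and positivity pass from one generation to the next in this
  form.\<close>

lemma coef_Suc_gen: "coef 1 (Suc n) k = q * coef 1 n k + p * coef 2 n k"
  by (simp add: coef_def)

lemma norm_f_le: "norm (f z) \<le> norm z * (q + p * norm z)"
proof -
  have "norm (f z) \<le> norm (of_real q * z) + norm (of_real p * z ^ 2)"
    unfolding f_def by (rule norm_triangle_ineq)
  then show ?thesis using p_pos q_pos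
    by (simp add: norm_mult norm_power power2_eq_square algebra_simps)
qed

lemma norm_f_le': assumes "norm z \<le> 1" shows "norm (f z) \<le> norm z"
proof -
  have "norm z * (q + p * norm z) \<le> norm z * 1"
    using assms p_pos by (intro mult_left_mono) (auto simp: q_def mult_left_le)
  then show ?thesis using norm_f_le[of z] by simp
qed

lemma norm_funpow_f_le: "norm z \<le> 1 \<Longrightarrow> norm ((f ^^ n) z) \<le> norm z"
proof (induction n)
  case (Suc n)
  then show ?case using norm_f_le'[of "(f ^^ n) z"] by auto
qed auto

text \<open>\<open>f z\<close> is \<open>z\<close> times the point \<open>q + p * z\<close> of the
  chord from 1 to \<open>z\<close>. The squared modulus of this convex combination falls short of
  the combination of the squared moduli by \<open>p * q * norm (1 - z) ^ 2\<close>, so a point at a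
  fixed distance from 1 is sent into a fixed smaller disc.\<close>

lemma norm_f_sq_le:
  assumes "norm z \<le> 1"
  shows "norm (f z) ^ 2 \<le> 1 - p * q * norm (1 - z) ^ 2"
proof -
  define x y where "x = Re z" and "y = Im z"
  have xy: "x\<^sup>2 + y\<^sup>2 \<le> 1"
    using assms by (simp add: cmod_def x_def y_def)
  have "f z = z * (of_real q + of_real p * z)"
    by (simp add: f_def power2_eq_square algebra_simps)
  then have "norm (f z) ^ 2 = norm z ^ 2 * norm (of_real q + of_real p * z) ^ 2"
    by (simp add: norm_mult power_mult_distrib)
  also have "\<dots> \<le> 1 * norm (of_real q + of_real p * z) ^ 2"
    using assms by (intro mult_right_mono) (auto simp: power_le_one)
  also have "norm (of_real q + of_real p * z) ^ 2 = (q + p * x)\<^sup>2 + (p * y)\<^sup>2"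
    by (simp add: cmod_power2 x_def y_def)
  also have "(q + p * x)\<^sup>2 + (p * y)\<^sup>2 =
      q * (q + p) + p * (p + q) * (x\<^sup>2 + y\<^sup>2) - p * q * ((1 - x)\<^sup>2 + y\<^sup>2)"
    by (simp add: power2_eq_square algebra_simps)
  also have "(1 - x)\<^sup>2 + y\<^sup>2 = norm (1 - z) ^ 2"
    by (simp add: cmod_power2 x_def y_def)
  also have "q * (q + p) + p * (p + q) * (x\<^sup>2 + y\<^sup>2) \<le> q * (q + p) + p * (p + q) * 1"
    using xy p_pos q_pos by (intro add_left_mono mult_left_mono) auto
  also have "\<dots> = 1" by (simp add: q_def)
  finally show ?thesis by simp
qed

section \<open>Escape from the repelling fixed point 1\<close>

lemma one_minus_f: "1 - f z = (1 - z) * (1 + of_real p * z)"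
  by (simp add: f_def q_def power2_eq_square algebra_simps)

lemma norm_one_minus_f_ge: "norm (1 - z) * (lam - p * norm (1 - z)) \<le> norm (1 - f z)"
proof -
  have "1 + of_real p * z = of_real lam - of_real p * (1 - z)"
    by (simp add: lam_def algebra_simps)
  then have "norm (1 + of_real p * z) \<ge> norm (complex_of_real lam) - norm (of_real p * (1 - z))"
    using norm_triangle_ineq2 by metis
  then have "lam - p * norm (1 - z) \<le> norm (1 + of_real p * z)"
    using p_pos lam_pos by (simp add: norm_mult)
  then show ?thesis
    by (simp add: one_minus_f norm_mult mult_left_mono)
qed

text \<open>
  Near the repelling fixed point 1, the iteration multiplies the distance \<open>d\<close> to 1 by almost
  \<open>lam\<close>; the quantity \<open>1/d - 2/lam\<close> absorbs the quadratic error.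
\<close>

lemma growth_step:
  fixes d d' :: real
  assumes "0 < d" "d \<le> 1 / 2" "d * (lam - p * d) \<le> d'"
  shows "1 / d' - 2 / lam \<le> (1 / d - 2 / lam) / lam"
proof -
  have pos: "0 < lam - p * d"
    using assms p_pos p_less_1 lam_gt_1 mult_mono[of p 1 d "1/2"] by simp
  then have dd: "0 < d * (lam - p * d)" using assms by simp
  have "1 / d' \<le> 1 / (d * (lam - p * d))"
    using assms dd by (intro divide_left_mono) (auto intro: mult_pos_pos)
  also have "\<dots> \<le> 1 / (lam * d) + 2 / lam * (p / lam)"
  proof -
    have "lam * lam \<le> (lam - p * d) * (lam + 2 * p * d)"
    proof -
      have "(lam - p * d) * (lam + 2 * p * d) = lam * lam + p * d * (lam - 2 * p * d)"
        by (simp add: algebra_simps)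
      moreover have "2 * p * d \<le> lam"
        using mult_mono[of p 1 d "1/2"] p_pos p_less_1 assms lam_gt_1 by auto
      then have "0 \<le> p * d * (lam - 2 * p * d)" using p_pos assms by simp
      ultimately show ?thesis by simp
    qed
    then have "1 / (lam - p * d) \<le> (lam + 2 * p * d) / (lam * lam)"
      using pos lam_pos by (simp add: divide_simps mult.commute)
    then have "1 / (lam - p * d) / d \<le> (lam + 2 * p * d) / (lam * lam) / d"
      using assms by (intro divide_right_mono) auto
    then show ?thesis using assms lam_pos by (simp add: field_simps)
  qed
  \<comment> \<open>Since \<open>p = lam - 1\<close>, the error term is \<open>2 / lam\<close> minus
    its own \<open>lam\<close>-th part; this determines the constant subtracted from
    \<open>1 / d\<close>.\<close>
  also have "2 / lam * (p / lam) = 2 / lam - 2 / lam / lam"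
  proof -
    have "p / lam = 1 - 1 / lam" using lam_pos by (simp add: diff_divide_distrib lam_def field_simps)
    then show ?thesis by (simp add: right_diff_distrib)
  qed
  finally show ?thesis using lam_pos assms by (simp add: diff_divide_distrib mult.commute)
qed

lemma growth:
  assumes z: "z \<noteq> 1" and small: "\<And>m. m \<le> n \<Longrightarrow> norm (1 - (f ^^ m) z) \<le> 1 / 2"
  shows "lam ^ n * norm (1 - z) \<le> lam / (2 * p)"
proof -
  define d where "d m = norm (1 - (f ^^ m) z)" for m
  have d_step: "d m * (lam - p * d m) \<le> d (Suc m)" for m
    unfolding d_def using norm_one_minus_f_ge by simp
  have pos: "0 < d m" if "m \<le> n" for m using that
  proof (induction m)
    case 0 then show ?case using z by (simp add: d_def)
  next
    case (Suc m)
    then have "0 < d m" "d m \<le> 1/2" using small[of m] by (auto simp: d_def)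
    moreover have "p * d m < lam"
      using calculation mult_mono[of p 1 "d m" "1/2"] p_pos p_less_1 lam_gt_1 by auto
    ultimately have "0 < d m * (lam - p * d m)" by simp
    then show ?case using d_step[of m] by linarith
  qed
  have le: "1 / d m - 2 / lam \<le> (1 / d 0 - 2 / lam) / lam ^ m" if "m \<le> n" for m using that
  proof (induction m)
    case (Suc m)
    then have "1 / d (Suc m) - 2 / lam \<le> (1 / d m - 2 / lam) / lam"
      using pos[of m] small[of m] d_step[of m] by (intro growth_step) (auto simp: d_def)
    also have "\<dots> \<le> (1 / d 0 - 2 / lam) / lam ^ m / lam"
      using Suc lam_pos by (intro divide_right_mono) auto
    finally show ?case by (simp add: field_simps)
  qed simp
  \<comment> \<open>Within distance 1/2 the reciprocal is at least 2, which exceeds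
    \<open>2 / lam\<close> by \<open>2 * p / lam\<close>; so the quantity stays bounded below even
    after \<open>n\<close> contractions.\<close>
  have "2 \<le> 1 / d n" using small[of n] pos[of n] by (simp add: d_def field_simps)
  then have "2 - 2 / lam \<le> (1 / d 0 - 2 / lam) / lam ^ n" using le[of n] by simp
  also have "\<dots> \<le> 1 / d 0 / lam ^ n"
    using lam_pos by (intro divide_right_mono) auto
  finally have "(2 - 2 / lam) * (d 0 * lam ^ n) \<le> 1"
    using pos[of 0] lam_pos by (simp add: field_simps)
  moreover have "2 - 2 / lam = 2 * p / lam" using lam_pos by (simp add: field_simps lam_def)
  ultimately have "2 * p / lam * (d 0 * lam ^ n) \<le> 1" by simp
  then show ?thesis using p_pos lam_pos by (simp add: d_def field_simps)
qed

section \<open>Approach to the attracting fixed point 0\<close>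

definition decay_exp :: nat where "decay_exp = nat \<lceil>1 / q\<rceil>"

lemma decay_exp_ge: "1 / q \<le> real decay_exp"
  unfolding decay_exp_def by linarith

text \<open>
  Near the attracting fixed point 0, the iteration multiplies the modulus \<open>w\<close> by almost \<open>q\<close>;
  the quantity \<open>w/(1-w)^decay_exp\<close> absorbs the error.
\<close>

lemma decay_step:
  fixes w w' :: real
  assumes "0 \<le> w" "w < 1" "0 \<le> w'" "w' \<le> w * (q + p * w)"
  shows "w' < 1" "w' / (1 - w') ^ decay_exp \<le> q * (w / (1 - w) ^ decay_exp)"
proof -
  have fac: "1 - w * (q + p * w) = (1 - w) * (1 + p * w)"
    by (simp add: q_def algebra_simps)
  have pos: "0 < (1 - w) * (1 + p * w)" using assms p_pos by (auto intro!: mult_pos_pos add_pos_nonneg)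
  then show "w' < 1" using assms fac by simp
  \<comment> \<open>The origin of \<open>decay_exp\<close>: by Bernoulli's inequality an exponent of
    at least \<open>1 / q\<close> lets the growth factor \<open>1 + p * w\<close> of
    \<open>1 - w\<close> pay for the excess of \<open>q + p * w\<close> over
    \<open>q\<close>.\<close>
  have "1 + p * w / q \<le> 1 + real decay_exp * (p * w)"
    using decay_exp_ge assms p_pos mult_right_mono[OF decay_exp_ge, of "p * w"] by simp
  also have "\<dots> \<le> (1 + p * w) ^ decay_exp"
    by (rule Bernoulli_inequality) (use assms p_pos mult_nonneg_nonneg[of p w] in linarith)
  finally have bern: "q + p * w \<le> q * (1 + p * w) ^ decay_exp"
    using q_pos by (simp add: field_simps)
  have "w' / (1 - w') ^ decay_exp \<le> w * (q + p * w) / ((1 - w) * (1 + p * w)) ^ decay_exp"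
    using assms pos fac p_pos q_pos
    by (intro frac_le power_mono zero_less_power) auto
  also have "\<dots> \<le> w * (q * (1 + p * w) ^ decay_exp) / ((1 - w) * (1 + p * w)) ^ decay_exp"
    using assms pos bern by (intro divide_right_mono mult_left_mono) auto
  also have "\<dots> = q * (w / (1 - w) ^ decay_exp)"
  proof -
    have "0 < 1 + p * w" using assms p_pos by (intro add_pos_nonneg) auto
    then have nz: "1 + p * w \<noteq> 0" by simp
    show ?thesis by (simp add: power_mult_distrib nz)
  qed
  finally show "w' / (1 - w') ^ decay_exp \<le> q * (w / (1 - w) ^ decay_exp)" .
qed

lemma decay:
  assumes "norm z \<le> r" "r < 1"
  shows "norm ((f ^^ n) z) \<le> q ^ n / (1 - r) ^ decay_exp"
proof -
  define w where "w m = norm ((f ^^ m) z)" for m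
  have step: "w (Suc m) \<le> w m * (q + p * w m)" for m
    unfolding w_def using norm_f_le by simp
  have "w m < 1 \<and> w m / (1 - w m) ^ decay_exp \<le> q ^ m * (w 0 / (1 - w 0) ^ decay_exp)" for m
  proof (induction m)
    case 0 then show ?case using assms by (simp add: w_def)
  next
    case (Suc m)
    have "w (Suc m) / (1 - w (Suc m)) ^ decay_exp \<le> q * (w m / (1 - w m) ^ decay_exp)"
      using Suc step[of m] by (intro decay_step(2)) (auto simp: w_def)
    also have "\<dots> \<le> q * (q ^ m * (w 0 / (1 - w 0) ^ decay_exp))"
      using Suc q_pos by (intro mult_left_mono) auto
    finally show ?case
      using Suc step[of m] decay_step(1)[of "w m" "w (Suc m)"] by (auto simp: w_def)
  qed
  note * = this[of n]
  have "w n \<le> w n / (1 - w n) ^ decay_exp"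
  proof -
    have "(1 - w n) ^ decay_exp \<le> 1" "0 < (1 - w n) ^ decay_exp" "0 \<le> w n"
      using * by (auto simp: w_def power_le_one)
    then show ?thesis by (simp add: pos_le_divide_eq mult_left_le)
  qed
  also have "\<dots> \<le> q ^ n * (w 0 / (1 - w 0) ^ decay_exp)" using * by simp
  also have "\<dots> \<le> q ^ n * (1 / (1 - r) ^ decay_exp)"
    using assms q_pos by (intro mult_left_mono frac_le power_mono) (auto simp: w_def)
  finally show ?thesis by (simp add: w_def)
qed

definition \<alpha> :: real where "\<alpha> = - ln q / ln lam"

lemma alpha_gt_1: "1 < \<alpha>"
proof -
  have "lam * q < 1" using p_pos by (simp add: lam_def q_def algebra_simps)
  then have "ln (lam * q) < 0" using lam_pos q_pos by simp
  then have "ln lam + ln q < 0" using lam_pos q_pos by (simp add: ln_mult)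
  then have "1 * ln lam < - ln q" by simp
  then show ?thesis
    unfolding \<alpha>_def by (subst pos_less_divide_eq) (use lam_gt_1 in auto)
qed

lemma q_power_eq: "q ^ n = (lam ^ n) powr (- \<alpha>)"
proof -
  have "q = lam powr (- \<alpha>)"
    using lam_gt_1 q_pos by (simp add: \<alpha>_def powr_def)
  then have "q ^ n = (lam powr (- \<alpha>)) powr real n" using q_pos by (simp add: powr_realpow)
  also have "\<dots> = (lam powr real n) powr (- \<alpha>)" by (simp add: powr_powr mult.commute)
  finally show ?thesis using lam_pos by (simp add: powr_realpow)
qed

text \<open>Let \<open>M\<close> be the first time at which the orbit is farther than 1/2 from 1.
  Then \<open>lam ^ M * norm (1 - z)\<close> is bounded, one more step lands in a disc of radius
  below 1, and the remaining steps contribute powers of \<open>q\<close>, which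
  \<open>q_power_eq\<close> turns into powers of \<open>lam\<close>. If the orbit has not left by
  time \<open>n\<close>, or leaves exactly then, \<open>lam ^ n * norm (1 - z)\<close> is bounded
  and the trivial bound 1 is enough.\<close>

lemma norm_iterate_le:
  obtains C where "0 < C"
    "\<And>z n. norm z = 1 \<Longrightarrow> z \<noteq> 1 \<Longrightarrow> norm ((f ^^ n) z) \<le> C * (lam ^ n * norm (1 - z)) powr (- \<alpha>)"
proof -
  \<comment> \<open>2 bounds the distance to 1 at time 0; the other entry is the bound of
    \<open>growth\<close> just before the exit, times \<open>lam\<close> for the exit step.\<close>
  define C1 where "C1 = max 2 (lam * (lam / (2 * p)))"
  \<comment> \<open>The radius given by \<open>norm_f_sq_le\<close> at distance 1/2.\<close>
  define r where "r = sqrt (1 - p * q / 4)"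
  have pq: "0 < p * q" "p * q < 1"
    using p_pos q_pos p_less_1 q_less_1 mult_strict_mono[of p 1 q 1] by auto
  have r: "0 \<le> r" "r < 1" using pq by (auto simp: r_def)
  have C1: "0 < C1" "2 \<le> C1" "lam * (lam / (2 * p)) \<le> C1" by (auto simp: C1_def)
  define C where "C = (lam * C1) powr \<alpha> / (1 - r) ^ decay_exp"
  have C: "0 < C" using r C1 lam_pos by (simp add: C_def)
  show thesis
  proof (rule that[OF C])
    fix z :: complex and n :: nat
    assume z: "norm z = 1" "z \<noteq> 1"
    define d where "d = norm (1 - z)"
    have d: "0 < d" "d \<le> 2" using z norm_triangle_ineq4[of 1 z] by (auto simp: d_def)
    have trivial: "norm ((f ^^ n) z) \<le> 1" using norm_funpow_f_le[of z n] z by simp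
    \<comment> \<open>Applied one step after the exit, whence the factor \<open>lam\<close> in front
      of \<open>C1\<close>.\<close>
    have main: "norm ((f ^^ n) z) \<le> C * (lam ^ n * d) powr (- \<alpha>)"
      if M: "M \<le> n" "lam ^ M * d \<le> lam * C1" "norm ((f ^^ M) z) \<le> r" for M
    proof -
      have "(f ^^ n) z = (f ^^ (n - M)) ((f ^^ M) z)"
        using M(1) by (metis comp_apply funpow_add le_add_diff_inverse2)
      then have "norm ((f ^^ n) z) \<le> q ^ (n - M) / (1 - r) ^ decay_exp"
        using decay[OF M(3) r(2), of "n - M"] by simp
      also have "q ^ (n - M) = (lam ^ (n - M)) powr (- \<alpha>)" by (rule q_power_eq)
      also have "\<dots> \<le> ((lam ^ n * d) / (lam * C1)) powr (- \<alpha>)"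
      proof (rule powr_mono2')
        have "lam ^ n * d = lam ^ (n - M) * (lam ^ M * d)"
          using M(1) by (simp flip: power_add)
        also have "\<dots> \<le> lam ^ (n - M) * (lam * C1)"
          using M lam_pos by (intro mult_left_mono) auto
        finally show "(lam ^ n * d) / (lam * C1) \<le> lam ^ (n - M)"
          using C1 lam_pos by (simp add: divide_simps)
      qed (use alpha_gt_1 d lam_pos C1 in auto)
      also have "\<dots> = (lam ^ n * d) powr (- \<alpha>) * (lam * C1) powr \<alpha>"
        using d lam_pos C1 by (simp add: powr_divide powr_minus field_simps)
      finally show ?thesis using r by (simp add: C_def field_simps divide_right_mono)
    qed
    have triv: "norm ((f ^^ n) z) \<le> C * (lam ^ n * d) powr (- \<alpha>)" if "lam ^ n * d \<le> lam * C1"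
    proof -
      have "(lam * C1) powr (-\<alpha>) \<le> (lam ^ n * d) powr (- \<alpha>)"
        using that d lam_pos alpha_gt_1 by (intro powr_mono2') auto
      then have "C * (lam * C1) powr (-\<alpha>) \<le> C * (lam ^ n * d) powr (- \<alpha>)"
        using C by (intro mult_left_mono) auto
      moreover have "C * (lam * C1) powr (-\<alpha>) = 1 / (1 - r) ^ decay_exp"
        using lam_pos C1 by (simp add: C_def powr_minus field_simps)
      moreover have "1 \<le> 1 / (1 - r) ^ decay_exp" using r by (simp add: divide_simps power_le_one)
      ultimately show ?thesis using trivial by linarith
    qed
    show "norm ((f ^^ n) z) \<le> C * (lam ^ n * norm (1 - z)) powr (- \<alpha>)"
    proof (cases "\<forall>m\<le>n. norm (1 - (f ^^ m) z) \<le> 1 / 2")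
      case True
      then have "lam ^ n * d \<le> lam / (2 * p)" using growth[of z n] z by (simp add: d_def)
      also have "\<dots> \<le> lam * (lam / (2 * p))" using lam_gt_1 p_pos by (simp add: field_simps)
      also have "\<dots> \<le> lam * C1"
        using C1(3) lam_gt_1 C1(1) by (smt (verit) mult_le_cancel_right1)
      finally show ?thesis using triv by (simp add: d_def)
    next
      case False
      define M where "M = (LEAST m. norm (1 - (f ^^ m) z) > 1 / 2)"
      obtain m where m: "m \<le> n" "norm (1 - (f ^^ m) z) > 1 / 2" using False by force
      have M: "norm (1 - (f ^^ M) z) > 1 / 2" "M \<le> n"
        unfolding M_def using m LeastI[of "\<lambda>m. norm (1 - (f ^^ m) z) > 1 / 2" m]
          Least_le[of "\<lambda>m. norm (1 - (f ^^ m) z) > 1 / 2" m] by auto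
      have less_M: "norm (1 - (f ^^ k) z) \<le> 1 / 2" if "k < M" for k
        using not_less_Least[of k "\<lambda>m. norm (1 - (f ^^ m) z) > 1 / 2"] that by (auto simp: M_def)
      have lM: "lam ^ M * d \<le> C1"
      proof (cases M)
        case 0 then show ?thesis using d C1 by simp
      next
        case (Suc k)
        have "lam ^ k * d \<le> lam / (2 * p)"
          unfolding d_def using less_M Suc z by (intro growth) auto
        then have "lam * (lam ^ k * d) \<le> lam * (lam / (2 * p))"
          using lam_pos by (intro mult_left_mono) auto
        then show ?thesis using C1 Suc by simp
      qed
      show ?thesis
      proof (cases "M = n")
        case True
        then show ?thesis using triv lM lam_gt_1 C1 by (simp add: d_def) (smt (verit) mult_le_cancel_right1)
      next
        case False
        then have "Suc M \<le> n" using M by simp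
        moreover have "lam ^ Suc M * d \<le> lam * C1" using lM lam_pos by simp
        moreover have "norm ((f ^^ Suc M) z) \<le> r"
        proof -
          have "norm ((f ^^ Suc M) z) ^ 2 \<le> 1 - p * q * norm (1 - (f ^^ M) z) ^ 2"
            using norm_f_sq_le[of "(f ^^ M) z"] norm_funpow_f_le[of z M] z by simp
          also have "\<dots> \<le> 1 - p * q * (1 / 2) ^ 2"
            using M pq by (intro diff_left_mono mult_left_mono power_mono) auto
          finally show ?thesis unfolding r_def
            by (intro real_le_rsqrt) (simp add: power2_eq_square)
        qed
        ultimately show ?thesis unfolding d_def[symmetric] by (rule main)
      qed
    qed
  qed
qed

end

section \<open>Fourier representation of the coefficients\<close>

text \<open>The chord has length \<open>2 * \<bar>sin (s / 2)\<bar>\<close>, and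
  \<open>x - x ^ 3 / 6\<close> is at least \<open>x / 3\<close> on [0, 2], which contains
  [0, pi / 2].\<close>

lemma norm_one_minus_iexp_ge:
  assumes "\<bar>s\<bar> \<le> pi"
  shows "\<bar>s\<bar> / 3 \<le> norm (1 - iexp s)"
proof -
  define x where "x = \<bar>s\<bar> / 2"
  have x: "0 \<le> x" "x \<le> 2" using assms pi_less_4 by (auto simp: x_def)
  have "\<bar>sin x - (\<Sum>m<3. sin_coeff m * x ^ m)\<bar> \<le> inverse (fact 3) * \<bar>x\<bar> ^ 3"
    by (rule Maclaurin_sin_bound)
  then have "\<bar>sin x - x\<bar> \<le> x ^ 3 / 6"
    using x by (simp add: eval_nat_numeral sin_coeff_def fact_numeral)
  then have "x - x ^ 3 / 6 \<le> sin x"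
    by linarith
  moreover have "x ^ 3 \<le> 4 * x"
  proof -
    have "x * x ^ 2 \<le> x * 2 ^ 2" using x by (intro mult_left_mono power_mono) auto
    then show ?thesis by (simp add: power3_eq_cube power2_eq_square)
  qed
  ultimately have "x / 3 \<le> sin x" by simp
  moreover have "norm (1 - iexp s) = 2 * \<bar>sin x\<bar>"
    using dist_exp_i_1[of s] by (auto simp: norm_minus_commute x_def abs_if)
  ultimately show ?thesis using x by (simp add: x_def)
qed

lemma iexp_eq_1_iff_small:
  assumes "\<bar>s\<bar> \<le> pi"
  shows "iexp s = 1 \<longleftrightarrow> s = 0"
  using norm_one_minus_iexp_ge[OF assms] by auto

lemma has_bochner_integral_iexp_period:
  fixes c :: real and m :: int
  assumes c: "0 < c"
  shows "has_bochner_integral lborel (\<lambda>t. indicator {-(pi*c)..pi*c} t *\<^sub>R iexp (t * (of_int m / c)))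
           (if m = 0 then 2 * pi * c else 0)"
proof (cases "m = 0")
  case True
  have "has_bochner_integral lborel (\<lambda>t. indicator {-(pi*c)..pi*c} t *\<^sub>R (1::complex))
      (measure lborel {-(pi*c)..pi*c} *\<^sub>R 1)"
    by (rule has_bochner_integral_indicator) (auto simp: emeasure_lborel_Icc_eq)
  then show ?thesis using True c by (simp add: scaleR_conv_of_real algebra_simps)
next
  case False
  define w where "w = complex_of_real (of_int m / c)"
  have w: "w \<noteq> 0" using False c by (simp add: w_def)
  define F where "F t = exp (\<i> * w * complex_of_real t) / (\<i> * w)" for t
  have "has_bochner_integral lborel (\<lambda>t. indicator {-(pi*c)..pi*c} t *\<^sub>R exp (\<i> * w * complex_of_real t))
          (F (pi*c) - F (-(pi*c)))"
  proof (rule has_bochner_integral_FTC_Icc)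
    show "- (pi * c) \<le> pi * c" using c by simp
    show "(F has_vector_derivative exp (\<i> * w * complex_of_real x)) (at x within {-(pi*c)..pi*c})" for x
      unfolding F_def using w
      by (auto intro!: derivative_eq_intros has_vector_derivative_real_field)
    show "continuous_on {-(pi*c)..pi*c} (\<lambda>t. exp (\<i> * w * complex_of_real t))"
      by (intro continuous_intros)
  qed
  moreover have "exp (\<i> * w * complex_of_real (pi*c)) = exp (\<i> * w * complex_of_real (-(pi*c)))"
  proof -
    have "\<i> * w * complex_of_real (pi*c) - \<i> * w * complex_of_real (-(pi*c)) = 2 * of_real pi * \<i> * of_int m"
      using c by (simp add: w_def)
    then have "exp (\<i> * w * complex_of_real (pi*c) - \<i> * w * complex_of_real (-(pi*c))) = 1"
      by (metis exp_2pi_1_int mult.commute mult.assoc)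
    then show ?thesis by (simp only: exp_diff) simp
  qed
  then have "F (pi*c) = F (-(pi*c))" by (simp add: F_def)
  ultimately show ?thesis using False by (simp add: w_def mult_ac)
qed

text \<open>\<open>k\<close> ranges over the integers because the coefficients are later sampled at
  \<open>\<lfloor>y * lam ^ n\<rfloor>\<close> for every real \<open>y\<close>; the value 0 for
  negative \<open>k\<close> makes the density vanish on the negative axis.\<close>

lemma integral_poly_iexp:
  fixes P :: "real poly" and c :: real and k :: int
  assumes c: "0 < c"
  shows "has_bochner_integral lborel
     (\<lambda>t. indicator {-(pi*c)..pi*c} t *\<^sub>R (poly (cpoly P) (iexp (t / c)) * iexp (-(t * (of_int k / c)))))
     (2 * pi * c * (if k < 0 then 0 else coeff P (nat k)))"
proof -
  have "has_bochner_integral lborel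
     (\<lambda>t. \<Sum>l\<le>degree P. complex_of_real (coeff P l) *
        (indicator {-(pi*c)..pi*c} t *\<^sub>R iexp (t * (of_int (int l - k) / c))))
     (\<Sum>l\<le>degree P. complex_of_real (coeff P l) * (if int l - k = 0 then 2 * pi * c else 0))"
    by (intro has_bochner_integral_sum has_bochner_integral_mult_right has_bochner_integral_iexp_period c)
  also have "(\<Sum>l\<le>degree P. complex_of_real (coeff P l) * (if int l - k = 0 then 2 * pi * c else 0)) =
      complex_of_real (2 * pi * c * (if k < 0 then 0 else coeff P (nat k)))"
  proof (cases "k < 0")
    case True
    then show ?thesis by (auto intro!: sum.neutral)
  next
    case False
    then have "(int l - k = 0) = (l = nat k)" for l by auto
    then have "(\<Sum>l\<le>degree P. complex_of_real (coeff P l) * (if int l - k = 0 then 2 * pi * c else 0)) =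
       (\<Sum>l\<le>degree P. if nat k = l then complex_of_real (coeff P l) * (2 * pi * c) else 0)"
      by (intro sum.cong) auto
    also have "\<dots> = complex_of_real (coeff P (nat k)) * (2 * pi * c)"
      by (simp add: coeff_eq_0)
    finally show ?thesis using False by simp
  qed
  also have "(\<lambda>t. \<Sum>l\<le>degree P. complex_of_real (coeff P l) *
        (indicator {-(pi*c)..pi*c} t *\<^sub>R iexp (t * (of_int (int l - k) / c)))) =
     (\<lambda>t. indicator {-(pi*c)..pi*c} t *\<^sub>R (poly (cpoly P) (iexp (t / c)) * iexp (-(t * (of_int k / c)))))"
  proof
    fix t
    have "iexp (t * (of_int (int l - k) / c)) = iexp (t / c) ^ l * iexp (-(t * (of_int k / c)))" for l
      by (simp add: exp_of_nat_mult[symmetric] mult_exp_exp field_simps diff_divide_distrib)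
    then show "(\<Sum>l\<le>degree P. complex_of_real (coeff P l) *
        (indicator {-(pi*c)..pi*c} t *\<^sub>R iexp (t * (of_int (int l - k) / c)))) =
      indicator {-(pi*c)..pi*c} t *\<^sub>R (poly (cpoly P) (iexp (t / c)) * iexp (-(t * (of_int k / c))))"
      by (cases "t \<in> {-(pi*c)..pi*c}") (simp_all add: poly_cpoly sum_distrib_left mult_ac)
  qed
  finally show ?thesis .
qed

lemma integrable_powr_tail:
  fixes e :: real
  assumes "1 < e"
  shows "integrable lborel (\<lambda>t. if \<bar>t\<bar> \<le> 1 then 1 else \<bar>t\<bar> powr (- e))"
proof -
  have tail: "integrable lborel (\<lambda>t. indicator {1..} t * t powr (- e))"
  proof (rule integrableI_nonneg)
    have "((\<lambda>t. t powr (- e)) has_integral - (1 powr (- e + 1)) / (- e + 1)) {1..}"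
      using assms by (intro has_integral_powr_to_inf) auto
    then have "(\<integral>\<^sup>+t. indicator {1..} t * t powr (- e) \<partial>lborel) = - (1 powr (- e + 1)) / (- e + 1)"
      by (intro nn_integral_has_integral_lebesgue) auto
    then show "(\<integral>\<^sup>+t. ennreal (indicator {1..} t * t powr (- e)) \<partial>lborel) < \<infinity>"
      by simp
  qed auto
  have tail': "integrable lborel (\<lambda>t. indicator {1..} (- t) * (- t) powr (- e))"
    using lborel_integrable_real_affine[OF tail, of "-1" 0] by simp
  have "integrable lborel (\<lambda>t. indicator {-1..1} t + (indicator {1..} t * t powr (- e) + indicator {1..} (- t) * (- t) powr (- e)))"
    by (intro Bochner_Integration.integrable_add tail tail') auto
  then show ?thesis
    by (rule Bochner_Integration.integrable_bound) (auto simp: indicator_def abs_if)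
qed

context branching
begin

text \<open>On the circle the generating function has period \<open>2 * pi * lam ^ n\<close> in
  \<open>t\<close>. Keeping a single period turns the coefficient formula into an integral over the
  whole line, where one integrable function can dominate all \<open>n\<close>.\<close>

definition phi_n :: "nat \<Rightarrow> real \<Rightarrow> complex" where
  "phi_n n t = indicator {-(pi * lam ^ n)..pi * lam ^ n} t *\<^sub>R (f ^^ n) (iexp (t / lam ^ n))"

lemma phi_n_measurable [measurable]: "phi_n n \<in> borel_measurable borel"
proof -
  have "continuous_on UNIV (\<lambda>t. (f ^^ n) (iexp (t / lam ^ n)))"
    unfolding poly_gen_poly[symmetric] by (intro continuous_intros) (use lam_pos in auto)
  then have "(\<lambda>t. (f ^^ n) (iexp (t / lam ^ n))) \<in> borel_measurable borel"
    by (rule borel_measurable_continuous_onI)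
  then show ?thesis unfolding phi_n_def by measurable
qed

lemma norm_phi_n_le_1: "norm (phi_n n t) \<le> 1"
  using norm_funpow_f_le[of "iexp (t / lam ^ n)" n] by (auto simp: phi_n_def indicator_def)

lemma dominating_function:
  obtains D :: "real \<Rightarrow> real"
  where "integrable lborel D" "\<And>n t. norm (phi_n n t) \<le> D t" "\<And>t. 0 \<le> D t"
proof -
  obtain C where C: "0 < C"
    "\<And>z n. norm z = 1 \<Longrightarrow> z \<noteq> 1 \<Longrightarrow> norm ((f ^^ n) z) \<le> C * (lam ^ n * norm (1 - z)) powr (- \<alpha>)"
    using norm_iterate_le by blast
  \<comment> \<open>1 serves \<open>\<bar>t\<bar> \<le> 1\<close>; the factor
    \<open>3 powr \<alpha>\<close> comes from the chord bound
    \<open>norm_one_minus_iexp_ge\<close>.\<close>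
  define C' where "C' = max 1 (C * 3 powr \<alpha>)"
  define D :: "real \<Rightarrow> real" where "D t = C' * (if \<bar>t\<bar> \<le> 1 then 1 else \<bar>t\<bar> powr (- \<alpha>))" for t
  have C': "1 \<le> C'" "C * 3 powr \<alpha> \<le> C'" by (auto simp: C'_def)
  show thesis
  proof (rule that)
    show "integrable lborel D"
      unfolding D_def by (intro Bochner_Integration.integrable_mult_right integrable_powr_tail alpha_gt_1)
    show "0 \<le> D t" for t using C' by (simp add: D_def)
    show "norm (phi_n n t) \<le> D t" for n t
    proof (cases "\<bar>t\<bar> \<le> 1 \<or> \<bar>t\<bar> > pi * lam ^ n")
      case True
      then show ?thesis using norm_phi_n_le_1[of n t] C' by (auto simp: D_def phi_n_def indicator_def)
    next
      case False
      define s where "s = t / lam ^ n"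
      have ln: "0 < lam ^ n" using lam_pos by simp
      have s: "\<bar>s\<bar> \<le> pi" "s \<noteq> 0" "lam ^ n * \<bar>s\<bar> = \<bar>t\<bar>"
        using False ln lam_pos by (auto simp: s_def field_simps abs_mult)
      have "norm ((f ^^ n) (iexp s)) \<le> C * (lam ^ n * norm (1 - iexp s)) powr (- \<alpha>)"
        using s iexp_eq_1_iff_small[of s] by (intro C) auto
      also have "\<dots> \<le> C * (\<bar>t\<bar> / 3) powr (- \<alpha>)"
      proof (intro mult_left_mono powr_mono2')
        have "lam ^ n * (\<bar>s\<bar> / 3) \<le> lam ^ n * norm (1 - iexp s)"
          using norm_one_minus_iexp_ge[of s] s ln by (intro mult_left_mono) auto
        then show "\<bar>t\<bar> / 3 \<le> lam ^ n * norm (1 - iexp s)" using s by simp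
      qed (use C alpha_gt_1 False in auto)
      also have "\<dots> = C * 3 powr \<alpha> * \<bar>t\<bar> powr (- \<alpha>)"
        by (simp add: powr_divide powr_minus field_simps)
      also have "\<dots> \<le> C' * \<bar>t\<bar> powr (- \<alpha>)"
        using C' by (intro mult_right_mono) auto
      finally show ?thesis using False
        by (auto simp: D_def phi_n_def s_def indicator_def)
    qed
  qed
qed

lemma phi_n_power_integrable:
  assumes "1 \<le> j"
  shows "integrable lborel (\<lambda>t. phi_n n t ^ j * iexp (-(t * y)))"
proof -
  obtain D where D: "integrable lborel D" "\<And>n t. norm (phi_n n t) \<le> D t" "\<And>t. 0 \<le> D t"
    using dominating_function by blast
  show ?thesis
  proof (rule Bochner_Integration.integrable_bound[OF D(1)])
    show "AE t in lborel. norm (phi_n n t ^ j * iexp (- (t * y))) \<le> norm (D t)"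
    proof (rule AE_I2)
      fix t
      have "norm (phi_n n t) ^ j \<le> norm (phi_n n t) ^ 1"
        using assms norm_phi_n_le_1 by (intro power_decreasing) auto
      then show "norm (phi_n n t ^ j * iexp (- (t * y))) \<le> norm (D t)"
        using D(2)[of n t] D(3)[of t] by (simp add: norm_mult norm_power)
    qed
  qed measurable
qed

lemma coef_fourier:
  fixes k :: int
  assumes j: "1 \<le> j"
  shows "(\<integral>t. phi_n n t ^ j * iexp (-(t * (of_int k / lam ^ n))) \<partial>lborel) =
    complex_of_real (2 * pi * (lam ^ n * (if k < 0 then 0 else coef j n (nat k))))"
proof -
  have "(\<lambda>t. phi_n n t ^ j * iexp (-(t * (of_int k / lam ^ n)))) =
    (\<lambda>t. indicator {-(pi*lam^n)..pi*lam^n} t *\<^sub>R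
       (poly (cpoly (gen_poly n ^ j)) (iexp (t / lam^n)) * iexp (-(t * (of_int k / lam^n)))))"
    using j by (auto simp: phi_n_def fun_eq_iff cpoly_power poly_gen_poly indicator_def)
  then show ?thesis
    using has_bochner_integral_integral_eq[OF integral_poly_iexp[of "lam ^ n" "gen_poly n ^ j" k]] lam_pos
    by (simp add: coef_def)
qed

text \<open>The constant is uniform in \<open>j\<close> too: as
  \<open>norm (phi_n n t) \<le> 1\<close>, higher powers only shrink the integrand.\<close>

lemma coef_bound:
  obtains B where "0 < B" "\<And>j n k. 1 \<le> j \<Longrightarrow> lam ^ n * coef j n k \<le> B"
proof -
  obtain D where D: "integrable lborel D" "\<And>n t. norm (phi_n n t) \<le> D t" "\<And>t. 0 \<le> D t"
    using dominating_function by blast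
  have I: "0 \<le> integral\<^sup>L lborel D" using D by simp
  show thesis
  proof (rule that)
    show "0 < integral\<^sup>L lborel D + 1" using I by simp
    fix j n k :: nat assume j: "1 \<le> j"
    have "norm (\<integral>t. phi_n n t ^ j * iexp (-(t * (of_int (int k) / lam ^ n))) \<partial>lborel) \<le>
      (\<integral>t. norm (phi_n n t ^ j * iexp (-(t * (of_int (int k) / lam ^ n)))) \<partial>lborel)"
      by (rule integral_norm_bound)
    also have "\<dots> \<le> integral\<^sup>L lborel D"
    proof (rule integral_mono)
      fix t
      have "norm (phi_n n t) ^ j \<le> norm (phi_n n t) ^ 1"
        using j norm_phi_n_le_1 by (intro power_decreasing) auto
      then show "norm (phi_n n t ^ j * iexp (- (t * (of_int (int k) / lam ^ n)))) \<le> D t"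
        using D(2)[of n t] by (simp add: norm_mult norm_power)
    qed (rule integrable_norm[OF phi_n_power_integrable[OF j]], rule D(1))
    finally have "norm (\<integral>t. phi_n n t ^ j * iexp (-(t * (of_int (int k) / lam ^ n))) \<partial>lborel) \<le>
      integral\<^sup>L lborel D" .
    then have "2 * pi * (lam ^ n * coef j n k) \<le> integral\<^sup>L lborel D"
      unfolding coef_fourier[OF j] using lam_pos coef_nonneg[of j n k]
      by (simp add: abs_mult norm_mult norm_power)
    moreover have "1 * (lam ^ n * coef j n k) \<le> 2 * pi * (lam ^ n * coef j n k)"
      using pi_gt3 lam_pos coef_nonneg[of j n k] by (intro mult_right_mono) auto
    ultimately show "lam ^ n * coef j n k \<le> integral\<^sup>L lborel D + 1" by simp
  qed
qed

end

section \<open>Tail bounds\<close>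

context branching
begin

section \<open>Factorial moments and Markov's inequality\<close>

lemma gen_poly_deriv1: "poly (pderiv (gen_poly n)) 1 = lam ^ n"
proof (induction n)
  case (Suc n)
  then show ?case
    by (simp add: pderiv_add pderiv_smult pderiv_mult power2_eq_square poly_gen_poly_1 q_def lam_def algebra_simps)
qed (simp add: pderiv_pCons)

text \<open>The second factorial moment satisfies
  \<open>x' = lam * x + 2 * p * lam ^ (2 * n)\<close>. The constant 2 reproduces itself because
  \<open>lam + p = 1 + 2 * p\<close> is at most \<open>lam ^ 2\<close>.\<close>

lemma gen_poly_deriv2: "poly (pderiv (pderiv (gen_poly n))) 1 \<le> 2 * lam ^ (2 * n)"
proof (induction n)
  case (Suc n)
  let ?x = "poly (pderiv (pderiv (gen_poly n))) 1"
  have "poly (pderiv (pderiv (gen_poly (Suc n)))) 1 = lam * ?x + 2 * p * lam ^ (2 * n)"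
    by (simp add: pderiv_add pderiv_smult pderiv_mult power2_eq_square poly_gen_poly_1 gen_poly_deriv1
        q_def lam_def power_mult algebra_simps flip: power_mult_distrib)
  also have "\<dots> \<le> lam * (2 * lam ^ (2 * n)) + 2 * p * lam ^ (2 * n)"
    using Suc lam_pos by (intro add_right_mono mult_left_mono) auto
  also have "\<dots> = 2 * (lam + p) * lam ^ (2 * n)" by (simp add: algebra_simps)
  also have "\<dots> \<le> 2 * lam ^ 2 * lam ^ (2 * n)"
    using lam_pos by (intro mult_right_mono mult_left_mono) (auto simp: lam_def power2_eq_square algebra_simps)
  finally show ?case by (simp add: power2_eq_square)
qed (simp add: pderiv_pCons)

text \<open>The constant 6 reproduces itself because \<open>lam + 2 * p = 1 + 3 * p\<close> is at
  most \<open>lam ^ 3\<close>.\<close>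

lemma gen_poly_deriv3: "poly (pderiv (pderiv (pderiv (gen_poly n)))) 1 \<le> 6 * lam ^ (3 * n)"
proof (induction n)
  case (Suc n)
  let ?y = "poly (pderiv (pderiv (gen_poly n))) 1"
  let ?x = "poly (pderiv (pderiv (pderiv (gen_poly n)))) 1"
  have "poly (pderiv (pderiv (pderiv (gen_poly (Suc n))))) 1 = lam * ?x + 6 * p * (lam ^ n * ?y)"
    by (simp add: pderiv_add pderiv_smult pderiv_mult power2_eq_square poly_gen_poly_1 gen_poly_deriv1
        q_def lam_def algebra_simps)
  also have "\<dots> \<le> lam * (6 * lam ^ (3 * n)) + 6 * p * (lam ^ n * (2 * lam ^ (2 * n)))"
    using Suc lam_pos p_pos by (intro add_mono mult_left_mono gen_poly_deriv2) auto
  also have "\<dots> = 6 * (lam + 2 * p) * lam ^ (3 * n)"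
    by (simp add: algebra_simps power_add[symmetric])
  also have "\<dots> \<le> 6 * lam ^ 3 * lam ^ (3 * n)"
    using lam_pos p_pos
    by (intro mult_right_mono mult_left_mono) (auto simp: lam_def power3_eq_cube algebra_simps)
  finally show ?case by (simp add: power_add power3_eq_cube mult_ac del: gen_poly.simps)
qed (simp add: pderiv_pCons)

text \<open>Markov's inequality for the third factorial moment. For \<open>k \<ge> 3\<close> the
  product \<open>k * (k - 1) * (k - 2)\<close> is at least \<open>2 / 9 * k ^ 3\<close>, with
  equality at 3, and \<open>6 / (2 / 9) = 27\<close>. For \<open>x < 3\<close> the bound is already
  at least the total mass 1.\<close>

lemma tail_bound:
  fixes x :: real
  assumes x: "0 < x" and S: "finite S" "\<And>k. k \<in> S \<Longrightarrow> x \<le> real k"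
  shows "(\<Sum>k\<in>S. coef 1 n k) \<le> 27 * lam ^ (3 * n) / x ^ 3"
proof (cases "x < 3")
  case True
  then have "x ^ 3 \<le> 3 ^ 3" using x by (intro power_mono) auto
  moreover have "1 \<le> lam ^ (3 * n)" using lam_gt_1 by simp
  ultimately have "1 \<le> 27 * lam ^ (3 * n) / x ^ 3" using x by (simp add: divide_simps)
  then show ?thesis using sum_coef_le_1[OF S(1), of 1 n] by simp
next
  case False
  define R where "R = pderiv (pderiv (pderiv (gen_poly n)))"
  have R: "coeff R l = real (l + 1) * real (l + 2) * real (l + 3) * coeff (gen_poly n) (l + 3)" for l
    by (simp add: R_def coeff_pderiv numeral_3_eq_3)
  have k3: "3 \<le> k" if "k \<in> S" for k using S(2)[OF that] False by linarith
  have "(2 / 9 * x ^ 3) * (\<Sum>k\<in>S. coef 1 n k) \<le> (\<Sum>k\<in>S. coeff R (k - 3))"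
    unfolding sum_distrib_left
  proof (rule sum_mono)
    fix k assume k: "k \<in> S"
    obtain l where l: "k = l + 3" using k3[OF k] by (metis add.commute le_Suc_ex)
    have "2 / 9 * x ^ 3 \<le> 2 / 9 * real k ^ 3"
      using S(2)[OF k] x by (intro mult_left_mono power_mono) auto
    also have "\<dots> \<le> real (l + 1) * real (l + 2) * real (l + 3)"
      by (simp add: l power3_eq_cube algebra_simps)
    finally have "2 / 9 * x ^ 3 * coef 1 n k \<le> real (l + 1) * real (l + 2) * real (l + 3) * coef 1 n k"
      by (rule mult_right_mono) (rule coef_nonneg)
    also have "\<dots> = coeff R (k - 3)"
      by (simp add: R l coef_def)
    finally show "2 / 9 * x ^ 3 * coef 1 n k \<le> coeff R (k - 3)" .
  qed
  also have "\<dots> = (\<Sum>l\<in>(\<lambda>k. k - 3) ` S. coeff R l)"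
    by (subst sum.reindex) (auto intro!: inj_onI dest!: k3)
  also have "\<dots> \<le> poly R 1"
    using S(1) by (intro coeff_sum_le_poly_1) (auto simp: R coeff_gen_poly_nonneg)
  also have "\<dots> \<le> 6 * lam ^ (3 * n)" unfolding R_def by (rule gen_poly_deriv3)
  finally show ?thesis using x by (simp add: field_simps)
qed

text \<open>
  If two independent sizes add up to \<open>k\<close>, one of them is at least \<open>k / 2\<close>; its tail is bounded by the
  third moment, the other size by the uniform bound. As \<open>q < lam ^ 2\<close>, the resulting recursion in the
  generation is contracting.
\<close>

lemma coef_1_cube_bound:
  obtains K where "0 < K" "\<And>n k. real k ^ 3 * coef 1 n k \<le> K * lam ^ (2 * n)"
proof -
  obtain B where B: "0 < B" "\<And>j n k. 1 \<le> j \<Longrightarrow> lam ^ n * coef j n k \<le> B"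
    using coef_bound by blast
  have d: "0 < lam\<^sup>2 - q" using lam_gt_1 q_less_1 by (simp add: power2_eq_square) (smt (verit) mult_le_cancel_left1)
  \<comment> \<open>The fraction solves \<open>q * K + 432 * B * p = lam\<^sup>2 * K\<close>; the 1
    covers generation 0, whose only nonzero coefficient is at \<open>k = 1\<close>. The factor 432
    is \<open>2 * 27 * 2 ^ 3\<close>: two symmetric halves, the constant of
    \<open>tail_bound\<close>, and the cut at \<open>k / 2\<close>.\<close>
  define K where "K = 1 + 432 * B * p / (lam\<^sup>2 - q)"
  have K: "1 \<le> K" using B d p_pos by (simp add: K_def)
  have step: "q * K + p * (432 * B) \<le> lam\<^sup>2 * K"
  proof -
    have "432 * B * p = (432 * B * p / (lam\<^sup>2 - q)) * (lam\<^sup>2 - q)" using d by simp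
    also have "\<dots> \<le> K * (lam\<^sup>2 - q)" using d by (intro mult_right_mono) (auto simp: K_def)
    finally show ?thesis by (simp add: algebra_simps)
  qed
  have conv: "real k ^ 3 * coef 2 n k \<le> 432 * B * lam ^ (2 * n)" for n k
  proof (cases "k = 0")
    case False
    define a where "a = coef 1 n"
    have a0: "0 \<le> a l" for l by (simp add: a_def coef_nonneg)
    have aB: "a l \<le> B / lam ^ n" for l
      using B(2)[of 1 n l] lam_pos by (simp add: a_def field_simps)
    have "coef 2 n k = (\<Sum>l\<le>k. a l * a (k - l))"
      using coef_add[of 1 1 n k] by (simp add: a_def numeral_2_eq_2)
    also have "\<dots> \<le> (\<Sum>l\<le>k. B / lam ^ n * (if k \<le> 2 * l then a l else 0) +
                                 B / lam ^ n * (if k \<le> 2 * (k - l) then a (k - l) else 0))"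
    proof (rule sum_mono)
      fix l assume "l \<in> {..k}"
      then have "k \<le> 2 * l \<or> k \<le> 2 * (k - l)" by auto
      moreover have "a l * a (k - l) \<le> B / lam ^ n * a (k - l)"
        by (rule mult_right_mono[OF aB a0])
      moreover have "a (k - l) * a l \<le> B / lam ^ n * a l"
        by (rule mult_right_mono[OF aB a0])
      moreover have "0 \<le> B / lam ^ n * a l" "0 \<le> B / lam ^ n * a (k - l)"
        using B a0 lam_pos by auto
      ultimately show "a l * a (k - l) \<le> B / lam ^ n * (if k \<le> 2 * l then a l else 0) +
           B / lam ^ n * (if k \<le> 2 * (k - l) then a (k - l) else 0)"
        by (auto simp: mult.commute)
    qed
    also have "\<dots> = B / lam ^ n * (\<Sum>l\<le>k. if k \<le> 2 * l then a l else 0) +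
                     B / lam ^ n * (\<Sum>l\<le>k. if k \<le> 2 * (k - l) then a (k - l) else 0)"
      by (simp only: sum.distrib sum_distrib_left)
    also have "(\<Sum>l\<le>k. if k \<le> 2 * (k - l) then a (k - l) else 0) = (\<Sum>l\<le>k. if k \<le> 2 * l then a l else 0)"
      by (rule sum.reindex_bij_witness[of _ "\<lambda>l. k - l" "\<lambda>l. k - l"]) auto
    also have "B / lam ^ n * (\<Sum>l\<le>k. if k \<le> 2 * l then a l else 0) +
        B / lam ^ n * (\<Sum>l\<le>k. if k \<le> 2 * l then a l else 0) =
        2 * B / lam ^ n * (\<Sum>l\<in>{l. l \<le> k \<and> k \<le> 2 * l}. a l)"
    proof -
      have "(\<Sum>l\<le>k. if k \<le> 2 * l then a l else 0) = (\<Sum>l\<in>{l. l \<le> k \<and> k \<le> 2 * l}. a l)"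
        using sum.inter_filter[of "{..k}" a "\<lambda>l. k \<le> 2 * l"] by simp
      then show ?thesis by simp
    qed
    also have "\<dots> \<le> 2 * B / lam ^ n * (27 * lam ^ (3 * n) / (real k / 2) ^ 3)"
      unfolding a_def using B lam_pos False by (intro mult_left_mono tail_bound) auto
    also have "\<dots> = 432 * B * lam ^ (2 * n) / real k ^ 3"
    proof -
      have "lam ^ (3 * n) = lam ^ (2 * n) * lam ^ n" by (simp flip: power_add)
      then show ?thesis using lam_pos by (simp add: power_divide)
    qed
    finally show ?thesis using False by (simp add: field_simps)
  qed (use B lam_pos in simp)
  show thesis
  proof (rule that[of K])
    show "0 < K" using K by simp
    fix n k :: nat
    show "real k ^ 3 * coef 1 n k \<le> K * lam ^ (2 * n)"
    proof (induction n)
      case 0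
      show ?case using K by (auto simp: coef_def coeff_pCons split: nat.splits)
    next
      case (Suc n)
      have "real k ^ 3 * coef 1 (Suc n) k = q * (real k ^ 3 * coef 1 n k) + p * (real k ^ 3 * coef 2 n k)"
        unfolding coef_Suc_gen by (simp add: algebra_simps)
      also have "\<dots> \<le> q * (K * lam ^ (2 * n)) + p * (432 * B * lam ^ (2 * n))"
        using Suc conv p_pos q_pos by (intro add_mono mult_left_mono) auto
      also have "\<dots> = (q * K + p * (432 * B)) * lam ^ (2 * n)" by (simp add: algebra_simps)
      also have "\<dots> \<le> (lam\<^sup>2 * K) * lam ^ (2 * n)"
        using step lam_pos by (intro mult_right_mono) auto
      finally show ?case by (simp add: power2_eq_square mult_ac)
    qed
  qed
qed

text \<open>One of the parts \<open>l\<close> and \<open>k - l\<close> is at least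
  \<open>k / 2\<close>, so \<open>k ^ 3 \<le> 8 * l ^ 3 + 8 * (k - l) ^ 3\<close>. The cube is spent
  on one factor of the convolution and the other is summed to at most 1.\<close>

lemma coef_cube_bound:
  assumes "1 \<le> j"
  obtains K where "0 < K" "\<And>n k. real k ^ 3 * coef j n k \<le> K * lam ^ (2 * n)"
proof -
  obtain K1 where K1: "0 < K1" "\<And>n k. real k ^ 3 * coef 1 n k \<le> K1 * lam ^ (2 * n)"
    using coef_1_cube_bound by blast
  have "\<exists>K>0. \<forall>n k. real k ^ 3 * coef j n k \<le> K * lam ^ (2 * n)"
    using assms
  proof (induction j rule: nat_induct_at_least)
    case base then show ?case using K1 by auto
  next
    case (Suc j)
    then obtain K where K: "0 < K" "\<And>n k. real k ^ 3 * coef j n k \<le> K * lam ^ (2 * n)" by auto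
    have "real k ^ 3 * coef (Suc j) n k \<le> 8 * (K1 + K) * lam ^ (2 * n)" for n k
    proof -
      have "real k ^ 3 * coef (Suc j) n k = (\<Sum>l\<le>k. real k ^ 3 * (coef 1 n l * coef j n (k - l)))"
        using coef_add[of 1 j n k] by (simp add: sum_distrib_left)
      also have "\<dots> \<le> (\<Sum>l\<le>k. 8 * K1 * lam ^ (2 * n) * coef j n (k - l) + 8 * K * lam ^ (2 * n) * coef 1 n l)"
      proof (rule sum_mono)
        fix l assume l: "l \<in> {..k}"
        have "real k ^ 3 \<le> 8 * real l ^ 3 + 8 * real (k - l) ^ 3"
        proof (cases "k \<le> 2 * l")
          case True
          then have "real k ^ 3 \<le> (2 * real l) ^ 3" by (intro power_mono) auto
          then show ?thesis by (simp add: power_mult_distrib add_increasing2)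
        next
          case False
          then have "real k ^ 3 \<le> (2 * real (k - l)) ^ 3" using l by (intro power_mono) auto
          then show ?thesis by (simp add: power_mult_distrib add_increasing)
        qed
        then have "real k ^ 3 * (coef 1 n l * coef j n (k - l)) \<le>
          (8 * real l ^ 3 + 8 * real (k - l) ^ 3) * (coef 1 n l * coef j n (k - l))"
          using coef_nonneg by (intro mult_right_mono) auto
        also have "\<dots> = 8 * (real l ^ 3 * coef 1 n l) * coef j n (k - l) +
            8 * (real (k - l) ^ 3 * coef j n (k - l)) * coef 1 n l"
          by (simp add: algebra_simps)
        also have "\<dots> \<le> 8 * (K1 * lam ^ (2 * n)) * coef j n (k - l) + 8 * (K * lam ^ (2 * n)) * coef 1 n l"
          using coef_nonneg K1 K by (intro add_mono mult_right_mono mult_left_mono) auto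
        finally show "real k ^ 3 * (coef 1 n l * coef j n (k - l)) \<le>
          8 * K1 * lam ^ (2 * n) * coef j n (k - l) + 8 * K * lam ^ (2 * n) * coef 1 n l"
          by (simp add: mult.assoc)
      qed
      also have "\<dots> = 8 * K1 * lam ^ (2 * n) * (\<Sum>l\<le>k. coef j n (k - l)) + 8 * K * lam ^ (2 * n) * (\<Sum>l\<le>k. coef 1 n l)"
        by (simp add: sum.distrib sum_distrib_left)
      also have "(\<Sum>l\<le>k. coef j n (k - l)) = (\<Sum>l\<le>k. coef j n l)"
        by (rule sum.reindex_bij_witness[of _ "\<lambda>l. k - l" "\<lambda>l. k - l"]) auto
      also have "8 * K1 * lam ^ (2 * n) * (\<Sum>l\<le>k. coef j n l) + 8 * K * lam ^ (2 * n) * (\<Sum>l\<le>k. coef 1 n l) \<le>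
        8 * K1 * lam ^ (2 * n) * 1 + 8 * K * lam ^ (2 * n) * 1"
        using K1 K lam_pos by (intro add_mono mult_left_mono sum_coef_le_1) auto
      finally show ?thesis by (simp add: algebra_simps)
    qed
    then show ?case using K K1 by (intro exI[of _ "8 * (K1 + K)"]) auto
  qed
  then show thesis using that by auto
qed

end

section \<open>The limit density\<close>

lemma power_le_self: "0 \<le> x \<Longrightarrow> x \<le> 1 \<Longrightarrow> 1 \<le> j \<Longrightarrow> x ^ j \<le> (x::real)"
  using power_decreasing[of 1 j x] by simp

text \<open>\<open>\<phi>\<close> will be the characteristic function of \<open>W\<close>. Assuming
  pointwise convergence of the iterates keeps the analysis separate from the probability
  space.\<close>

locale branching_limit = branching +
  fixes \<phi> :: "real \<Rightarrow> complex"
  assumes iterate_tendsto: "\<And>t. (\<lambda>n. (f ^^ n) (iexp (t / lam ^ n))) \<longlonglongrightarrow> \<phi> t"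
begin

lemma lam_power_at_top: "filterlim (\<lambda>n. lam ^ n) at_top sequentially"
  by (rule filterlim_at_infinity_imp_filterlim_at_top[OF filterlim_realpow_sequentially_gt1])
     (use lam_gt_1 in auto)

lemma phi_n_tendsto: "(\<lambda>n. phi_n n t) \<longlonglongrightarrow> \<phi> t"
proof -
  have "eventually (\<lambda>n. \<bar>t\<bar> \<le> lam ^ n) sequentially"
    using lam_power_at_top by (simp add: filterlim_at_top)
  then have "eventually (\<lambda>n. (f ^^ n) (iexp (t / lam ^ n)) = phi_n n t) sequentially"
  proof eventually_elim
    case (elim n)
    have "1 * lam ^ n \<le> pi * lam ^ n" using lam_pos pi_gt3 by (intro mult_right_mono) auto
    then show ?case using elim by (auto simp: phi_n_def indicator_def abs_le_iff)
  qed
  then show ?thesis using iterate_tendsto[of t] by (rule Lim_transform_eventually[rotated])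
qed

lemma phi_measurable [measurable]: "\<phi> \<in> borel_measurable borel"
  by (rule borel_measurable_LIMSEQ_metric[OF phi_n_measurable phi_n_tendsto])

lemma norm_phi_le_1: "norm (\<phi> t) \<le> 1"
  by (rule LIMSEQ_le_const2[OF tendsto_norm[OF phi_n_tendsto]]) (use norm_phi_n_le_1 in auto)

lemma phi_dominated:
  obtains D :: "real \<Rightarrow> real"
  where "integrable lborel D" "\<And>n t. norm (phi_n n t) \<le> D t" "\<And>t. norm (\<phi> t) \<le> D t"
proof -
  obtain D where D: "integrable lborel D" "\<And>n t. norm (phi_n n t) \<le> D t" "\<And>t. 0 \<le> D t"
    using dominating_function by blast
  have "norm (\<phi> t) \<le> D t" for t
    by (rule LIMSEQ_le_const2[OF tendsto_norm[OF phi_n_tendsto]]) (use D(2) in auto)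
  then show thesis using D that by blast
qed

lemma phi_power_integrable:
  assumes "1 \<le> j"
  shows "integrable lborel (\<lambda>t. \<phi> t ^ j * iexp (-(t * y)))"
proof -
  obtain D where D: "integrable lborel D" "\<And>n t. norm (phi_n n t) \<le> D t" "\<And>t. norm (\<phi> t) \<le> D t"
    using phi_dominated by blast
  show ?thesis
  proof (rule Bochner_Integration.integrable_bound[OF D(1)])
    show "AE t in lborel. norm (\<phi> t ^ j * iexp (- (t * y))) \<le> norm (D t)"
    proof (rule AE_I2)
      fix t
      show "norm (\<phi> t ^ j * iexp (- (t * y))) \<le> norm (D t)"
        using D(3)[of t] power_le_self[of "norm (\<phi> t)" j] norm_phi_le_1[of t] assms
        by (simp add: norm_mult norm_power)
    qed
  qed measurable
qed

text \<open>The Fourier inversion formula; \<open>\<phi> t ^ j\<close> will be the characteristic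
  function of \<open>V\<close>.\<close>

definition vc :: "nat \<Rightarrow> real \<Rightarrow> complex" where
  "vc j y = (\<integral>t. \<phi> t ^ j * iexp (-(t * y)) \<partial>lborel) / (2 * pi)"

definition v :: "nat \<Rightarrow> real \<Rightarrow> real" where
  "v j y = Re (vc j y)"

text \<open>Bounds the local limit error for all \<open>k\<close> at once, because the kernel of the
  inversion integral has modulus 1.\<close>

definition err :: "nat \<Rightarrow> nat \<Rightarrow> real" where
  "err j n = (\<integral>t. norm (phi_n n t ^ j - \<phi> t ^ j) \<partial>lborel)"

definition coefz :: "nat \<Rightarrow> nat \<Rightarrow> int \<Rightarrow> real" where
  "coefz j n k = (if k < 0 then 0 else coef j n (nat k))"

lemma err_tendsto:
  assumes j: "1 \<le> j"
  shows "err j \<longlonglongrightarrow> 0"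
proof -
  obtain D where D: "integrable lborel D" "\<And>n t. norm (phi_n n t) \<le> D t" "\<And>t. norm (\<phi> t) \<le> D t"
    using phi_dominated by blast
  have "(\<lambda>n. \<integral>t. norm (phi_n n t ^ j - \<phi> t ^ j) \<partial>lborel) \<longlonglongrightarrow> (\<integral>t. 0 \<partial>(lborel :: real measure))"
  proof (rule integral_dominated_convergence)
    show "integrable lborel (\<lambda>t. 2 * D t)" using D by simp
    show "AE t in lborel. (\<lambda>n. norm (phi_n n t ^ j - \<phi> t ^ j)) \<longlonglongrightarrow> 0"
    proof (rule AE_I2)
      fix t
      have "(\<lambda>n. norm (phi_n n t ^ j - \<phi> t ^ j)) \<longlonglongrightarrow> norm (\<phi> t ^ j - \<phi> t ^ j)"
        by (intro tendsto_intros phi_n_tendsto)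
      then show "(\<lambda>n. norm (phi_n n t ^ j - \<phi> t ^ j)) \<longlonglongrightarrow> 0" by simp
    qed
    show "AE t in lborel. norm (norm (phi_n n t ^ j - \<phi> t ^ j)) \<le> 2 * D t" for n
    proof (rule AE_I2)
      fix t
      have "norm (phi_n n t ^ j - \<phi> t ^ j) \<le> norm (phi_n n t) ^ j + norm (\<phi> t) ^ j"
        by (metis norm_power norm_triangle_ineq4)
      also have "\<dots> \<le> norm (phi_n n t) + norm (\<phi> t)"
        using norm_phi_n_le_1 norm_phi_le_1 j by (intro add_mono power_le_self) auto
      finally show "norm (norm (phi_n n t ^ j - \<phi> t ^ j)) \<le> 2 * D t"
        using D(2)[of n t] D(3)[of t] by simp
    qed
  qed measurable
  then show ?thesis by (simp add: err_def[abs_def])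
qed

lemma local_limit_complex:
  assumes j: "1 \<le> j"
  shows "norm (complex_of_real (lam ^ n * coefz j n k) - vc j (of_int k / lam ^ n)) \<le> err j n"
proof -
  let ?e = "\<lambda>t. iexp (-(t * (of_int k / lam ^ n)))"
  have "complex_of_real (lam ^ n * coefz j n k) - vc j (of_int k / lam ^ n) =
      ((\<integral>t. phi_n n t ^ j * ?e t \<partial>lborel) - (\<integral>t. \<phi> t ^ j * ?e t \<partial>lborel)) / (2 * pi)"
    unfolding coef_fourier[OF j] vc_def coefz_def by (simp add: diff_divide_distrib)
  also have "\<dots> = (\<integral>t. (phi_n n t ^ j - \<phi> t ^ j) * ?e t \<partial>lborel) / (2 * pi)"
    by (subst Bochner_Integration.integral_diff[symmetric])
       (rule phi_n_power_integrable[OF j] phi_power_integrable[OF j] | simp add: left_diff_distrib)+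
  finally have "norm (complex_of_real (lam ^ n * coefz j n k) - vc j (of_int k / lam ^ n)) =
      norm (\<integral>t. (phi_n n t ^ j - \<phi> t ^ j) * ?e t \<partial>lborel) / (2 * pi)"
    by (simp add: norm_divide norm_mult)
  also have "\<dots> \<le> norm (\<integral>t. (phi_n n t ^ j - \<phi> t ^ j) * ?e t \<partial>lborel) / 1"
    using pi_gt3 by (intro divide_left_mono) auto
  also have "\<dots> \<le> (\<integral>t. norm ((phi_n n t ^ j - \<phi> t ^ j) * ?e t) \<partial>lborel)"
    using integral_norm_bound by simp
  also have "\<dots> = err j n" by (simp add: err_def norm_mult)
  finally show ?thesis .
qed

lemma local_limit:
  assumes j: "1 \<le> j"
  shows "\<bar>lam ^ n * coefz j n k - v j (of_int k / lam ^ n)\<bar> \<le> err j n"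
  using abs_Re_le_cmod[of "complex_of_real (lam ^ n * coefz j n k) - vc j (of_int k / lam ^ n)"]
    local_limit_complex[OF j, of n k] by (simp add: v_def)

lemma continuous_vc:
  assumes j: "1 \<le> j"
  shows "isCont (vc j) y"
proof (rule continuous_at_sequentiallyI)
  fix u :: "nat \<Rightarrow> real" assume u: "u \<longlonglongrightarrow> y"
  obtain D where D: "integrable lborel D" "\<And>n t. norm (phi_n n t) \<le> D t" "\<And>t. norm (\<phi> t) \<le> D t"
    using phi_dominated by blast
  have "(\<lambda>n. \<integral>t. \<phi> t ^ j * iexp (-(t * u n)) \<partial>lborel) \<longlonglongrightarrow> (\<integral>t. \<phi> t ^ j * iexp (-(t * y)) \<partial>lborel)"
  proof (rule integral_dominated_convergence)
    show "integrable lborel D" by fact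
    show "AE t in lborel. (\<lambda>n. \<phi> t ^ j * iexp (- (t * u n))) \<longlonglongrightarrow> \<phi> t ^ j * iexp (- (t * y))"
      by (intro AE_I2 tendsto_intros u)
    show "AE t in lborel. norm (\<phi> t ^ j * iexp (- (t * u n))) \<le> D t" for n
    proof (rule AE_I2)
      fix t
      show "norm (\<phi> t ^ j * iexp (- (t * u n))) \<le> D t"
        using D(3)[of t] power_le_self[of "norm (\<phi> t)" j] norm_phi_le_1[of t] j
        by (simp add: norm_mult norm_power)
    qed
  qed measurable
  then show "(\<lambda>n. vc j (u n)) \<longlonglongrightarrow> vc j y"
    unfolding vc_def by (intro tendsto_divide) auto
qed

text \<open>Presents the density as a pointwise limit of rescaled coefficients. That it is real, its
  sign, support and bounds are all read off from this limit.\<close>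

lemma coefz_tendsto_vc:
  assumes j: "1 \<le> j"
  shows "(\<lambda>n. complex_of_real (lam ^ n * coefz j n \<lfloor>y * lam ^ n\<rfloor>)) \<longlonglongrightarrow> vc j y"
proof -
  have "(\<lambda>n. of_int \<lfloor>y * lam ^ n\<rfloor> / lam ^ n) \<longlonglongrightarrow> y"
  proof (rule LIM_zero_cancel, rule Lim_null_comparison)
    show "eventually (\<lambda>n. norm (of_int \<lfloor>y * lam ^ n\<rfloor> / lam ^ n - y) \<le> 1 / lam ^ n) sequentially"
    proof (rule always_eventually, rule allI)
      fix n
      have "of_int \<lfloor>y * lam ^ n\<rfloor> / lam ^ n - y = (of_int \<lfloor>y * lam ^ n\<rfloor> - y * lam ^ n) / lam ^ n"
        using lam_pos by (simp add: field_simps)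
      moreover have "\<bar>of_int \<lfloor>y * lam ^ n\<rfloor> - y * lam ^ n\<bar> \<le> 1" by linarith
      ultimately show "norm (of_int \<lfloor>y * lam ^ n\<rfloor> / lam ^ n - y) \<le> 1 / lam ^ n"
        using lam_pos by (simp add: divide_right_mono)
    qed
    show "(\<lambda>n. 1 / lam ^ n) \<longlonglongrightarrow> 0"
      by (rule tendsto_divide_0[OF tendsto_const filterlim_at_top_imp_at_infinity[OF lam_power_at_top]])
  qed
  then have 1: "(\<lambda>n. vc j (of_int \<lfloor>y * lam ^ n\<rfloor> / lam ^ n)) \<longlonglongrightarrow> vc j y"
    by (rule isCont_tendsto_compose[OF continuous_vc[OF j]])
  have "(\<lambda>n. complex_of_real (lam ^ n * coefz j n \<lfloor>y * lam ^ n\<rfloor>) - vc j (of_int \<lfloor>y * lam ^ n\<rfloor> / lam ^ n)) \<longlonglongrightarrow> 0"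
    by (rule Lim_null_comparison[OF always_eventually err_tendsto[OF j]])
       (use local_limit_complex[OF j] in auto)
  from tendsto_add[OF this 1] show ?thesis by simp
qed

lemma coefz_tendsto_v: "1 \<le> j \<Longrightarrow> (\<lambda>n. lam ^ n * coefz j n \<lfloor>y * lam ^ n\<rfloor>) \<longlonglongrightarrow> v j y"
  using tendsto_Re[OF coefz_tendsto_vc[of j y]] by (simp add: v_def)

lemma vc_eq_v: "1 \<le> j \<Longrightarrow> vc j y = complex_of_real (v j y)"
  using tendsto_Im[OF coefz_tendsto_vc[of j y]]
  by (simp add: v_def complex_eq_iff LIMSEQ_const_iff)

lemma isCont_v: "1 \<le> j \<Longrightarrow> isCont (v j) y"
  unfolding v_def by (intro isCont_Re continuous_vc)

lemma continuous_on_v: "1 \<le> j \<Longrightarrow> continuous_on S (v j)"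
  using isCont_v continuous_at_imp_continuous_on by blast

lemma v_measurable [measurable]: "1 \<le> j \<Longrightarrow> v j \<in> borel_measurable borel"
  by (intro borel_measurable_continuous_onI continuous_on_v)

lemma v_nonneg: "1 \<le> j \<Longrightarrow> 0 \<le> v j y"
  by (rule LIMSEQ_le_const[OF coefz_tendsto_v])
     (use lam_pos in \<open>auto simp: coefz_def coef_nonneg\<close>)

lemma v_neg_eq_0:
  assumes "1 \<le> j" "y < 0" shows "v j y = 0"
proof -
  have "y * lam ^ n < 0" for n using assms lam_pos by (simp add: mult_neg_pos)
  then have "coefz j n \<lfloor>y * lam ^ n\<rfloor> = 0" for n by (simp add: coefz_def)
  then show ?thesis using coefz_tendsto_v[OF assms(1), of y] by (simp add: LIMSEQ_const_iff)
qed

lemma v_bounded: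
  obtains B where "0 < B" "\<And>j n k. 1 \<le> j \<Longrightarrow> lam ^ n * coef j n k \<le> B" "\<And>j y. 1 \<le> j \<Longrightarrow> v j y \<le> B"
proof -
  obtain B where B: "0 < B" "\<And>j n k. 1 \<le> j \<Longrightarrow> lam ^ n * coef j n k \<le> B"
    using coef_bound by blast
  have "v j y \<le> B" if "1 \<le> j" for j y
    by (rule LIMSEQ_le_const2[OF coefz_tendsto_v[OF that]]) (use B that in \<open>auto simp: coefz_def\<close>)
  then show thesis using that B by blast
qed

lemma v_cube_bound:
  assumes j: "1 \<le> j"
  obtains K where "0 < K" "\<And>n k. real k ^ 3 * coef j n k \<le> K * lam ^ (2 * n)"
    "\<And>y. 0 < y \<Longrightarrow> y ^ 3 * v j y \<le> K"
proof -
  obtain K where K: "0 < K" "\<And>n k. real k ^ 3 * coef j n k \<le> K * lam ^ (2 * n)"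
    using coef_cube_bound[OF j] by blast
  have "y ^ 3 * v j y \<le> 8 * K" if y: "0 < y" for y
  proof (rule LIMSEQ_le_const2)
    show "(\<lambda>n. y ^ 3 * (lam ^ n * coefz j n \<lfloor>y * lam ^ n\<rfloor>)) \<longlonglongrightarrow> y ^ 3 * v j y"
      by (intro tendsto_intros coefz_tendsto_v j)
    have "eventually (\<lambda>n. 1 / y \<le> lam ^ n) sequentially"
      using lam_power_at_top by (simp add: filterlim_at_top)
    then obtain N where N: "\<And>n. n \<ge> N \<Longrightarrow> 1 / y \<le> lam ^ n" by (auto simp: eventually_sequentially)
    show "\<exists>N. \<forall>n\<ge>N. y ^ 3 * (lam ^ n * coefz j n \<lfloor>y * lam ^ n\<rfloor>) \<le> 8 * K"
    proof (intro exI[of _ N] allI impI)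
      fix n assume "N \<le> n"
      then have yl: "1 \<le> y * lam ^ n" using N[of n] y by (simp add: field_simps)
      define k where "k = nat \<lfloor>y * lam ^ n\<rfloor>"
      have k: "\<lfloor>y * lam ^ n\<rfloor> = int k" unfolding k_def using yl by simp
      have "y * lam ^ n < of_int \<lfloor>y * lam ^ n\<rfloor> + 1" by linarith
      moreover have "1 \<le> \<lfloor>y * lam ^ n\<rfloor>" using yl by simp
      \<comment> \<open>For \<open>k \<ge> 1\<close> rounding down loses at most a factor 2, hence 8
        in the cube.\<close>
      ultimately have k2: "y * lam ^ n \<le> 2 * real k" unfolding k by simp
      have l3: "lam ^ (3 * n) = (lam ^ n) ^ 3" by (simp add: power_mult mult.commute)
      have "y ^ 3 * lam ^ (3 * n) * coef j n k \<le> (2 * real k) ^ 3 * coef j n k"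
        unfolding l3 power_mult_distrib[symmetric] using k2 yl coef_nonneg
        by (intro mult_right_mono power_mono) auto
      also have "\<dots> = 8 * (real k ^ 3 * coef j n k)" by (simp add: power_mult_distrib)
      also have "\<dots> \<le> 8 * (K * lam ^ (2 * n))" using K(2)[of k n] by simp
      finally have *: "y ^ 3 * lam ^ (3 * n) * coef j n k \<le> 8 * (K * lam ^ (2 * n))" .
      have "y ^ 3 * (lam ^ n * coef j n k) * lam ^ (2 * n) \<le> 8 * K * lam ^ (2 * n)"
      proof -
        have "lam ^ (3 * n) = lam ^ n * lam ^ (2 * n)" by (simp flip: power_add)
        then show ?thesis using * by (simp only: mult.assoc mult.left_commute mult.commute)
      qed
      then have "y ^ 3 * (lam ^ n * coef j n k) \<le> 8 * K"
        using lam_pos by simp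
      then show "y ^ 3 * (lam ^ n * coefz j n \<lfloor>y * lam ^ n\<rfloor>) \<le> 8 * K"
        by (simp add: coefz_def k)
    qed
  qed
  moreover have "real k ^ 3 * coef j n k \<le> 8 * K * lam ^ (2 * n)" for n k
  proof -
    have "K * lam ^ (2 * n) \<le> 8 * K * lam ^ (2 * n)" using K lam_pos by simp
    then show ?thesis using K(2)[of k n] by linarith
  qed
  ultimately show thesis using that[of "8 * K"] K by auto
qed

end

section \<open>Distributions with an integrable characteristic function\<close>

lemma iexp_difference_quotient:
  fixes a b t :: real
  assumes "a \<le> b" "t \<noteq> 0"
  shows "has_bochner_integral lborel (\<lambda>y. indicator {a..b} y *\<^sub>R iexp (-(t * y)))
           ((iexp (-(t * a)) - iexp (-(t * b))) / (\<i> * t))"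
proof -
  define F where "F y = exp (- \<i> * of_real t * of_real y) / (- \<i> * of_real t)" for y :: real
  have "has_bochner_integral lborel (\<lambda>y. indicator {a..b} y *\<^sub>R exp (- \<i> * of_real t * of_real y)) (F b - F a)"
  proof (rule has_bochner_integral_FTC_Icc)
    show "(F has_vector_derivative exp (- \<i> * of_real t * of_real y)) (at y within {a..b})" for y :: real
      unfolding F_def using assms
      by (auto intro!: derivative_eq_intros has_vector_derivative_real_field)
    show "continuous_on {a..b} (\<lambda>y. exp (- \<i> * of_real t * of_real y))"
      by (intro continuous_intros)
  qed fact
  moreover have "F b - F a = (iexp (-(t * a)) - iexp (-(t * b))) / (\<i> * t)"
    using assms by (simp add: F_def field_simps)
  ultimately show ?thesis by (simp add: mult.assoc)
qed

text \<open>Integrability of \<open>char M\<close> lets the truncated integrals of Levy's inversion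
  theorem converge to an integral over the whole line. The difference quotient is then an integral
  of exponentials over \<open>{a..b}\<close>, and Fubini's theorem applies.\<close>

lemma (in real_distribution) measure_Ioc_integrable_char:
  fixes a b :: real
  assumes int: "integrable lborel (char M)"
    and v: "\<And>y. complex_of_real (v y) = (\<integral>t. char M t * iexp (-(t * y)) \<partial>lborel) / (2 * pi)"
    and ab: "a \<le> b" "measure M {a} = 0" "measure M {b} = 0"
  shows "measure M {a<..b} = (\<integral>y. indicator {a..b} y * v y \<partial>lborel)"
proof -
  define F where "F t = (iexp (-(t * a)) - iexp (-(t * b))) / (\<i> * t)" for t :: real
  have [measurable]: "F \<in> borel_measurable borel" unfolding F_def by measurable
  have F_bound: "norm (F t) \<le> b - a" for t
  proof (cases "t = 0")
    case True then show ?thesis using ab by (simp add: F_def)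
  next
    case False
    have "F t = (iexp ((-t) * b) - iexp ((-t) * a)) / (\<i> * complex_of_real (-t))"
      by (simp add: F_def minus_divide_right[symmetric] minus_divide_left)
    moreover have "- t \<noteq> 0" using False by simp
    ultimately show ?thesis using Levy_Inversion_aux2[OF ab(1), of "-t"] by simp
  qed
  have "(\<lambda>T. \<integral>t. indicator {- real T<..<real T} t *\<^sub>R (F t * char M t) \<partial>lborel) \<longlonglongrightarrow> (\<integral>t. F t * char M t \<partial>lborel)"
  proof (rule integral_dominated_convergence)
    show "integrable lborel (\<lambda>t. (b - a) * norm (char M t))" using int by simp
    show "AE t in lborel. (\<lambda>T. indicator {- real T<..<real T} t *\<^sub>R (F t * char M t)) \<longlonglongrightarrow> F t * char M t"
    proof (rule AE_I2, rule tendsto_eventually)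
      fix t
      obtain N where "\<bar>t\<bar> < real N" using reals_Archimedean2 by blast
      then show "eventually (\<lambda>T. indicator {- real T<..<real T} t *\<^sub>R (F t * char M t) = F t * char M t) sequentially"
        by (intro eventually_sequentiallyI[of N]) (auto simp: indicator_def)
    qed
    show "AE t in lborel. norm (indicator {- real T<..<real T} t *\<^sub>R (F t * char M t)) \<le> (b - a) * norm (char M t)" for T
      using F_bound ab by (auto simp: norm_mult indicator_def intro!: mult_right_mono)
  qed measurable
  then have lim: "(\<lambda>T. 1 / (2 * pi) * (\<integral>t. indicator {- real T<..<real T} t *\<^sub>R (F t * char M t) \<partial>lborel))
      \<longlonglongrightarrow> 1 / (2 * pi) * (\<integral>t. F t * char M t \<partial>lborel)"
    by (intro tendsto_intros)
  have "(\<lambda>T. 1 / (2 * pi) * (\<integral>t. indicator {- real T<..<real T} t *\<^sub>R (F t * char M t) \<partial>lborel)) \<longlonglongrightarrow> of_real (measure M {a<..b})"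
    using Levy_Inversion[OF ab]
    by (simp add: interval_lebesgue_integral_def set_lebesgue_integral_def F_def)
  with lim have "of_real (measure M {a<..b}) = 1 / (2 * pi) * (\<integral>t. F t * char M t \<partial>lborel)"
    using LIMSEQ_unique by blast
  also have "(\<integral>t. F t * char M t \<partial>lborel) =
      (\<integral>t. (\<integral>y. char M t * (indicator {a..b} y *\<^sub>R iexp (-(t * y))) \<partial>lborel) \<partial>lborel)"
  proof (rule integral_cong_AE)
    \<comment> \<open>At \<open>t = 0\<close> division by zero makes \<open>F\<close> equal to 0,
      whereas the inner integral is \<open>(b - a) * char M 0\<close>; hence the exception of a null
      set.\<close>
    show "AE t in lborel. F t * char M t = (\<integral>y. char M t * (indicator {a..b} y *\<^sub>R iexp (-(t * y))) \<partial>lborel)"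
      using AE_lborel_singleton[of "0::real"]
    proof eventually_elim
      case (elim t)
      have "has_bochner_integral lborel (\<lambda>y. char M t * (indicator {a..b} y *\<^sub>R iexp (-(t * y)))) (char M t * F t)"
        unfolding F_def by (rule has_bochner_integral_mult_right) (rule iexp_difference_quotient[OF ab(1) elim])
      from has_bochner_integral_integral_eq[OF this] show ?case by (simp add: mult.commute)
    qed
  qed measurable
  also have "\<dots> = (\<integral>y. (\<integral>t. char M t * (indicator {a..b} y *\<^sub>R iexp (-(t * y))) \<partial>lborel) \<partial>lborel)"
  proof (rule lborel_pair.Fubini_integral[symmetric], rule lborel_pair.Fubini_integrable)
    have norm_eq: "norm (char M t * (indicator {a..b} y *\<^sub>R iexp (-(t * y)))) = indicator {a..b} y * norm (char M t)" for t y
      by (simp add: norm_mult)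
    have "(\<integral>y. indicator {a..b} y * norm (char M t) \<partial>lborel) = (b - a) * norm (char M t)" for t
      using ab by simp
    then have "(\<lambda>x. \<integral>y. norm (case (x, y) of (t, y) \<Rightarrow> char M t * (indicator {a..b} y *\<^sub>R iexp (-(t * y)))) \<partial>lborel)
        = (\<lambda>t. (b - a) * norm (char M t))"
      by (simp only: prod.case norm_eq)
    then show "integrable lborel (\<lambda>x. \<integral>y. norm (case (x, y) of (t, y) \<Rightarrow> char M t * (indicator {a..b} y *\<^sub>R iexp (-(t * y)))) \<partial>lborel)"
      using int by (simp only:) simp
    show "AE x in lborel. integrable lborel (\<lambda>y. case (x, y) of (t, y) \<Rightarrow> char M t * (indicator {a..b} y *\<^sub>R iexp (-(t * y))))"
    proof (rule AE_I2)
      fix t :: real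
      have "integrable lborel (\<lambda>y. indicator {a..b} y *\<^sub>R iexp (-(t * y)))"
        by (rule borel_integrable_compact) (auto intro!: continuous_intros)
      then show "integrable lborel (\<lambda>y. case (t, y) of (t, y) \<Rightarrow> char M t * (indicator {a..b} y *\<^sub>R iexp (-(t * y))))"
        unfolding prod.case by (rule integrable_mult_right)
    qed
  qed measurable
  also have "\<dots> = (\<integral>y. 2 * pi * complex_of_real (indicator {a..b} y * v y) \<partial>lborel)"
  proof (rule Bochner_Integration.integral_cong)
    fix y
    have "(\<integral>t. char M t * (indicator {a..b} y *\<^sub>R iexp (-(t * y))) \<partial>lborel) = indicator {a..b} y *\<^sub>R (\<integral>t. char M t * iexp (-(t * y)) \<partial>lborel)"
      by (simp flip: integral_scaleR_right)
    also have "(\<integral>t. char M t * iexp (-(t * y)) \<partial>lborel) = 2 * pi * complex_of_real (v y)"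
      using v[of y] by simp
    finally show "(\<integral>t. char M t * (indicator {a..b} y *\<^sub>R iexp (-(t * y))) \<partial>lborel) = 2 * pi * complex_of_real (indicator {a..b} y * v y)"
      by (simp add: scaleR_conv_of_real mult_ac)
  qed simp
  also have "\<dots> = 2 * pi * complex_of_real (\<integral>y. indicator {a..b} y * v y \<partial>lborel)"
    by (simp only: integral_mult_right_zero integral_complex_of_real)
  finally have "complex_of_real (measure M {a<..b}) = complex_of_real (\<integral>y. indicator {a..b} y * v y \<partial>lborel)"
    by simp
  then show ?thesis by (simp only: of_real_eq_iff)
qed

text \<open>The inversion formula requires endpoints without mass. Boundedness of \<open>v\<close>
  first excludes atoms, by enclosing a supposed atom between nearby points of mass zero; then the
  formula holds for all endpoints.\<close>

lemma (in real_distribution) density_of_integrable_char: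
  assumes int: "integrable lborel (char M)"
    and v: "\<And>y. complex_of_real (v y) = (\<integral>t. char M t * iexp (-(t * y)) \<partial>lborel) / (2 * pi)"
    and v_nonneg: "\<And>y. 0 \<le> v y" and v_cont: "continuous_on UNIV v"
  shows "M = density lborel v"
proof -
  define B where "B = (\<integral>t. norm (char M t) \<partial>lborel)"
  have B0: "0 \<le> B" by (simp add: B_def)
  have vB: "v y \<le> B" for y
  proof -
    have "v y = norm (complex_of_real (v y))" using v_nonneg by simp
    also have "\<dots> = norm (\<integral>t. char M t * iexp (-(t * y)) \<partial>lborel) / (2 * pi)"
      unfolding v by (simp add: norm_divide norm_mult)
    also have "\<dots> \<le> norm (\<integral>t. char M t * iexp (-(t * y)) \<partial>lborel) / 1"
      using pi_gt3 by (intro divide_left_mono) auto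
    also have "\<dots> \<le> (\<integral>t. norm (char M t * iexp (-(t * y))) \<partial>lborel)"
      using integral_norm_bound by simp
    finally show ?thesis by (simp add: B_def norm_mult)
  qed
  have v_meas [measurable]: "v \<in> borel_measurable borel"
    by (rule borel_measurable_continuous_onI[OF v_cont])
  have v_int: "integrable lborel (\<lambda>y. indicator {a..b} y * v y)" for a b
    using borel_integrable_compact[OF compact_Icc continuous_on_subset[OF v_cont], of a b] by simp
  have no_atom: "measure M {x} = 0" for x
  proof (rule ccontr)
    assume "measure M {x} \<noteq> 0"
    then have m: "0 < measure M {x}" by (simp add: zero_less_measure_iff)
    \<comment> \<open>An interval shorter than \<open>2 * \<delta>\<close> carries at most half the
      mass of the atom; \<open>B + 1\<close> keeps the denominator positive.\<close>
    define \<delta> where "\<delta> = measure M {x} / (4 * (B + 1))"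
    have \<delta>: "0 < \<delta>" using m B0 by (simp add: \<delta>_def)
    have cnt: "countable {x. measure M {x} > 0}" by (rule countable_atoms)
    obtain a where a: "a \<in> {x - \<delta><..<x}" "measure M {a} = 0"
      using real_interval_avoid_countable_set[OF _ cnt, of "x - \<delta>" x] \<delta> by (auto simp: zero_less_measure_iff)
    obtain b where b: "b \<in> {x<..<x + \<delta>}" "measure M {b} = 0"
      using real_interval_avoid_countable_set[OF _ cnt, of x "x + \<delta>"] \<delta> by (auto simp: zero_less_measure_iff)
    have "measure M {x} \<le> measure M {a<..b}"
      using a b by (intro finite_measure_mono) auto
    also have "\<dots> = (\<integral>y. indicator {a..b} y * v y \<partial>lborel)"
      using a b by (intro measure_Ioc_integrable_char[OF int v]) auto
    also have "\<dots> \<le> (\<integral>y. indicator {a..b} y * B \<partial>lborel)"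
    proof (rule integral_mono)
      show "integrable lborel (\<lambda>y. indicator {a..b} y * B)"
        by (intro integrable_mult_left integrable_real_indicator) (auto simp: emeasure_lborel_Icc_eq)
    qed (use vB v_int in \<open>auto simp: indicator_def\<close>)
    also have "\<dots> = (b - a) * B" using a b by simp
    also have "\<dots> \<le> (2 * \<delta>) * (B + 1)" using a b B0 by (intro mult_mono) auto
    also have "\<dots> = measure M {x} / 2" using B0 by (simp add: \<delta>_def field_simps)
    finally show False using m by simp
  qed
  have eq: "emeasure M {a<..b} = emeasure (density lborel v) {a<..b}" if ab: "a \<le> b" for a b
  proof -
    have "emeasure M {a<..b} = ennreal (\<integral>y. indicator {a..b} y * v y \<partial>lborel)"
      unfolding emeasure_eq_measure
      by (subst measure_Ioc_integrable_char[OF int v ab no_atom no_atom]) simp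
    also have "\<dots> = (\<integral>\<^sup>+y. ennreal (indicator {a..b} y * v y) \<partial>lborel)"
      using v_nonneg by (intro nn_integral_eq_integral[symmetric] v_int) (auto simp: indicator_def)
    also have "\<dots> = (\<integral>\<^sup>+y. ennreal (v y) * indicator {a<..b} y \<partial>lborel)"
    proof (rule nn_integral_cong_AE)
      show "AE y in lborel. ennreal (indicator {a..b} y * v y) = ennreal (v y) * indicator {a<..b} y"
        using AE_lborel_singleton[of a] by eventually_elim (auto simp: indicator_def)
    qed
    also have "\<dots> = emeasure (density lborel v) {a<..b}"
      by (subst emeasure_density) auto
    finally show ?thesis .
  qed
  show ?thesis
  proof (rule measure_eqI_generator_eq[where \<Omega>=UNIV and A="\<lambda>i::nat. {- real i<..real i}"])
    show "Int_stable (range (\<lambda>(a, b). {a<..b::real}))" by (auto simp: Int_stable_def)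
    show "sets M = sigma_sets UNIV (range (\<lambda>(a, b). {a<..b::real}))"
      "sets (density lborel v) = sigma_sets UNIV (range (\<lambda>(a, b). {a<..b::real}))"
      by (simp_all add: borel_sigma_sets_Ioc)
    show "emeasure M X = emeasure (density lborel v) X" if X: "X \<in> range (\<lambda>(a, b). {a<..b::real})" for X
    proof -
      obtain a b where "X = {a<..b}" using X by auto
      then show ?thesis using eq[of a b] by (cases "a \<le> b") auto
    qed
    show "(\<Union>i::nat. {- real i<..real i}) = UNIV" by (rule UN_Ioc_eq_UNIV)
  qed auto
qed

section \<open>The branching process\<close>

text \<open>Measurability is asked for the rows before \<open>n\<close>, so that the lemma also
  applies on the product space over these indices alone.\<close>

lemma generation_size_measurable:
  assumes "\<And>m i. m < n \<Longrightarrow> Z m i \<in> measurable N (count_space UNIV)"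
  shows "generation_size Z n \<in> measurable N (count_space UNIV)"
  using assms
proof (induction n)
  case 0
  have "generation_size Z 0 = (\<lambda>_. 1)" by (simp add: fun_eq_iff)
  then show ?case by simp
next
  case (Suc n)
  have D [measurable]: "generation_size Z n \<in> measurable N (count_space UNIV)"
    using Suc by simp
  have Z [measurable]: "Z n i \<in> measurable N (count_space UNIV)" for i
    using Suc.prems by simp
  have "(\<lambda>\<omega>. (\<lambda>d \<omega>. \<Sum>i<d. Z n i \<omega>) (generation_size Z n \<omega>) \<omega>) \<in> measurable N (count_space UNIV)"
    by (rule measurable_compose_countable[OF _ D]) measurable
  then show ?case by (simp add: generation_size.simps(2)[abs_def])
qed

lemma generation_size_cong:
  assumes "\<And>m i. m < n \<Longrightarrow> Z m i \<omega> = Z' m i \<omega>'"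
  shows "generation_size Z n \<omega> = generation_size Z' n \<omega>'"
  using assms by (induction n) auto

context branching
begin

lemma offspring_expectation:
  "measure_pmf.expectation (offspring_pmf p) (\<lambda>k. (z::complex) ^ k) = f z"
  using p_pos p_less_1
  by (simp add: offspring_pmf_def)
     (subst integral_measure_pmf[of UNIV], auto simp: UNIV_bool f_def q_def scaleR_conv_of_real algebra_simps)

text \<open>On the event that generation \<open>n\<close> has size \<open>d\<close>, the next size
  is a sum of \<open>d\<close> variables of row \<open>n\<close>. These are independent of the
  earlier rows, so averaging over them turns \<open>z\<close> into \<open>f z\<close>.\<close>

lemma generation_size_step:
  assumes M: "prob_space M" and iid: "iid_offspring M p \<xi>" and z: "norm z \<le> 1"
  shows "(\<integral>\<omega>. z ^ generation_size \<xi> (Suc n) \<omega> \<partial>M) = (\<integral>\<omega>. f z ^ generation_size \<xi> n \<omega> \<partial>M)"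
proof -
  interpret prob_space M by fact
  define X where "X = (\<lambda>(n, i). \<xi> n i)"
  have X: "indep_vars (\<lambda>_. count_space UNIV) X UNIV"
    and dist: "\<And>n i. distr M (count_space UNIV) (\<xi> n i) = measure_pmf (offspring_pmf p)"
    using iid by (auto simp: iid_offspring_def X_def)
  have meas [measurable]: "\<xi> n i \<in> measurable M (count_space UNIV)" for n i
    using X by (auto simp: indep_vars_def X_def)
  have D_meas [measurable]: "generation_size \<xi> n \<in> measurable M (count_space UNIV)" for n
    by (rule generation_size_measurable) measurable
  \<comment> \<open>\<open>A\<close> indexes the past, which determines the size of generation
    \<open>n\<close>; \<open>B\<close> indexes the reproduction of that generation.\<close>
  define A where "A = {(m, i::nat). m < n}"
  define B where "B = {n} \<times> (UNIV :: nat set)"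
  let ?D = "generation_size \<xi> n"
  have indep: "indep_var (PiM A (\<lambda>_. count_space UNIV)) (\<lambda>\<omega>. restrict (\<lambda>i. X i \<omega>) A)
       (PiM B (\<lambda>_. count_space UNIV)) (\<lambda>\<omega>. restrict (\<lambda>i. X i \<omega>) B)"
    by (rule indep_var_restrict[OF X]) (auto simp: A_def B_def)
  have offspring: "(\<integral>\<omega>. z ^ \<xi> n i \<omega> \<partial>M) = f z" for i
  proof -
    have "(\<integral>\<omega>. z ^ \<xi> n i \<omega> \<partial>M) = (\<integral>k. z ^ k \<partial>distr M (count_space UNIV) (\<xi> n i))"
      by (rule integral_distr[symmetric]) auto
    then show ?thesis by (simp add: dist offspring_expectation)
  qed
  have z_int: "integrable M (\<lambda>\<omega>. z ^ g \<omega>)" if [measurable]: "g \<in> measurable M (count_space UNIV)" for g :: "'a \<Rightarrow> nat"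
    by (rule integrable_const_bound[of _ 1]) (use z in \<open>auto simp: norm_power power_le_one\<close>)
  have fz: "norm (f z) \<le> 1" using norm_f_le'[OF z] z by simp
  have fixed: "(\<integral>\<omega>. of_bool (?D \<omega> = d) * z ^ generation_size \<xi> (Suc n) \<omega> \<partial>M) =
      (\<integral>\<omega>. of_bool (?D \<omega> = d) * f z ^ ?D \<omega> \<partial>M)" for d
  proof -
    define h1 :: "(nat \<times> nat \<Rightarrow> nat) \<Rightarrow> complex" where
      "h1 x = of_bool (generation_size (\<lambda>m i y. y (m, i)) n x = d)" for x
    define h2 :: "(nat \<times> nat \<Rightarrow> nat) \<Rightarrow> complex" where
      "h2 x = (\<Prod>i\<in>{n} \<times> {..<d}. z ^ x i)" for x
    have h1 [measurable]: "h1 \<in> borel_measurable (PiM A (\<lambda>_. count_space UNIV))"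
    proof -
      have [measurable]: "generation_size (\<lambda>m i y. y (m, i)) n \<in> measurable (PiM A (\<lambda>_. count_space UNIV)) (count_space UNIV)"
        by (rule generation_size_measurable) (auto simp: A_def intro!: measurable_component_singleton)
      show ?thesis unfolding h1_def by measurable
    qed
    have h2 [measurable]: "h2 \<in> borel_measurable (PiM B (\<lambda>_. count_space UNIV))"
      unfolding h2_def
    proof (rule borel_measurable_prod)
      fix i assume "i \<in> {n} \<times> {..<d}"
      then have "i \<in> B" by (auto simp: B_def)
      from measurable_component_singleton[OF this, of "\<lambda>_. count_space UNIV"]
      show "(\<lambda>x. z ^ x i) \<in> borel_measurable (PiM B (\<lambda>_. count_space UNIV))" by measurable
    qed
    have h1_eq: "h1 (restrict (\<lambda>i. X i \<omega>) A) = of_bool (?D \<omega> = d)" for \<omega>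
    proof -
      have "generation_size (\<lambda>m i y. y (m, i)) n (restrict (\<lambda>i. X i \<omega>) A) = ?D \<omega>"
        by (rule generation_size_cong) (auto simp: A_def X_def)
      then show ?thesis by (simp add: h1_def)
    qed
    have h2_eq: "h2 (restrict (\<lambda>i. X i \<omega>) B) = (\<Prod>i\<in>{n} \<times> {..<d}. z ^ X i \<omega>)" for \<omega>
      unfolding h2_def by (rule prod.cong) (auto simp: B_def)
    have h2_eq': "(\<Prod>i\<in>{n} \<times> {..<d}. z ^ X i \<omega>) = z ^ (\<Sum>i<d. \<xi> n i \<omega>)" for \<omega>
    proof -
      have "(\<Prod>i\<in>{n} \<times> {..<d}. z ^ X i \<omega>) = (\<Prod>i<d. z ^ \<xi> n i \<omega>)"
        by (rule prod.reindex_bij_witness[of _ "\<lambda>i. (n, i)" snd]) (auto simp: X_def)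
      then show ?thesis by (simp add: power_sum)
    qed
    have "indep_var borel (h1 \<circ> (\<lambda>\<omega>. restrict (\<lambda>i. X i \<omega>) A)) borel (h2 \<circ> (\<lambda>\<omega>. restrict (\<lambda>i. X i \<omega>) B))"
      by (rule indep_var_compose[OF indep]) measurable
    then have ind: "indep_var borel (\<lambda>\<omega>. of_bool (?D \<omega> = d) :: complex) borel (\<lambda>\<omega>. \<Prod>i\<in>{n} \<times> {..<d}. z ^ X i \<omega>)"
      by (simp add: comp_def h1_eq h2_eq)
    have int1: "integrable M (\<lambda>\<omega>. of_bool (?D \<omega> = d) :: complex)"
      by (rule integrable_const_bound[of _ 1]) auto
    have int2: "integrable M (\<lambda>\<omega>. \<Prod>i\<in>{n} \<times> {..<d}. z ^ X i \<omega>)"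
      unfolding h2_eq' by (rule z_int) measurable
    have "(\<integral>\<omega>. of_bool (?D \<omega> = d) * z ^ generation_size \<xi> (Suc n) \<omega> \<partial>M) =
        (\<integral>\<omega>. of_bool (?D \<omega> = d) * (\<Prod>i\<in>{n} \<times> {..<d}. z ^ X i \<omega>) \<partial>M)"
      unfolding h2_eq' by (rule Bochner_Integration.integral_cong) auto
    also have "\<dots> = (\<integral>\<omega>. of_bool (?D \<omega> = d) \<partial>M) * (\<integral>\<omega>. (\<Prod>i\<in>{n} \<times> {..<d}. z ^ X i \<omega>) \<partial>M)"
      by (rule indep_var_lebesgue_integral[OF ind int1 int2])
    also have "(\<integral>\<omega>. (\<Prod>i\<in>{n} \<times> {..<d}. z ^ X i \<omega>) \<partial>M) = (\<Prod>i\<in>{n} \<times> {..<d}. \<integral>\<omega>. z ^ X i \<omega> \<partial>M)"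
    proof (rule indep_vars_lebesgue_integral)
      show "indep_vars (\<lambda>_. borel) (\<lambda>i \<omega>. z ^ X i \<omega>) ({n} \<times> {..<d})"
        by (rule indep_vars_compose2[OF indep_vars_subset[OF X]]) auto
      show "integrable M (\<lambda>\<omega>. z ^ X i \<omega>)" if "i \<in> {n} \<times> {..<d}" for i
        by (rule z_int) (auto simp: X_def split: prod.splits)
    qed auto
    also have "\<dots> = (\<Prod>i\<in>{n} \<times> {..<d}. f z)"
      by (rule prod.cong) (auto simp: X_def offspring)
    also have "\<dots> = f z ^ d" by (simp add: card_cartesian_product)
    also have "(\<integral>\<omega>. of_bool (?D \<omega> = d) \<partial>M) * f z ^ d = (\<integral>\<omega>. of_bool (?D \<omega> = d) * f z ^ d \<partial>M)"
      by simp
    also have "\<dots> = (\<integral>\<omega>. of_bool (?D \<omega> = d) * f z ^ ?D \<omega> \<partial>M)"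
      by (rule Bochner_Integration.integral_cong) auto
    finally show ?thesis .
  qed
  \<comment> \<open>Recovers the full integral from the events \<open>?D \<omega> = d\<close> by
    dominated convergence.\<close>
  have trunc: "(\<lambda>N. \<integral>\<omega>. (\<Sum>d<N. of_bool (?D \<omega> = d) * g \<omega>) \<partial>M) \<longlonglongrightarrow> (\<integral>\<omega>. g \<omega> \<partial>M)"
    if [measurable]: "g \<in> borel_measurable M" and g: "\<And>\<omega>. norm (g \<omega>) \<le> 1" for g :: "'a \<Rightarrow> complex"
  proof (rule integral_dominated_convergence)
    have eq: "(\<Sum>d<N. of_bool (?D \<omega> = d) * g \<omega>) = of_bool (?D \<omega> < N) * g \<omega>" for N \<omega>
    proof -
      have "(\<Sum>d<N. of_bool (?D \<omega> = d) * g \<omega>) = (\<Sum>d<N. if ?D \<omega> = d then g \<omega> else 0)"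
        by (rule sum.cong) auto
      then show ?thesis by simp
    qed
    show "AE \<omega> in M. (\<lambda>N. \<Sum>d<N. of_bool (?D \<omega> = d) * g \<omega>) \<longlonglongrightarrow> g \<omega>"
      unfolding eq
    proof (rule AE_I2)
      fix \<omega>
      show "(\<lambda>N. of_bool (?D \<omega> < N) * g \<omega>) \<longlonglongrightarrow> g \<omega>"
        by (rule tendsto_eventually, rule eventually_sequentiallyI[of "Suc (?D \<omega>)"]) auto
    qed
    show "AE \<omega> in M. norm (\<Sum>d<N. of_bool (?D \<omega> = d) * g \<omega>) \<le> 1" for N
      unfolding eq using g by (auto simp: norm_mult)
    show "(\<lambda>\<omega>. \<Sum>d<N. of_bool (?D \<omega> = d) * g \<omega>) \<in> borel_measurable M" for N
      unfolding eq by measurable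
  qed simp_all
  have "(\<lambda>N. \<integral>\<omega>. (\<Sum>d<N. of_bool (?D \<omega> = d) * z ^ generation_size \<xi> (Suc n) \<omega>) \<partial>M)
      \<longlonglongrightarrow> (\<integral>\<omega>. z ^ generation_size \<xi> (Suc n) \<omega> \<partial>M)"
    by (rule trunc) (use z in \<open>auto simp: norm_power power_le_one simp del: generation_size.simps\<close>)
  moreover have "(\<lambda>N. \<integral>\<omega>. (\<Sum>d<N. of_bool (?D \<omega> = d) * f z ^ ?D \<omega>) \<partial>M)
      \<longlonglongrightarrow> (\<integral>\<omega>. f z ^ ?D \<omega> \<partial>M)"
    by (rule trunc) (use fz in \<open>auto simp: norm_power power_le_one\<close>)
  moreover have "(\<integral>\<omega>. (\<Sum>d<N. of_bool (?D \<omega> = d) * z ^ generation_size \<xi> (Suc n) \<omega>) \<partial>M) =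
      (\<integral>\<omega>. (\<Sum>d<N. of_bool (?D \<omega> = d) * f z ^ ?D \<omega>) \<partial>M)" for N
  proof -
    have i1: "integrable M (\<lambda>\<omega>. of_bool (?D \<omega> = d) * w ^ g \<omega>)"
      if [measurable]: "g \<in> measurable M (count_space UNIV)" and w: "norm w \<le> 1" for g :: "'a \<Rightarrow> nat" and w :: complex and d
      by (rule integrable_const_bound[of _ 1]) (use w in \<open>auto simp: norm_mult norm_power power_le_one\<close>)
    show ?thesis
      by (subst (1 2) Bochner_Integration.integral_sum) (auto intro!: i1 z fz simp: fixed simp del: generation_size.simps)
  qed
  ultimately show ?thesis using LIMSEQ_unique by (simp only:)
qed

lemma generation_size_pgf:
  assumes M: "prob_space M" and iid: "iid_offspring M p \<xi>" and z: "norm z \<le> 1"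
  shows "(\<integral>\<omega>. z ^ generation_size \<xi> n \<omega> \<partial>M) = (f ^^ n) z"
  using z
proof (induction n arbitrary: z)
  case 0
  then show ?case using prob_space.prob_space[OF M] by simp
next
  case (Suc n)
  have "norm (f z) \<le> 1" using norm_f_le'[of z] Suc.prems by simp
  then show ?case
    using generation_size_step[OF M iid Suc.prems] Suc.IH by (simp add: funpow_swap1 del: generation_size.simps)
qed

text \<open>The iterate is the characteristic function at \<open>t\<close> of the generation size
  divided by \<open>lam ^ n\<close>, so almost sure convergence gives pointwise convergence of the
  iterates.\<close>

lemma iterate_tendsto_char:
  assumes M: "prob_space M" and iid: "iid_offspring M p \<xi>" and W: "W \<in> borel_measurable M"
    and lim: "AE \<omega> in M. (\<lambda>n. real (generation_size \<xi> n \<omega>) / lam ^ n) \<longlonglongrightarrow> W \<omega>"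
  shows "(\<lambda>n. (f ^^ n) (iexp (t / lam ^ n))) \<longlonglongrightarrow> char (distr M borel W) t"
proof -
  interpret prob_space M by fact
  have meas [measurable]: "\<xi> n i \<in> measurable M (count_space UNIV)" for n i
    using iid by (auto simp: iid_offspring_def indep_vars_def)
  have D_meas [measurable]: "generation_size \<xi> n \<in> measurable M (count_space UNIV)" for n
    by (rule generation_size_measurable) measurable
  note W [measurable]
  have eq: "iexp (t / lam ^ n) ^ k = iexp (t * (real k / lam ^ n))" for n k
    by (simp add: exp_of_nat_mult[symmetric] mult_ac)
  have "(\<lambda>n. \<integral>\<omega>. iexp (t * (real (generation_size \<xi> n \<omega>) / lam ^ n)) \<partial>M) \<longlonglongrightarrow> (\<integral>\<omega>. iexp (t * W \<omega>) \<partial>M)"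
  proof (rule integral_dominated_convergence)
    show "AE \<omega> in M. (\<lambda>n. iexp (t * (real (generation_size \<xi> n \<omega>) / lam ^ n))) \<longlonglongrightarrow> iexp (t * W \<omega>)"
      using lim by eventually_elim (intro tendsto_intros)
    show "AE \<omega> in M. norm (iexp (t * (real (generation_size \<xi> n \<omega>) / lam ^ n))) \<le> 1" for n
      by simp
    show "(\<lambda>\<omega>. iexp (t * W \<omega>)) \<in> borel_measurable M" by measurable
    show "(\<lambda>\<omega>. iexp (t * (real (generation_size \<xi> n \<omega>) / lam ^ n))) \<in> borel_measurable M" for n by measurable
  qed simp
  moreover have "(\<integral>\<omega>. iexp (t * (real (generation_size \<xi> n \<omega>) / lam ^ n)) \<partial>M) = (f ^^ n) (iexp (t / lam ^ n))" for n
    using generation_size_pgf[OF M iid, of "iexp (t / lam ^ n)" n] by (simp only: eq) simp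
  moreover have "(\<integral>\<omega>. iexp (t * W \<omega>) \<partial>M) = char (distr M borel W) t"
    by (simp add: char_def integral_distr)
  ultimately show ?thesis by (simp only:)
qed

end

section \<open>Positivity of the limit density\<close>

context branching_limit
begin

lemma density_v:
  assumes N: "real_distribution N" and char: "\<And>t. char N t = \<phi> t ^ j" and j: "1 \<le> j"
  shows "N = density lborel (v j)"
proof -
  interpret real_distribution N by fact
  have char': "char N = (\<lambda>t. \<phi> t ^ j)" using char by auto
  show ?thesis
  proof (rule density_of_integrable_char)
    show "integrable lborel (char N)"
      using phi_power_integrable[OF j, of 0] by (simp add: char')
    show "complex_of_real (v j y) = (\<integral>t. char N t * iexp (-(t * y)) \<partial>lborel) / (2 * pi)" for y
      unfolding vc_eq_v[OF j, symmetric] by (simp add: vc_def char')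
  qed (auto intro: v_nonneg[OF j] continuous_on_v[OF j])
qed

text \<open>
  Positivity of the density near a point is expressed through the discrete probabilities, for which
  the branching property is an exact convolution identity.
\<close>

definition pos_at :: "nat \<Rightarrow> real \<Rightarrow> bool" where
  "pos_at j x \<longleftrightarrow> (\<exists>c>0. \<exists>e>0. \<exists>N. \<forall>n\<ge>N. \<forall>k. \<bar>real k / lam ^ n - x\<bar> < e \<longrightarrow> c \<le> lam ^ n * coef j n k)"

lemma eventually_lam_power_ge: "\<exists>N. \<forall>n\<ge>N. x \<le> lam ^ n"
  using lam_power_at_top by (auto simp: filterlim_at_top eventually_sequentially)

lemma v_pos_imp_pos_at:
  assumes j: "1 \<le> j" and x: "0 < v j x"
  shows "pos_at j x"
proof -
  \<comment> \<open>The value at \<open>x\<close> is \<open>2 * c\<close>; continuity and the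
    discretisation error cost at most \<open>c / 2\<close> each.\<close>
  define c where "c = v j x / 2"
  have c: "0 < c" using x by (simp add: c_def)
  obtain e where e: "0 < e" "\<And>y. \<bar>y - x\<bar> < e \<Longrightarrow> \<bar>v j y - v j x\<bar> < c / 2"
    using isCont_v[OF j, of x] c unfolding continuous_at_eps_delta
    by (metis dist_real_def half_gt_zero)
  obtain N where N: "\<And>n. n \<ge> N \<Longrightarrow> \<bar>err j n\<bar> < c / 2"
    using LIMSEQ_D[OF err_tendsto[OF j], of "c / 2"] c by auto
  show ?thesis unfolding pos_at_def
  proof (rule exI[of _ c], rule conjI[OF c], rule exI[of _ e], rule conjI[OF e(1)], rule exI[of _ N], intro allI impI)
    fix n k assume n: "N \<le> n" and k: "\<bar>real k / lam ^ n - x\<bar> < e"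
    have "\<bar>lam ^ n * coef j n k - v j (real k / lam ^ n)\<bar> \<le> err j n"
      using local_limit[OF j, of n "int k"] by (simp add: coefz_def)
    then show "c \<le> lam ^ n * coef j n k"
      using N[OF n] e(2)[OF k] by (simp add: c_def abs_if split: if_splits)
  qed
qed

lemma pos_at_imp_v_pos:
  assumes j: "1 \<le> j" and x: "0 \<le> x" and pos: "pos_at j x"
  shows "0 < v j x"
proof -
  obtain c e N where c: "0 < c" "0 < e"
    "\<And>n k. n \<ge> N \<Longrightarrow> \<bar>real k / lam ^ n - x\<bar> < e \<Longrightarrow> c \<le> lam ^ n * coef j n k"
    using pos unfolding pos_at_def by blast
  obtain N' where N': "\<And>n. n \<ge> N' \<Longrightarrow> 2 / e \<le> lam ^ n" using eventually_lam_power_ge by blast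
  have "c \<le> v j x"
  proof (rule LIMSEQ_le_const[OF coefz_tendsto_v[OF j]], intro exI[of _ "max N N'"] allI impI)
    fix n assume n: "max N N' \<le> n"
    define k where "k = nat \<lfloor>x * lam ^ n\<rfloor>"
    have fl: "0 \<le> \<lfloor>x * lam ^ n\<rfloor>" using x lam_pos by simp
    have "real k = of_int \<lfloor>x * lam ^ n\<rfloor>" using fl by (simp add: k_def)
    then have "\<bar>real k - x * lam ^ n\<bar> \<le> 1" by linarith
    moreover have "1 < e * lam ^ n" using N'[of n] n c by (simp add: field_simps)
    moreover have "real k / lam ^ n - x = (real k - x * lam ^ n) / lam ^ n" using lam_pos by (simp add: field_simps)
    ultimately have "\<bar>real k / lam ^ n - x\<bar> < e" using lam_pos by (simp add: abs_divide divide_simps)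
    then have "c \<le> lam ^ n * coef j n k" using c(3) n by simp
    then show "c \<le> lam ^ n * coefz j n \<lfloor>x * lam ^ n\<rfloor>" using fl by (simp add: coefz_def k_def)
  qed
  then show ?thesis using c by simp
qed

text \<open>About \<open>e * lam ^ n\<close> terms of the convolution have both scaled parts near
  \<open>x\<close> and \<open>y\<close>, and each is at least
  \<open>c1 * c2 / lam ^ (2 * n)\<close>. The total is of the required order
  \<open>1 / lam ^ n\<close>.\<close>

lemma pos_at_add:
  assumes x: "0 < x" and y: "0 < y" and pos: "pos_at i x" "pos_at j y"
  shows "pos_at (i + j) (x + y)"
proof -
  obtain c1 e1 N1 where c1: "0 < c1" "0 < e1"
    "\<And>n k. n \<ge> N1 \<Longrightarrow> \<bar>real k / lam ^ n - x\<bar> < e1 \<Longrightarrow> c1 \<le> lam ^ n * coef i n k"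
    using pos(1) unfolding pos_at_def by blast
  obtain c2 e2 N2 where c2: "0 < c2" "0 < e2"
    "\<And>n k. n \<ge> N2 \<Longrightarrow> \<bar>real k / lam ^ n - y\<bar> < e2 \<Longrightarrow> c2 \<le> lam ^ n * coef j n k"
    using pos(2) unfolding pos_at_def by blast
  \<comment> \<open>The part \<open>l\<close> will deviate from \<open>x\<close> by less than
    \<open>e\<close>, the part \<open>k - l\<close> from \<open>y\<close> by less than
    \<open>2 * e\<close>, and \<open>2 * e \<le> y\<close> forces \<open>l \<le> k\<close>. Once
    \<open>lam ^ n \<ge> 2 / e\<close>, rounding at most halves the number of terms.\<close>
  define e where "e = min (min e1 e2) y / 2"
  have e: "0 < e" "e < e1" "2 * e \<le> e2" "2 * e \<le> y" using c1 c2 y by (auto simp: e_def min_def)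
  obtain N3 where N3: "\<And>n. n \<ge> N3 \<Longrightarrow> 2 / e \<le> lam ^ n" using eventually_lam_power_ge by blast
  show ?thesis unfolding pos_at_def
  proof (rule exI[of _ "e / 2 * (c1 * c2)"], rule conjI, use e c1 c2 in simp,
      rule exI[of _ e], rule conjI[OF e(1)], rule exI[of _ "max N1 (max N2 N3)"], intro allI impI)
    fix n k assume n: "max N1 (max N2 N3) \<le> n" and k: "\<bar>real k / lam ^ n - (x + y)\<bar> < e"
    define s where "s = lam ^ n"
    have s: "0 < s" "2 \<le> e * s" using lam_pos N3[of n] n e by (auto simp: s_def field_simps)
    define L where "L = {nat \<lceil>x * s\<rceil>..<nat \<lceil>(x + e) * s\<rceil>}"
    have cardL: "e * s / 2 \<le> real (card L)"
    proof -
      have "x * s \<le> (x + e) * s" using e s by simp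
      then have "\<lceil>x * s\<rceil> \<le> \<lceil>(x + e) * s\<rceil>" by (rule ceiling_mono)
      moreover have "0 \<le> \<lceil>x * s\<rceil>" using x s mult_pos_pos[OF x s(1)] by linarith
      moreover have "real (nat B - nat A) = of_int B - of_int A" if "0 \<le> A" "A \<le> B" for A B :: int
        using that by (simp add: of_nat_diff nat_mono)
      ultimately have "real (card L) = of_int \<lceil>(x + e) * s\<rceil> - of_int \<lceil>x * s\<rceil>"
        unfolding L_def card_atLeastLessThan by metis
      then have "(x + e) * s - x * s - 1 \<le> real (card L)" by linarith
      then show ?thesis using s(2) by (simp add: algebra_simps)
    qed
    have L: "l \<le> k \<and> c1 * c2 / s\<^sup>2 \<le> coef i n l * coef j n (k - l)" if "l \<in> L" for l
    proof -
      have "x * s \<le> real l" "real l < (x + e) * s"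
        using that by (auto simp: L_def nat_le_iff zless_nat_eq_int_zless) linarith+
      then have l: "x \<le> real l / s" "real l / s < x + e" using s by (auto simp: field_simps)
      have k': "\<bar>real k / s - (x + y)\<bar> < e" using k by (simp add: s_def)
      then have "real l / s < real k / s" using l e by (simp add: abs_if split: if_splits)
      then have lk: "l \<le> k" using s by (simp add: divide_less_cancel)
      have "\<bar>real l / s - x\<bar> < e1" using l e by simp
      then have a: "c1 \<le> s * coef i n l" using c1(3)[of n l] n by (simp add: s_def)
      have "real (k - l) / s - y = (real k / s - (x + y)) - (real l / s - x)"
        using lk by (simp add: of_nat_diff diff_divide_distrib)
      then have "\<bar>real (k - l) / s - y\<bar> < e2" using l k' e by (simp add: abs_if split: if_splits)
      then have b: "c2 \<le> s * coef j n (k - l)" using c2(3)[of n "k - l"] n by (simp add: s_def)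
      have "c1 * c2 \<le> (s * coef i n l) * (s * coef j n (k - l))"
        using a b c1 c2 by (intro mult_mono) auto
      then have "c1 * c2 / s\<^sup>2 \<le> coef i n l * coef j n (k - l)"
        using s by (simp add: field_simps power2_eq_square)
      with lk show ?thesis by simp
    qed
    have "e * s / 2 * (c1 * c2 / s\<^sup>2) \<le> real (card L) * (c1 * c2 / s\<^sup>2)"
      using cardL c1 c2 s by (intro mult_right_mono) auto
    also have "\<dots> = (\<Sum>l\<in>L. c1 * c2 / s\<^sup>2)" by simp
    also have "\<dots> \<le> (\<Sum>l\<in>L. coef i n l * coef j n (k - l))"
      using L by (intro sum_mono) auto
    also have "\<dots> \<le> (\<Sum>l\<le>k. coef i n l * coef j n (k - l))"
      using L by (intro sum_mono2) (auto intro!: mult_nonneg_nonneg coef_nonneg)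
    also have "\<dots> = coef (i + j) n k" by (rule coef_add[symmetric])
    finally have "e * s / 2 * (c1 * c2 / s\<^sup>2) * s \<le> coef (i + j) n k * s"
      using s by (intro mult_right_mono) auto
    then show "e / 2 * (c1 * c2) \<le> lam ^ n * coef (i + j) n k"
      using s by (simp add: s_def[symmetric] power2_eq_square mult_ac)
  qed
qed

text \<open>The ancestor has one or two children, each case with probability at least
  \<open>r\<close>. Counting one more generation divides the scaled size by
  \<open>lam\<close>.\<close>

lemma pos_at_step:
  assumes "pos_at 1 x \<or> pos_at 2 x"
  shows "pos_at 1 (x / lam)"
proof -
  obtain i where i: "i = 1 \<or> i = 2" "pos_at i x" using assms by auto
  define r where "r = min p q"
  have r: "0 < r" using p_pos q_pos by (simp add: r_def)
  obtain c e N where c: "0 < c" "0 < e"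
    "\<And>n k. n \<ge> N \<Longrightarrow> \<bar>real k / lam ^ n - x\<bar> < e \<Longrightarrow> c \<le> lam ^ n * coef i n k"
    using i(2) unfolding pos_at_def by blast
  show ?thesis unfolding pos_at_def
  proof (rule exI[of _ "lam * (r * c)"], rule conjI, use r c lam_pos in simp,
      rule exI[of _ "e / lam"], rule conjI, use c lam_pos in simp,
      rule exI[of _ "Suc N"], intro allI impI)
    fix n' k assume n': "Suc N \<le> n'" and k: "\<bar>real k / lam ^ n' - x / lam\<bar> < e / lam"
    obtain n where n: "n' = Suc n" "N \<le> n" using n' by (cases n') auto
    have "real k / lam ^ n' - x / lam = (real k / lam ^ n - x) / lam"
      using lam_pos by (simp add: n field_simps)
    then have "\<bar>real k / lam ^ n - x\<bar> < e" using k lam_pos by (simp add: abs_divide divide_less_cancel)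
    then have "c \<le> lam ^ n * coef i n k" using c(3) n by simp
    then have "lam * (r * c) \<le> lam * (r * (lam ^ n * coef i n k))"
      using r lam_pos by (intro mult_left_mono) auto
    also have "\<dots> = lam ^ n' * (r * coef i n k)" by (simp add: n)
    also have "r * coef i n k \<le> q * coef 1 n k + p * coef 2 n k"
    proof -
      have "r * coef i n k \<le> q * coef 1 n k \<or> r * coef i n k \<le> p * coef 2 n k"
        using i(1) coef_nonneg[of i n k] by (auto simp: r_def intro: mult_right_mono)
      moreover have "0 \<le> q * coef 1 n k" "0 \<le> p * coef 2 n k" using p_pos q_pos coef_nonneg by auto
      ultimately show ?thesis by linarith
    qed
    also have "q * coef 1 n k + p * coef 2 n k = coef 1 n' k" by (simp only: n coef_Suc_gen)
    finally show "lam * (r * c) \<le> lam ^ n' * coef 1 n' k" using lam_pos by simp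
  qed
qed

lemma pos_at_steps: "pos_at 1 x \<Longrightarrow> pos_at 1 (x / lam ^ m)"
proof (induction m)
  case (Suc m)
  then show ?case using pos_at_step[of "x / lam ^ m"] by (simp add: mult.commute)
qed simp

text \<open>
  The set of reached points is invariant under multiplication by powers of \<open>lam\<close> and by the numbers
  \<open>1 + lam ^ (-i)\<close>. As these tend to 1, a single interval of positivity already spreads over the
  whole half-line.
\<close>

definition reached :: "real \<Rightarrow> bool" where
  "reached t \<longleftrightarrow> 0 < t \<and> (\<exists>m. pos_at 1 (t / lam ^ m))"

text \<open>With \<open>x = t / lam ^ m\<close>, two children that contribute \<open>x\<close> and
  \<open>x / lam ^ i\<close> add up to \<open>x * (1 + 1 / lam ^ i)\<close>. The step back to one
  ancestor divides by \<open>lam\<close>, which \<open>reached\<close> absorbs.\<close>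

lemma reached_mult:
  assumes "reached t"
  shows "reached (t * (1 + 1 / lam ^ i))"
proof -
  obtain m where m: "0 < t" "pos_at 1 (t / lam ^ m)" using assms by (auto simp: reached_def)
  have "pos_at 1 (t / lam ^ m / lam ^ i)" by (rule pos_at_steps[OF m(2)])
  with m have "pos_at (1 + 1) (t / lam ^ m + t / lam ^ m / lam ^ i)"
    using lam_pos by (intro pos_at_add) auto
  then have "pos_at 1 ((t / lam ^ m + t / lam ^ m / lam ^ i) / lam)"
    by (intro pos_at_step) (simp add: numeral_2_eq_2)
  moreover have "(t / lam ^ m + t / lam ^ m / lam ^ i) / lam = t * (1 + 1 / lam ^ i) / lam ^ Suc m"
    using lam_pos by (simp add: field_simps)
  moreover have "0 < t * (1 + 1 / lam ^ i)" using m lam_pos by (intro mult_pos_pos add_pos_pos) auto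
  ultimately show ?thesis unfolding reached_def by metis
qed

lemma reached_all:
  assumes x0: "0 < x0" "0 < v 1 x0" and t: "0 < t"
  shows "reached t"
proof -
  obtain e where e: "0 < e" "\<And>y. \<bar>y - x0\<bar> < e \<Longrightarrow> \<bar>v 1 y - v 1 x0\<bar> < v 1 x0"
    using isCont_v[of 1 x0] x0 unfolding continuous_at_eps_delta
    by (metis dist_real_def order_refl)
  \<comment> \<open>Makes \<open>[x0, x0 * s)\<close> shorter than \<open>e\<close>, so continuity
    settles a whole fundamental interval of multiplication by \<open>s\<close>.\<close>
  obtain i where i: "x0 / e < lam ^ i" using real_arch_pow[OF lam_gt_1] by blast
  define s where "s = 1 + 1 / lam ^ i"
  have s: "1 < s" "x0 * s < x0 + e"
    using i e x0 lam_pos by (auto simp: s_def field_simps)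
  have init: "reached y" if "x0 \<le> y" "y < x0 * s" for y
  proof -
    have "\<bar>v 1 y - v 1 x0\<bar> < v 1 x0" using that s by (intro e(2)) auto
    then have "pos_at 1 y" by (intro v_pos_imp_pos_at) auto
    then show ?thesis using that x0 unfolding reached_def by (intro conjI exI[of _ 0]) auto
  qed
  have big: "reached y" if y: "x0 \<le> y" for y
  proof -
    obtain k where k: "y / x0 < s ^ k" using real_arch_pow[OF s(1)] by blast
    \<comment> \<open>Minimality puts \<open>y / s ^ (K - 1)\<close> into
      \<open>[x0, x0 * s)\<close>.\<close>
    define K where "K = (LEAST k. y < x0 * s ^ k)"
    have "y < x0 * s ^ k" using k x0 by (simp add: field_simps)
    then have K: "y < x0 * s ^ K" unfolding K_def by (rule LeastI)
    have "K \<noteq> 0" using K y by (intro notI) simp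
    then obtain K' where K': "K = Suc K'" using not0_implies_Suc by blast
    have "\<not> y < x0 * s ^ K'" unfolding K_def[symmetric]
      using not_less_Least[of K' "\<lambda>k. y < x0 * s ^ k"] K' by (simp add: K_def[symmetric])
    then have "x0 \<le> y / s ^ K'" "y / s ^ K' < x0 * s"
      using K K' s by (auto simp: field_simps)
    then have r: "reached (y / s ^ K')" by (rule init)
    have "reached (y / s ^ K' * s ^ l)" for l
    proof (induction l)
      case (Suc l)
      then show ?case using reached_mult[of "y / s ^ K' * s ^ l" i] by (simp add: s_def[symmetric] mult_ac)
    qed (use r in simp)
    from this[of K'] show ?thesis using s by simp
  qed
  obtain m where m: "x0 / t < lam ^ m" using real_arch_pow[OF lam_gt_1] by blast
  then have "reached (t * lam ^ m)" using t by (intro big) (simp add: field_simps)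
  then obtain m' where "pos_at 1 (t * lam ^ m / lam ^ m')" by (auto simp: reached_def)
  from pos_at_steps[OF this, of m] show ?thesis
    using t lam_pos unfolding reached_def by (intro conjI exI[of _ m']) auto
qed

lemma pos_at_multiple:
  assumes "1 \<le> j" "0 < x" "pos_at 1 x"
  shows "pos_at j (real j * x)"
  using assms(1)
proof (induction j rule: nat_induct_at_least)
  case base then show ?case using assms by simp
next
  case (Suc j)
  then have "pos_at (j + 1) (real j * x + x)" using assms by (intro pos_at_add) auto
  then show ?case by (simp add: algebra_simps)
qed

text \<open>As a probability density, \<open>v 1\<close> is positive somewhere on the positive
  half-line. So \<open>y / j\<close> is reached at some scale, and adding \<open>j\<close> equal
  parts leads back to \<open>y\<close> at that scale.\<close>

lemma exists_v_pos:
  assumes N: "real_distribution N" and char: "\<And>t. char N t = \<phi> t" and j: "1 \<le> j" and y: "0 < y"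
  shows "\<exists>m::nat. 0 < v j (y / lam ^ m)"
proof -
  interpret real_distribution N by fact
  have dens: "N = density lborel (v 1)" using density_v[OF N, of 1] char by simp
  have "\<exists>x0>0. 0 < v 1 x0"
  proof (rule ccontr)
    assume "\<not> ?thesis"
    then have z: "v 1 x = 0" if "x \<noteq> 0" for x
      using that v_nonneg[of 1 x] v_neg_eq_0[of 1 x] by (metis less_eq_real_def linorder_neqE order_refl)
    have "emeasure N UNIV = (\<integral>\<^sup>+x. ennreal (v 1 x) \<partial>lborel)"
      unfolding dens by (subst emeasure_density) auto
    also have "\<dots> = (\<integral>\<^sup>+x. 0 \<partial>(lborel :: real measure))"
    proof (rule nn_integral_cong_AE)
      show "AE x in lborel. ennreal (v 1 x) = 0"
        using AE_lborel_singleton[of "0::real"] by eventually_elim (metis z ennreal_0)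
    qed
    finally show False using emeasure_space_1 by simp
  qed
  then obtain x0 where x0: "0 < x0" "0 < v 1 x0" by blast
  have "reached (y / real j)" using y j by (intro reached_all[OF x0]) auto
  then obtain m where m: "pos_at 1 (y / real j / lam ^ m)" by (auto simp: reached_def)
  have "pos_at j (real j * (y / real j / lam ^ m))"
    using m y j lam_pos by (intro pos_at_multiple) auto
  then have "pos_at j (y / lam ^ m)" using j by simp
  then show ?thesis using y lam_pos j by (intro exI[of _ m] pos_at_imp_v_pos) auto
qed

end

section \<open>The periodic function and the asymptotics\<close>

text \<open>With \<open>N\<close> the integer part of \<open>log lam k\<close>, this aligns the sum
  over generations with the paired two-sided sum in \<open>Psi\<close>.\<close>

lemma suminf_around:
  fixes t :: "nat \<Rightarrow> real"
  assumes "summable t"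
  shows "(\<lambda>n. (if n \<le> N then t (N - n) else 0) + t (N + n + 1)) sums suminf t"
proof -
  define S where "S = (\<Sum>n<Suc N. t n)"
  have "(\<lambda>n. if n \<le> N then t (N - n) else 0) sums (\<Sum>n\<le>N. t (N - n))"
    using sums_If_finite_set[of "{..N}" "\<lambda>n. t (N - n)"] by simp
  moreover have "(\<Sum>n\<le>N. t (N - n)) = S"
    unfolding S_def by (rule sum.reindex_bij_witness[of _ "\<lambda>n. N - n" "\<lambda>n. N - n"]) auto
  moreover have "(\<lambda>n. t (n + Suc N)) sums (suminf t - S)"
    unfolding S_def using assms by (rule sums_split_initial_segment[OF summable_sums])
  then have "(\<lambda>n. t (N + n + 1)) sums (suminf t - S)" by (simp add: add.commute)
  ultimately have "(\<lambda>n. (if n \<le> N then t (N - n) else 0) + t (N + n + 1)) sums (S + (suminf t - S))"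
    by (intro sums_add) simp_all
  then show ?thesis by simp
qed

context branching
begin

section \<open>The weights and their geometric majorant\<close>

definition \<rho> :: real where "\<rho> = ln (1 + 2 * p) / ln (1 + p)"
definition a :: real where "a = 1 + 2 * p"

lemma rho_pos: "0 < \<rho>" and rho_less_2: "\<rho> < 2"
proof -
  show "0 < \<rho>" using p_pos by (simp add: \<rho>_def)
  have "1 + 2 * p < (1 + p) ^ 2" using p_pos by (simp add: power2_eq_square algebra_simps)
  then have "ln (1 + 2 * p) < ln ((1 + p) ^ 2)"
    using p_pos by (subst ln_less_cancel_iff) simp_all
  then have "ln (1 + 2 * p) < 2 * ln (1 + p)" using p_pos by (simp add: ln_realpow)
  then show "\<rho> < 2" using p_pos by (simp add: \<rho>_def divide_less_eq)
qed

lemma a_eq: "a = lam powr \<rho>" and a_gt_1: "1 < a"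
proof -
  show "1 < a" using p_pos by (simp add: a_def)
  have "\<rho> * ln (1 + p) = ln (1 + 2 * p)" using p_pos by (simp add: \<rho>_def)
  then show "a = lam powr \<rho>" using p_pos by (simp add: powr_def lam_def a_def)
qed

text \<open>The weight \<open>y powr (1 + \<rho>)\<close> in the logarithmic variable
  \<open>y = lam powr x\<close>.\<close>

definition w_rho :: "real \<Rightarrow> real" where "w_rho x = lam powr (x * (1 + \<rho>))"

text \<open>The first bound is summable towards negative \<open>x\<close>, as
  \<open>1 + \<rho> > 0\<close>; the second towards positive \<open>x\<close>, as
  \<open>\<rho> < 2\<close>.\<close>

lemma w_rho_bounds:
  assumes h: "0 \<le> h" "h \<le> C" "(lam powr x) ^ 3 * h \<le> C"
  shows "w_rho x * h \<le> C * lam powr (x * (1 + \<rho>))" "w_rho x * h \<le> C * lam powr (x * (\<rho> - 2))"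
proof -
  show "w_rho x * h \<le> C * lam powr (x * (1 + \<rho>))"
    using h by (simp add: w_rho_def mult.commute mult_right_mono)
  have "x * (1 + \<rho>) = x * (\<rho> - 2) + x * 3" by (simp add: algebra_simps)
  then have "w_rho x = lam powr (x * (\<rho> - 2)) * (lam powr x) ^ 3"
    using lam_pos by (simp add: w_rho_def powr_add powr_powr[symmetric] powr_realpow[symmetric] flip: powr_numeral)
  then have "w_rho x * h = lam powr (x * (\<rho> - 2)) * ((lam powr x) ^ 3 * h)" by simp
  also have "\<dots> \<le> lam powr (x * (\<rho> - 2)) * C" using h by (intro mult_left_mono) auto
  finally show "w_rho x * h \<le> C * lam powr (x * (\<rho> - 2))" by (simp add: mult.commute)
qed

text \<open>One geometric series for each direction. A base point of modulus at most
  \<open>R\<close> changes the exponents by at most \<open>3 * R\<close>, because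
  \<open>\<bar>\<rho> - 2\<bar>\<close> and \<open>1 + \<rho>\<close> are at most 3.\<close>

definition majorant :: "real \<Rightarrow> real \<Rightarrow> nat \<Rightarrow> real" where
  "majorant C R n = C * (lam powr (3 * R) * (lam powr (\<rho> - 2)) ^ n) + C * (lam powr (3 * R) * (lam powr (- 1 - \<rho>)) ^ n)"

lemma majorant_summable: "summable (majorant C R)"
proof -
  have "lam powr (\<rho> - 2) < 1" "lam powr (- 1 - \<rho>) < 1"
    using rho_less_2 rho_pos lam_gt_1 powr_less_mono[of "\<rho> - 2" 0 lam] powr_less_mono[of "-1 - \<rho>" 0 lam] by auto
  then show ?thesis unfolding majorant_def
    by (intro summable_add summable_mult summable_geometric) auto
qed

text \<open>\<open>h1\<close> and \<open>h2\<close> stay abstract because values of \<open>v\<close>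
  and rescaled coefficients must share one majorant.\<close>

lemma w_rho_majorant:
  assumes R: "\<bar>u\<bar> \<le> R" and h1: "0 \<le> h1" "h1 \<le> C" "(lam powr (u + real n)) ^ 3 * h1 \<le> C"
    and h2: "0 \<le> h2" "h2 \<le> C" "(lam powr (u - real n - 1)) ^ 3 * h2 \<le> C"
  shows "w_rho (u + real n) * h1 + w_rho (u - real n - 1) * h2 \<le> majorant C R n"
proof -
  have C: "0 \<le> C" using h1 by simp
  have "w_rho (u + real n) * h1 \<le> C * lam powr ((u + real n) * (\<rho> - 2))"
    by (rule w_rho_bounds[OF h1])
  also have "\<dots> \<le> C * (lam powr (3 * R) * (lam powr (\<rho> - 2)) ^ n)"
  proof (rule mult_left_mono[OF _ C])
    have "u * (\<rho> - 2) \<le> \<bar>u\<bar> * \<bar>\<rho> - 2\<bar>" by (metis abs_ge_self abs_mult)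
    also have "\<dots> \<le> R * 3" using R rho_pos rho_less_2 by (intro mult_mono) auto
    finally have "lam powr (u * (\<rho> - 2) + (\<rho> - 2) * real n) \<le> lam powr (3 * R + (\<rho> - 2) * real n)"
      using lam_gt_1 by (intro powr_mono) auto
    also have "\<dots> = lam powr (3 * R) * (lam powr (\<rho> - 2)) ^ n"
      using lam_pos by (simp add: powr_add powr_powr[symmetric] powr_realpow)
    finally show "lam powr ((u + real n) * (\<rho> - 2)) \<le> lam powr (3 * R) * (lam powr (\<rho> - 2)) ^ n"
      by (simp add: algebra_simps)
  qed
  finally have 1: "w_rho (u + real n) * h1 \<le> C * (lam powr (3 * R) * (lam powr (\<rho> - 2)) ^ n)" .
  have "w_rho (u - real n - 1) * h2 \<le> C * lam powr ((u - real n - 1) * (1 + \<rho>))"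
    by (rule w_rho_bounds[OF h2])
  also have "\<dots> \<le> C * (lam powr (3 * R) * (lam powr (- 1 - \<rho>)) ^ n)"
  proof (rule mult_left_mono[OF _ C])
    have "u * (1 + \<rho>) \<le> \<bar>u\<bar> * \<bar>1 + \<rho>\<bar>" by (metis abs_ge_self abs_mult)
    also have "\<dots> \<le> R * 3" using R rho_pos rho_less_2 by (intro mult_mono) auto
    finally have "(u - real n - 1) * (1 + \<rho>) \<le> 3 * R + (- 1 - \<rho>) * real n"
      using rho_pos by (simp add: algebra_simps)
    then have "lam powr ((u - real n - 1) * (1 + \<rho>)) \<le> lam powr (3 * R + (- 1 - \<rho>) * real n)"
      using lam_gt_1 by (intro powr_mono) auto
    also have "\<dots> = lam powr (3 * R) * (lam powr (- 1 - \<rho>)) ^ n"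
      using lam_pos by (simp only: powr_add powr_powr[symmetric]) (simp add: powr_realpow)
    finally show "lam powr ((u - real n - 1) * (1 + \<rho>)) \<le> lam powr (3 * R) * (lam powr (- 1 - \<rho>)) ^ n" .
  qed
  finally show ?thesis using 1 by (simp add: majorant_def)
qed

end

locale branching_limit_j = branching_limit +
  fixes j :: nat
  assumes j: "1 \<le> j"
begin

definition g :: "real \<Rightarrow> real" where
  "g x = w_rho x * v j (lam powr x)"

text \<open>Pairing the shifts \<open>n\<close> and \<open>-n - 1\<close> turns sums over the integers into sums over \<open>nat\<close>.\<close>

definition g2 :: "nat \<Rightarrow> real \<Rightarrow> real" where
  "g2 n u = g (u + real n) + g (u - real n - 1)"

definition Psi :: "real \<Rightarrow> real" where
  "Psi u = 2 * p / a * (\<Sum>n. g2 n u)"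

text \<open>Up to the factor \<open>2 * p / a\<close> this is the \<open>n\<close>-th summand of
  \<open>k powr (1 + \<rho>) * p_coeff p j k\<close>, because
  \<open>lam powr \<rho> = a\<close>.\<close>

definition tau :: "nat \<Rightarrow> nat \<Rightarrow> real" where
  "tau k n = (real k / lam ^ n) powr (1 + \<rho>) * (lam ^ n * coef j n k)"

lemma bound_constant:
  obtains C where "0 < C" "\<And>n k. lam ^ n * coef j n k \<le> C"
    "\<And>n k. (real k / lam ^ n) ^ 3 * (lam ^ n * coef j n k) \<le> C"
    "\<And>y. v j y \<le> C" "\<And>y. 0 < y \<Longrightarrow> y ^ 3 * v j y \<le> C"
proof -
  obtain B where B: "0 < B" "\<And>j n k. 1 \<le> j \<Longrightarrow> lam ^ n * coef j n k \<le> B" "\<And>j y. 1 \<le> j \<Longrightarrow> v j y \<le> B"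
    using v_bounded by blast
  obtain K where K: "0 < K" "\<And>n k. real k ^ 3 * coef j n k \<le> K * lam ^ (2 * n)"
    "\<And>y. 0 < y \<Longrightarrow> y ^ 3 * v j y \<le> K"
    using v_cube_bound[OF j] by blast
  have "(real k / lam ^ n) ^ 3 * (lam ^ n * coef j n k) \<le> K" for n k
  proof -
    have "(real k / lam ^ n) ^ 3 * (lam ^ n * coef j n k) = real k ^ 3 * coef j n k / lam ^ (2 * n)"
      using lam_pos by (simp add: power_divide field_simps flip: power_mult power_add)
    also have "\<dots> \<le> K" using K(2)[of k n] lam_pos by (simp add: pos_divide_le_eq)
    finally show ?thesis .
  qed
  with B K j show thesis
    by (intro that[of "max B K"]) (auto simp: le_max_iff_disj)
qed

lemma g_nonneg: "0 \<le> g x"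
  using v_nonneg[OF j] by (simp add: g_def w_rho_def)

lemma isCont_g: "isCont g x"
proof -
  have "isCont (\<lambda>x. w_rho x * v j (lam powr x)) x"
  proof (rule isCont_mult)
    show "isCont w_rho x"
      unfolding w_rho_def[abs_def] using lam_pos by (intro continuous_intros) auto
    have "isCont (\<lambda>x. lam powr x) x" using lam_pos by (intro continuous_intros) auto
    then show "isCont (\<lambda>x. v j (lam powr x)) x" by (rule isCont_o2[OF _ isCont_v[OF j]])
  qed
  then show ?thesis by (simp add: g_def[abs_def])
qed

lemma continuous_on_g [continuous_intros]:
  "continuous_on S h \<Longrightarrow> continuous_on S (\<lambda>x. g (h x))"
  using continuous_on_compose2[of UNIV g S h] isCont_g
  by (simp add: continuous_at_imp_continuous_on)

lemma g2_majorant: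
  obtains C where "0 < C" "\<And>u R n. \<bar>u\<bar> \<le> R \<Longrightarrow> \<bar>g2 n u\<bar> \<le> majorant C R n"
    "\<And>u R n x1 x2. \<bar>u\<bar> \<le> R \<Longrightarrow> 0 \<le> x1 \<Longrightarrow> x1 \<le> C \<Longrightarrow> (lam powr (u + real n)) ^ 3 * x1 \<le> C \<Longrightarrow>
      0 \<le> x2 \<Longrightarrow> x2 \<le> C \<Longrightarrow> (lam powr (u - real n - 1)) ^ 3 * x2 \<le> C \<Longrightarrow>
      w_rho (u + real n) * x1 + w_rho (u - real n - 1) * x2 \<le> majorant C R n"
    "\<And>n k. lam ^ n * coef j n k \<le> C"
    "\<And>n k. (real k / lam ^ n) ^ 3 * (lam ^ n * coef j n k) \<le> C"
proof -
  obtain C where C: "0 < C" "\<And>n k. lam ^ n * coef j n k \<le> C"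
    "\<And>n k. (real k / lam ^ n) ^ 3 * (lam ^ n * coef j n k) \<le> C"
    "\<And>y. v j y \<le> C" "\<And>y. 0 < y \<Longrightarrow> y ^ 3 * v j y \<le> C"
    using bound_constant by blast
  have "\<bar>g2 n u\<bar> \<le> majorant C R n" if "\<bar>u\<bar> \<le> R" for u R n
  proof -
    have "g2 n u \<le> majorant C R n"
      unfolding g2_def g_def using C lam_pos v_nonneg[OF j] that by (intro w_rho_majorant) auto
    then show ?thesis using g_nonneg by (simp add: g2_def)
  qed
  then show thesis using that[of C] C w_rho_majorant by blast
qed

lemma g2_summable: "summable (\<lambda>n. g2 n u)"
proof -
  obtain C where "\<And>u R n. \<bar>u\<bar> \<le> R \<Longrightarrow> \<bar>g2 n u\<bar> \<le> majorant C R n"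
    using g2_majorant by metis
  then show ?thesis
    by (intro summable_comparison_test'[OF majorant_summable[of C "\<bar>u\<bar>"]]) auto
qed

lemma Psi_continuous: "continuous_on UNIV Psi"
proof -
  obtain C where C: "\<And>u R n. \<bar>u\<bar> \<le> R \<Longrightarrow> \<bar>g2 n u\<bar> \<le> majorant C R n"
    using g2_majorant by metis
  have "continuous_on {-R<..<R} (\<lambda>u. \<Sum>n. g2 n u)" for R
  proof (rule uniform_limit_theorem)
    show "uniform_limit {-R<..<R} (\<lambda>N u. \<Sum>n<N. g2 n u) (\<lambda>u. \<Sum>n. g2 n u) sequentially"
      by (rule Weierstrass_m_test[OF _ majorant_summable[of C R]]) (use C in auto)
    show "\<forall>\<^sub>F N in sequentially. continuous_on {-R<..<R} (\<lambda>u. \<Sum>n<N. g2 n u)"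
      unfolding g2_def by (intro always_eventually allI continuous_intros)
  qed simp
  then have "isCont (\<lambda>u. \<Sum>n. g2 n u) u" for u
    by (rule continuous_on_interior[of "{-(\<bar>u\<bar>+1)<..<\<bar>u\<bar>+1}"]) (auto simp: abs_if)
  then have "isCont Psi u" for u
    unfolding Psi_def by (intro continuous_intros)
  then show ?thesis by (simp add: continuous_at_imp_continuous_on)
qed

lemma g_tendsto_0: "(\<lambda>n. g (u + real n)) \<longlonglongrightarrow> 0" "(\<lambda>n. g (u - real n - 1)) \<longlonglongrightarrow> 0"
proof -
  have lim: "(\<lambda>n. g2 n u) \<longlonglongrightarrow> 0" by (rule summable_LIMSEQ_zero[OF g2_summable])
  show "(\<lambda>n. g (u + real n)) \<longlonglongrightarrow> 0"
    by (rule tendsto_sandwich[OF _ _ tendsto_const lim]) (auto simp: g2_def g_nonneg)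
  show "(\<lambda>n. g (u - real n - 1)) \<longlonglongrightarrow> 0"
    by (rule tendsto_sandwich[OF _ _ tendsto_const lim]) (auto simp: g2_def g_nonneg)
qed

text \<open>A shift by 1 moves the window of summation: the partial sums differ by two boundary
  values of \<open>g\<close>, which tend to 0.\<close>

lemma Psi_periodic: "Psi (u + 1) = Psi u"
proof -
  have "(\<Sum>n<N. g2 n (u + 1)) = (\<Sum>n<N. g2 n u) + g (u + real N) - g (u - real N)" for N
    by (induction N) (simp_all add: g2_def algebra_simps)
  moreover have "(\<lambda>N. (\<Sum>n<N. g2 n u) + g (u + real N) - g (u - real N)) \<longlonglongrightarrow> (\<Sum>n. g2 n u) + 0 - 0"
  proof (intro tendsto_intros summable_LIMSEQ g2_summable g_tendsto_0)
    show "(\<lambda>N. g (u - real N)) \<longlonglongrightarrow> 0"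
      using g_tendsto_0(2)[of "u + 1"] by (simp add: algebra_simps)
  qed
  ultimately have "(\<lambda>N. \<Sum>n<N. g2 n (u + 1)) \<longlonglongrightarrow> (\<Sum>n. g2 n u)" by simp
  moreover have "(\<lambda>N. \<Sum>n<N. g2 n (u + 1)) \<longlonglongrightarrow> (\<Sum>n. g2 n (u + 1))"
    by (rule summable_LIMSEQ[OF g2_summable])
  ultimately show ?thesis unfolding Psi_def using LIMSEQ_unique by metis
qed

lemma Psi_periodic_nat: "Psi (u + real n) = Psi u"
proof (induction n)
  case (Suc n)
  then show ?case using Psi_periodic[of "u + real n"] by (simp add: add_ac)
qed simp

lemma Psi_pos:
  assumes N: "real_distribution N" and char: "\<And>t. char N t = \<phi> t"
  shows "0 < Psi u"
proof -
  obtain m where m: "0 < v j (lam powr u / lam ^ m)"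
    using exists_v_pos[OF N char j, of "lam powr u"] lam_pos by auto
  have "lam powr u / lam ^ m = lam powr (u - real m)"
    using lam_pos by (simp add: powr_diff powr_realpow)
  then have gm: "0 < g (u - real m)" using m lam_pos by (simp add: g_def w_rho_def)
  have "0 < (\<Sum>n. g2 n u)"
  proof (rule suminf_pos2[OF g2_summable])
    show "0 \<le> g2 n u" for n by (simp add: g2_def g_nonneg)
    \<comment> \<open>For \<open>m > 0\<close> the value \<open>g (u - m)\<close> is the second
      summand of the pair \<open>m - 1\<close>. For \<open>m = 0\<close> the truncated difference is
      0, and it is the first summand of that pair.\<close>
    show "0 < g2 (m - 1) u"
    proof (cases m)
      case 0
      then show ?thesis using gm g_nonneg[of "u - 1"] by (simp add: g2_def add_pos_nonneg)
    next
      case (Suc n)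
      then show ?thesis using gm g_nonneg[of "u + real n"] by (simp add: g2_def add_nonneg_pos algebra_simps)
    qed
  qed
  then show ?thesis using p_pos a_gt_1 by (simp add: Psi_def)
qed

lemma tau_nonneg: "0 \<le> tau k n"
  using lam_pos coef_nonneg by (simp add: tau_def)

lemma tau_summable: "summable (tau k)"
proof -
  obtain C where C: "0 < C" "\<And>n k. lam ^ n * coef j n k \<le> C"
    using bound_constant by metis
  have "summable (\<lambda>n. real k powr (1 + \<rho>) * C * (lam powr (-1 - \<rho>)) ^ n)"
    using powr_less_mono[of "-1 - \<rho>" 0 lam] rho_pos lam_gt_1
    by (intro summable_mult summable_geometric) auto
  then show ?thesis
  proof (rule summable_comparison_test')
    fix n
    have "tau k n \<le> (real k / lam ^ n) powr (1 + \<rho>) * C"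
      unfolding tau_def using C by (intro mult_left_mono) auto
    also have "(real k / lam ^ n) powr (1 + \<rho>) = real k powr (1 + \<rho>) * (lam powr (-1 - \<rho>)) ^ n"
    proof -
      have "(lam ^ n) powr (1 + \<rho>) = (lam powr (1 + \<rho>)) ^ n"
        using lam_pos by (simp add: powr_realpow[symmetric] powr_powr mult.commute)
      moreover have "lam powr (-1 - \<rho>) = 1 / lam powr (1 + \<rho>)"
        using powr_minus_divide[of lam "1 + \<rho>"] by (simp add: algebra_simps)
      ultimately show ?thesis using lam_pos by (simp add: powr_divide power_divide)
    qed
    finally show "norm (tau k n) \<le> real k powr (1 + \<rho>) * C * (lam powr (-1 - \<rho>)) ^ n"
      using tau_nonneg by (simp add: mult_ac)
  qed
qed

lemma tau_minus_g:
  assumes x: "real k / lam ^ n = lam powr x"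
  shows "\<bar>tau k n - g x\<bar> \<le> w_rho x * err j n"
proof -
  have "tau k n = w_rho x * (lam ^ n * coef j n k)"
    by (simp add: tau_def x w_rho_def powr_powr)
  then have "\<bar>tau k n - g x\<bar> = w_rho x * \<bar>lam ^ n * coef j n k - v j (lam powr x)\<bar>"
    by (simp add: g_def w_rho_def abs_mult right_diff_distrib[symmetric])
  also have "\<dots> \<le> w_rho x * err j n"
    using local_limit[OF j, of n "int k"] by (intro mult_left_mono) (auto simp: coefz_def x[symmetric] w_rho_def)
  finally show ?thesis .
qed

lemma w_rho_mono: "x \<le> y \<Longrightarrow> w_rho x \<le> w_rho y"
  unfolding w_rho_def using lam_gt_1 rho_pos by (intro powr_mono mult_right_mono) auto

text \<open>The series is centred at the generation \<open>N k\<close> where \<open>lam ^ n\<close>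
  is comparable to \<open>k\<close>, leaving the fractional part \<open>\<theta> k\<close>. For
  fixed \<open>n\<close> the generations \<open>N k - n\<close> and \<open>N k + n + 1\<close> tend
  to infinity, so each paired difference vanishes; Tannery's theorem exchanges limit and sum, and
  periodicity turns \<open>\<theta> k\<close> back into the logarithm.\<close>

lemma suminf_tau_asymp: "(\<lambda>k. 2 * p / a * suminf (tau k) - Psi (log lam (real k))) \<longlonglongrightarrow> 0"
proof -
  define N where "N k = nat \<lfloor>log lam (real k)\<rfloor>" for k
  define \<theta> where "\<theta> k = log lam (real k) - real (N k)" for k
  \<comment> \<open>For \<open>n > N k\<close> the generation index would be negative, and 0 is
    compared with \<open>g\<close>; the majorant covers these terms as well.\<close>
  define d where "d n k = ((if n \<le> N k then tau k (N k - n) else 0) - g (\<theta> k + real n)) +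
     (tau k (N k + n + 1) - g (\<theta> k - real n - 1))" for n k
  obtain C where C: "0 < C" "\<And>u R n. \<bar>u\<bar> \<le> R \<Longrightarrow> \<bar>g2 n u\<bar> \<le> majorant C R n"
    "\<And>u R n x1 x2. \<bar>u\<bar> \<le> R \<Longrightarrow> 0 \<le> x1 \<Longrightarrow> x1 \<le> C \<Longrightarrow> (lam powr (u + real n)) ^ 3 * x1 \<le> C \<Longrightarrow>
      0 \<le> x2 \<Longrightarrow> x2 \<le> C \<Longrightarrow> (lam powr (u - real n - 1)) ^ 3 * x2 \<le> C \<Longrightarrow>
      w_rho (u + real n) * x1 + w_rho (u - real n - 1) * x2 \<le> majorant C R n"
    "\<And>n k. lam ^ n * coef j n k \<le> C"
    "\<And>n k. (real k / lam ^ n) ^ 3 * (lam ^ n * coef j n k) \<le> C"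
    using g2_majorant by metis
  have \<theta>: "0 \<le> \<theta> k" "\<theta> k \<le> 1" if "1 \<le> k" for k
  proof -
    have "0 \<le> log lam (real k)" using that lam_gt_1 by simp
    then show "0 \<le> \<theta> k" "\<theta> k \<le> 1" unfolding \<theta>_def N_def by linarith+
  qed
  have scale: "real k / lam ^ n = lam powr (\<theta> k + real (N k) - real n)" if "1 \<le> k" for k n
  proof -
    have "lam powr (log lam (real k)) = real k" using that lam_gt_1 by simp
    then show ?thesis using lam_pos by (simp add: \<theta>_def powr_diff powr_realpow)
  qed
  have scale1: "real k / lam ^ (N k - n) = lam powr (\<theta> k + real n)" if "1 \<le> k" "n \<le> N k" for k n
    using scale[OF that(1), of "N k - n"] that(2) by (simp add: of_nat_diff)
  have scale2: "real k / lam ^ (N k + n + 1) = lam powr (\<theta> k - real n - 1)" if "1 \<le> k" for k n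
    using scale[OF that(1), of "N k + n + 1"] by (simp add: algebra_simps)
  have tau1: "tau k (N k - n) = w_rho (\<theta> k + real n) * (lam ^ (N k - n) * coef j (N k - n) k)"
    if "1 \<le> k" "n \<le> N k" for k n
    by (simp add: tau_def scale1[OF that] w_rho_def powr_powr)
  have tau2: "tau k (N k + n + 1) = w_rho (\<theta> k - real n - 1) * (lam ^ (N k + n + 1) * coef j (N k + n + 1) k)"
    if "1 \<le> k" for k n
    unfolding tau_def scale2[OF that] by (simp add: w_rho_def powr_powr)
  have bound: "norm (d n k) \<le> majorant C 1 n" if k: "1 \<le> k" for n k
  proof -
    define A1 where "A1 = (if n \<le> N k then lam ^ (N k - n) * coef j (N k - n) k else 0)"
    define A2 where "A2 = lam ^ (N k + n + 1) * coef j (N k + n + 1) k"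
    have "(if n \<le> N k then tau k (N k - n) else 0) + tau k (N k + n + 1) =
      w_rho (\<theta> k + real n) * A1 + w_rho (\<theta> k - real n - 1) * A2"
      using tau1[OF k] tau2[OF k] by (simp add: A1_def A2_def)
    also have "\<dots> \<le> majorant C 1 n"
    proof (rule C(3))
      show "\<bar>\<theta> k\<bar> \<le> 1" using \<theta>[OF k] by simp
      show "0 \<le> A1" "0 \<le> A2" "A1 \<le> C" "A2 \<le> C"
        using C(1) C(4)[of "N k - n" k] C(4)[of "N k + n + 1" k] lam_pos by (auto simp: A1_def A2_def coef_nonneg)
      show "(lam powr (\<theta> k + real n)) ^ 3 * A1 \<le> C"
        using C(1) C(5)[of k "N k - n"] scale1[OF k, of n] by (auto simp: A1_def)
      show "(lam powr (\<theta> k - real n - 1)) ^ 3 * A2 \<le> C"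
        using C(5)[of k "N k + n + 1"] unfolding scale2[OF k] A2_def .
    qed
    finally have up: "(if n \<le> N k then tau k (N k - n) else 0) + tau k (N k + n + 1) \<le> majorant C 1 n" .
    have "g (\<theta> k + real n) + g (\<theta> k - real n - 1) \<le> majorant C 1 n"
      using C(2)[of "\<theta> k" 1 n] \<theta>[OF k] by (simp add: g2_def abs_le_iff)
    moreover have "0 \<le> (if n \<le> N k then tau k (N k - n) else 0) + tau k (N k + n + 1)"
      using tau_nonneg by simp
    moreover have "0 \<le> g (\<theta> k + real n) + g (\<theta> k - real n - 1)" using g_nonneg by simp
    \<comment> \<open>Both paired sums lie between 0 and the majorant, hence so does the modulus of
      their difference.\<close>
    ultimately show ?thesis using up unfolding d_def real_norm_def abs_le_iff by linarith
  qed
  have N_lim: "filterlim N at_top sequentially"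
    unfolding filterlim_at_top
  proof
    fix Z
    have "eventually (\<lambda>k. lam ^ Z \<le> real k) sequentially"
      using filterlim_real_sequentially by (simp add: filterlim_at_top)
    then show "eventually (\<lambda>k. Z \<le> N k) sequentially"
    proof eventually_elim
      case (elim k)
      have "0 < real k" using elim lam_pos by (metis less_le_trans zero_less_power)
      then have "real Z \<le> log lam (real k)"
        using elim lam_gt_1 by (simp add: le_log_iff powr_realpow)
      then show ?case unfolding N_def by linarith
    qed
  qed
  have lim: "(\<lambda>k. d n k) \<longlonglongrightarrow> 0" for n
  proof (rule Lim_null_comparison)
    have e: "eventually (\<lambda>k. n \<le> N k) sequentially" using N_lim by (simp add: filterlim_at_top)
    show "eventually (\<lambda>k. norm (d n k) \<le> w_rho (1 + real n) * err j (N k - n) + w_rho (- real n) * err j (N k + n + 1)) sequentially"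
      using e eventually_ge_at_top[of 1]
    proof eventually_elim
      case (elim k)
      have e0: "0 \<le> err j m" for m by (simp add: err_def)
      have "\<bar>tau k (N k - n) - g (\<theta> k + real n)\<bar> \<le> w_rho (\<theta> k + real n) * err j (N k - n)"
        using elim by (intro tau_minus_g scale1) auto
      also have "\<dots> \<le> w_rho (1 + real n) * err j (N k - n)"
        using \<theta>[of k] elim e0 by (intro mult_right_mono w_rho_mono) auto
      finally have 1: "\<bar>tau k (N k - n) - g (\<theta> k + real n)\<bar> \<le> w_rho (1 + real n) * err j (N k - n)" .
      have "\<bar>tau k (N k + n + 1) - g (\<theta> k - real n - 1)\<bar> \<le> w_rho (\<theta> k - real n - 1) * err j (N k + n + 1)"
        using elim by (intro tau_minus_g scale2) auto
      also have "\<dots> \<le> w_rho (- real n) * err j (N k + n + 1)"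
        using \<theta>[of k] elim e0 by (intro mult_right_mono w_rho_mono) auto
      finally show ?case using 1 elim by (simp add: d_def)
    qed
    have "filterlim (\<lambda>k. N k - n) at_top sequentially"
      using filterlim_compose[OF filterlim_minus_const_nat_at_top N_lim] by simp
    then have "(\<lambda>k. err j (N k - n)) \<longlonglongrightarrow> 0" by (rule filterlim_compose[OF err_tendsto[OF j]])
    moreover have "filterlim (\<lambda>k. N k + n + 1) at_top sequentially"
      by (rule filterlim_at_top_mono[OF N_lim]) simp
    then have "(\<lambda>k. err j (N k + n + 1)) \<longlonglongrightarrow> 0" by (rule filterlim_compose[OF err_tendsto[OF j]])
    ultimately show "(\<lambda>k. w_rho (1 + real n) * err j (N k - n) + w_rho (- real n) * err j (N k + n + 1)) \<longlonglongrightarrow> 0"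
      by (auto intro!: tendsto_eq_intros)
  qed
  have "(\<lambda>k. \<Sum>n. d n k) \<longlonglongrightarrow> (\<Sum>n::nat. 0::real)"
  proof -
    have "eventually (\<lambda>(n, k). norm (d n k) \<le> majorant C 1 n) (at_top \<times>\<^sub>F sequentially)"
      unfolding eventually_prod_filter
      by (intro exI[of _ "\<lambda>_. True"] exI[of _ "\<lambda>k. 1 \<le> k"]) (use bound in \<open>auto simp: eventually_ge_at_top\<close>)
    from tannerys_theorem[OF lim this majorant_summable] show ?thesis by auto
  qed
  then have "(\<lambda>k. 2 * p / a * (\<Sum>n. d n k)) \<longlonglongrightarrow> 0"
    by (intro tendsto_mult_right_zero) simp
  moreover have "eventually (\<lambda>k. 2 * p / a * (\<Sum>n. d n k) = 2 * p / a * suminf (tau k) - Psi (log lam (real k))) sequentially"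
    using eventually_ge_at_top[of 1]
  proof eventually_elim
    case (elim k)
    have "(\<lambda>n. ((if n \<le> N k then tau k (N k - n) else 0) + tau k (N k + n + 1)) - g2 n (\<theta> k)) sums
       (suminf (tau k) - (\<Sum>n. g2 n (\<theta> k)))"
      by (intro sums_diff suminf_around tau_summable summable_sums g2_summable)
    moreover have "(\<lambda>n. ((if n \<le> N k then tau k (N k - n) else 0) + tau k (N k + n + 1)) - g2 n (\<theta> k)) = (\<lambda>n. d n k)"
      by (simp add: fun_eq_iff d_def g2_def)
    ultimately have "(\<Sum>n. d n k) = suminf (tau k) - (\<Sum>n. g2 n (\<theta> k))"
      by (metis sums_unique)
    then have "2 * p / a * (\<Sum>n. d n k) = 2 * p / a * suminf (tau k) - Psi (\<theta> k)"
      by (simp add: Psi_def right_diff_distrib)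
    moreover have "Psi (log lam (real k)) = Psi (\<theta> k)"
      using Psi_periodic_nat[of "\<theta> k" "N k"] by (simp add: \<theta>_def)
    ultimately show ?case by simp
  qed
  ultimately show ?thesis by (rule Lim_transform_eventually)
qed

end

section \<open>The coefficients of the generating function\<close>

context branching
begin

definition fr :: "real \<Rightarrow> real" where "fr x = x - p * x + p * x\<^sup>2"

lemma fr_unit_interval: "x \<in> {0..1} \<Longrightarrow> fr x \<in> {0..1}"
  unfolding fr_def by (rule feq_map_unit_interval[OF p_pos p_less_1])

lemma poly_gen_poly_real: "poly (gen_poly n) x = (fr ^^ n) x"
  by (induction n) (simp_all add: fr_def q_def algebra_simps)

lemma funpow_fr_unit_interval: "x \<in> {0..1} \<Longrightarrow> (fr ^^ n) x \<in> {0..1}"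
proof (induction n)
  case (Suc n)
  then show ?case using fr_unit_interval by (simp del: atLeastAtMost_iff)
qed simp

definition size_pmf :: "nat \<Rightarrow> nat \<Rightarrow> nat pmf" where
  "size_pmf j n = embed_pmf (coef j n)"

lemma coef_sums: "(\<lambda>k. coef j n k * x ^ k) sums (fr ^^ n) x ^ j"
proof -
  have "(\<lambda>k. coef j n k * x ^ k) sums (\<Sum>k\<le>degree (gen_poly n ^ j). coef j n k * x ^ k)"
    by (rule sums_finite) (auto simp: coef_def coeff_eq_0)
  then show ?thesis by (simp add: coef_def poly_altdef[symmetric] poly_gen_poly_real)
qed

lemma pmf_size_pmf: "pmf (size_pmf j n) k = coef j n k"
proof -
  have "(\<Sum>k. ennreal (coef j n k)) = ennreal 1"
    using coef_sums[of j n 1] poly_gen_poly_1[of n]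
    by (intro suminf_ennreal_eq coef_nonneg) (simp_all add: poly_gen_poly_real)
  then have "(\<integral>\<^sup>+k. ennreal (coef j n k) \<partial>count_space UNIV) = 1"
    by (simp add: nn_integral_count_space_nat)
  then show ?thesis
    unfolding size_pmf_def by (intro pmf_embed_pmf coef_nonneg)
qed

lemma pgf_size_pmf: "pgf (size_pmf j n) x = (fr ^^ n) x ^ j"
  using coef_sums[of j n x] by (simp add: pgf_def pmf_size_pmf sums_iff)

lemma geometric_nn_integral:
  assumes "0 < s" "s \<le> 1" "\<And>n. 0 \<le> h n" "\<And>n. h n \<le> (1::real)"
  shows "(\<integral>\<^sup>+n. ennreal (h n) \<partial>measure_pmf (geometric_pmf s)) = ennreal (\<Sum>n. (1 - s) ^ n * s * h n)"
    "summable (\<lambda>n. (1 - s) ^ n * s * h n)"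
proof -
  show sm: "summable (\<lambda>n. (1 - s) ^ n * s * h n)"
  proof (rule summable_comparison_test')
    show "summable (\<lambda>n. (1 - s) ^ n)" using assms by (intro summable_geometric) auto
    fix n
    have "(1 - s) ^ n * (s * h n) \<le> (1 - s) ^ n * 1"
      using assms by (intro mult_left_mono) (auto intro: mult_le_one)
    then show "norm ((1 - s) ^ n * s * h n) \<le> (1 - s) ^ n" using assms by (simp add: abs_mult mult.assoc)
  qed
  have "(\<integral>\<^sup>+n. ennreal (h n) \<partial>measure_pmf (geometric_pmf s)) = (\<Sum>n. ennreal ((1 - s) ^ n * s * h n))"
    using assms by (simp add: nn_integral_measure_pmf nn_integral_count_space_nat ennreal_mult')
  also have "\<dots> = ennreal (\<Sum>n. (1 - s) ^ n * s * h n)"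
    using assms sm by (intro suminf_ennreal2) auto
  finally show "(\<integral>\<^sup>+n. ennreal (h n) \<partial>measure_pmf (geometric_pmf s)) = ennreal (\<Sum>n. (1 - s) ^ n * s * h n)" .
qed

text \<open>\<open>Q\<close> is the size of a generation picked with geometric weights. Shifting its
  series by one index gives the functional equation, and uniqueness identifies \<open>Q\<close> with
  the law behind \<open>p_coeff\<close>.\<close>

lemma p_coeff_eq: "p_coeff p j k = 2 * p / a * (\<Sum>n. (1 / a) ^ n * coef j n k)"
proof -
  define s where "s = 2 * p / a"
  have s: "0 < s" "s \<le> 1" "1 - s = 1 / a" using p_pos by (auto simp: s_def a_def field_simps)
  define Q where "Q = bind_pmf (geometric_pmf s) (size_pmf j)"
  have pgf_Q: "pgf Q x = (\<Sum>n. (1 - s) ^ n * s * (fr ^^ n) x ^ j)"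
    and pgf_Q_summable: "summable (\<lambda>n. (1 - s) ^ n * s * (fr ^^ n) x ^ j)" if x: "x \<in> {0..1}" for x
  proof -
    have b: "0 \<le> (fr ^^ n) x ^ j" "(fr ^^ n) x ^ j \<le> 1" for n
      using funpow_fr_unit_interval[OF x, of n] by (auto simp: power_le_one)
    show sm: "summable (\<lambda>n. (1 - s) ^ n * s * (fr ^^ n) x ^ j)"
      by (rule geometric_nn_integral(2)[OF s(1,2) b])
    have "ennreal (pgf Q x) = (\<integral>\<^sup>+n. (\<integral>\<^sup>+k. ennreal (x ^ k) \<partial>measure_pmf (size_pmf j n)) \<partial>measure_pmf (geometric_pmf s))"
      unfolding ennreal_pgf[OF x] Q_def by simp
    also have "\<dots> = (\<integral>\<^sup>+n. ennreal ((fr ^^ n) x ^ j) \<partial>measure_pmf (geometric_pmf s))"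
      by (simp only: ennreal_pgf[OF x, symmetric] pgf_size_pmf)
    also have "\<dots> = ennreal (\<Sum>n. (1 - s) ^ n * s * (fr ^^ n) x ^ j)"
      by (rule geometric_nn_integral(1)[OF s(1,2) b])
    finally have "ennreal (pgf Q x) = ennreal (\<Sum>n. (1 - s) ^ n * s * (fr ^^ n) x ^ j)" .
    moreover have "0 \<le> (\<Sum>n. (1 - s) ^ n * s * (fr ^^ n) x ^ j)"
      by (rule suminf_nonneg[OF sm], rule mult_nonneg_nonneg[OF mult_nonneg_nonneg[OF zero_le_power] b(1)])
         (use s(1,2) in auto)
    ultimately show "pgf Q x = (\<Sum>n. (1 - s) ^ n * s * (fr ^^ n) x ^ j)"
      using pgf_bounds(1)[OF x, of Q] by (simp only: ennreal_inj)
  qed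
  have "solves_feq p j Q"
    unfolding solves_feq_def
  proof
    fix x :: real assume x: "x \<in> {0..1}"
    have y: "fr x \<in> {0..1}" by (rule fr_unit_interval[OF x])
    have "pgf Q x = (\<Sum>n. (1 - s) ^ Suc n * s * (fr ^^ Suc n) x ^ j) + s * x ^ j"
      unfolding pgf_Q[OF x] using suminf_split_head[OF pgf_Q_summable[OF x]] by simp
    also have "(\<Sum>n. (1 - s) ^ Suc n * s * (fr ^^ Suc n) x ^ j) = (1 - s) * (\<Sum>n. (1 - s) ^ n * s * (fr ^^ n) (fr x) ^ j)"
      by (subst suminf_mult[OF pgf_Q_summable[OF y], symmetric]) (simp add: funpow_swap1 mult_ac)
    finally have "pgf Q x = (1 - s) * pgf Q (fr x) + s * x ^ j" using pgf_Q[OF y] by simp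
    then have "a * pgf Q x = pgf Q (fr x) + 2 * p * x ^ j"
      unfolding s(3) using a_gt_1 by (simp add: s_def field_simps)
    then show "(1 + 2 * p) * pgf Q x = 2 * p * x ^ j + pgf Q (x - p * x + p * x\<^sup>2)"
      by (simp add: a_def fr_def)
  qed
  then have "(THE P. solves_feq p j P) = Q"
    using solves_feq_unique[OF p_pos p_less_1] by (intro the_equality) auto
  then have "p_coeff p j k = pmf Q k" by (simp add: p_coeff_def)
  also have "\<dots> = (\<Sum>n. (1 - s) ^ n * s * coef j n k)"
  proof -
    have "ennreal (pmf Q k) = (\<integral>\<^sup>+n. ennreal (coef j n k) \<partial>measure_pmf (geometric_pmf s))"
      unfolding Q_def ennreal_pmf_bind by (simp add: pmf_size_pmf)
    also have "\<dots> = ennreal (\<Sum>n. (1 - s) ^ n * s * coef j n k)"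
      by (rule geometric_nn_integral(1)[OF s(1,2) coef_nonneg coef_le_1])
    finally have "ennreal (pmf Q k) = ennreal (\<Sum>n. (1 - s) ^ n * s * coef j n k)" .
    moreover have "0 \<le> (\<Sum>n. (1 - s) ^ n * s * coef j n k)"
      using s(1,2) coef_nonneg
      by (intro suminf_nonneg[OF geometric_nn_integral(2)[OF s(1,2) coef_nonneg coef_le_1]]
          mult_nonneg_nonneg zero_le_power) auto
    ultimately show ?thesis by (simp only: ennreal_inj pmf_nonneg)
  qed
  also have "\<dots> = s * (\<Sum>n. (1 / a) ^ n * coef j n k)"
  proof -
    have "summable (\<lambda>n. (1 / a) ^ n * coef j n k)"
    proof (rule summable_comparison_test')
      show "summable (\<lambda>n. (1 / a) ^ n)" using a_gt_1 by (intro summable_geometric) auto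
      show "norm ((1 / a) ^ n * coef j n k) \<le> (1 / a) ^ n" for n
        using a_gt_1 coef_nonneg coef_le_1 by (simp add: abs_mult divide_right_mono)
    qed
    from suminf_mult[OF this, of s] show ?thesis unfolding s(3) by (simp add: mult_ac)
  qed
  finally show ?thesis by (simp add: s_def)
qed

end

context branching_limit_j
begin

lemma p_coeff_eq_suminf_tau:
  assumes k: "1 \<le> k"
  shows "2 * p / a * suminf (tau k) = real k powr (1 + \<rho>) * p_coeff p j k"
proof -
  have tau: "tau k n = real k powr (1 + \<rho>) * ((1 / a) ^ n * coef j n k)" for n
  proof -
    have "(lam ^ n) powr (1 + \<rho>) = lam ^ n * (lam ^ n) powr \<rho>"
      using lam_pos by (simp add: powr_add)
    also have "(lam ^ n) powr \<rho> = a ^ n"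
      using lam_pos by (simp add: a_eq powr_realpow[symmetric] powr_powr mult.commute)
    finally show ?thesis
      using lam_pos k by (simp add: tau_def powr_divide power_divide)
  qed
  have "summable (\<lambda>n. (1 / a) ^ n * coef j n k)"
    using tau_summable[of k] k by (simp add: tau[abs_def])
  then have "suminf (tau k) = real k powr (1 + \<rho>) * (\<Sum>n. (1 / a) ^ n * coef j n k)"
    by (simp add: tau[abs_def] suminf_mult)
  then show ?thesis by (simp add: p_coeff_eq)
qed

lemma p_coeff_asymp:
  "(\<lambda>k. p_coeff p j k - real k powr (-1 - \<rho>) * Psi (log lam (real k))) \<in> o(\<lambda>k. real k powr (-1 - \<rho>))"
proof (rule smalloI_tendsto)
  show "eventually (\<lambda>k. real k powr (-1 - \<rho>) \<noteq> 0) sequentially"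
    using eventually_ge_at_top[of 1] by eventually_elim auto
  have "eventually (\<lambda>k. 2 * p / a * suminf (tau k) - Psi (log lam (real k)) =
      (p_coeff p j k - real k powr (-1 - \<rho>) * Psi (log lam (real k))) / real k powr (-1 - \<rho>)) sequentially"
    using eventually_ge_at_top[of 1]
  proof eventually_elim
    case (elim k)
    have r: "real k powr (1 + \<rho>) = 1 / real k powr (-1 - \<rho>)"
      using powr_minus_divide[of "real k" "-1 - \<rho>"] by (simp add: algebra_simps)
    show ?case
      unfolding p_coeff_eq_suminf_tau[OF elim] r using elim by (simp add: diff_divide_distrib)
  qed
  then show "(\<lambda>k. (p_coeff p j k - real k powr (-1 - \<rho>) * Psi (log lam (real k))) / real k powr (-1 - \<rho>)) \<longlonglongrightarrow> 0"
    by (rule Lim_transform_eventually[OF suminf_tau_asymp])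
qed

end

section \<open>Fourier coefficients\<close>

text \<open>The negative axis is the branch cut of \<open>Ln\<close>, so continuity of the complex
  power fails to cover it; there \<open>Ln\<close> equals \<open>ln \<bar>y\<bar>\<close> plus the
  constant \<open>\<i> * pi\<close>.\<close>

lemma borel_measurable_of_real_powr:
  "(\<lambda>y. complex_of_real y powr z) \<in> borel_measurable borel"
proof -
  have "complex_of_real y powr z =
      (if y = 0 then 0 else exp (z * (complex_of_real (ln \<bar>y\<bar>) + (if y < 0 then \<i> * pi else 0))))" for y
  proof (cases "y < 0")
    case True
    then have "Ln (- complex_of_real (- y)) = complex_of_real (ln (- y)) + \<i> * pi"
      by (subst Ln_minus) (auto simp: Ln_of_real simp del: of_real_minus)
    then show ?thesis using True by (simp add: powr_def)
  next
    case False
    then show ?thesis by (auto simp: powr_def Ln_of_real)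
  qed
  then have "(\<lambda>y. complex_of_real y powr z) =
      (\<lambda>y. if y = 0 then 0 else exp (z * (complex_of_real (ln \<bar>y\<bar>) + (if y < 0 then \<i> * pi else 0))))"
    by (rule ext)
  then show ?thesis by (simp only:) measurable
qed

context branching_limit_j
begin

section \<open>Unfolding the Fourier integral\<close>

definition E :: "int \<Rightarrow> real \<Rightarrow> complex" where
  "E m u = exp (2 * complex_of_real pi * \<i> * of_int m * complex_of_real u)"

lemma continuous_on_E [continuous_intros]:
  "continuous_on S h \<Longrightarrow> continuous_on S (\<lambda>x. E m (h x))"
  unfolding E_def by (intro continuous_intros)

lemma norm_E [simp]: "norm (E m u) = 1"
proof -
  have "2 * complex_of_real pi * \<i> * of_int m * complex_of_real u = \<i> * complex_of_real (2 * pi * of_int m * u)"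
    by simp
  then show ?thesis unfolding E_def by (simp only: norm_exp_i_times)
qed

lemma E_add_int: "E m (u + of_int n) = E m u"
proof -
  have "E m (u + of_int n) = E m u * exp (2 * of_int (m * n) * complex_of_real pi * \<i>)"
    unfolding E_def exp_add[symmetric] by (rule arg_cong[of _ _ exp]) (simp add: algebra_simps)
  then show ?thesis using exp_2pi_1_int[of "m * n"] by (simp add: mult_ac)
qed

definition gE :: "int \<Rightarrow> real \<Rightarrow> complex" where
  "gE m x = complex_of_real (g x) * E m x"

lemma continuous_on_gE [continuous_intros]:
  "continuous_on S h \<Longrightarrow> continuous_on S (\<lambda>x. gE m (h x))"
  unfolding gE_def by (intro continuous_intros)

lemma gE_integrable: "gE m integrable_on {x..y}"
  by (rule integrable_continuous_interval) (intro continuous_intros)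

lemma integral_gE_shift: "integral {0..1} (\<lambda>u. gE m (u + of_int n)) = integral {of_int n..of_int n + 1} (gE m)"
  using integral_shift_real_ivl[of "of_int n" "of_int n" "of_int n + 1" "gE m"] by simp

text \<open>As \<open>E m\<close> has period 1, the pair with index \<open>n\<close> integrates to
  \<open>gE m\<close> over the two unit intervals that extend \<open>{- n..n}\<close> on either
  side.\<close>

lemma integral_partial_sum:
  "integral {0..1} (\<lambda>u. \<Sum>n<L. complex_of_real (g2 n u) * E m u) = integral {- real L..real L} (gE m)"
proof (induction L)
  case (Suc L)
  have eq: "complex_of_real (g2 L u) * E m u = gE m (u + of_int (int L)) + gE m (u + of_int (- int L - 1))" for u
    unfolding gE_def g2_def E_add_int by (simp add: algebra_simps)
  have int: "(\<lambda>u. gE m (u + c)) integrable_on {0..1}" for c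
    by (rule integrable_continuous_interval) (intro continuous_intros)
  have "(\<lambda>u. complex_of_real (g2 n u) * E m u) integrable_on {0..1}" for n
    unfolding g2_def by (rule integrable_continuous_interval) (intro continuous_intros)
  then have "integral {0..1} (\<lambda>u. \<Sum>n<Suc L. complex_of_real (g2 n u) * E m u) =
      integral {- real L..real L} (gE m) + integral {0..1} (\<lambda>u. complex_of_real (g2 L u) * E m u)"
    by (simp add: Henstock_Kurzweil_Integration.integral_add integrable_sum Suc)
  also have "integral {0..1} (\<lambda>u. complex_of_real (g2 L u) * E m u) =
      integral {real L..real L + 1} (gE m) + integral {- real L - 1..- real L} (gE m)"
    unfolding eq Henstock_Kurzweil_Integration.integral_add[OF int int] integral_gE_shift by simp
  also have "integral {- real L..real L} (gE m) + (integral {real L..real L + 1} (gE m) + integral {- real L - 1..- real L} (gE m)) =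
      integral {- real L - 1..real L + 1} (gE m)"
  proof -
    have "integral {- real L - 1..- real L} (gE m) + integral {- real L..real L} (gE m) = integral {- real L - 1..real L} (gE m)"
      by (rule Henstock_Kurzweil_Integration.integral_combine) (auto intro: gE_integrable)
    moreover have "integral {- real L - 1..real L} (gE m) + integral {real L..real L + 1} (gE m) = integral {- real L - 1..real L + 1} (gE m)"
      by (rule Henstock_Kurzweil_Integration.integral_combine) (auto intro: gE_integrable)
    ultimately show ?thesis by (metis add.assoc add.commute)
  qed
  moreover have "- real (Suc L) = - real L - 1" "real (Suc L) = real L + 1" by simp_all
  ultimately show ?case by (simp only:)
qed simp

text \<open>The majorant makes the series uniformly convergent on \<open>{0..1}\<close>, which
  justifies integrating it term by term.\<close>

lemma fourier_coeff_Psi_limit: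
  "(\<lambda>L. 2 * p / a * integral {- real L..real L} (gE m)) \<longlonglongrightarrow> fourier_coeff Psi m"
proof -
  obtain C where C: "\<And>u R n. \<bar>u\<bar> \<le> R \<Longrightarrow> \<bar>g2 n u\<bar> \<le> majorant C R n"
    using g2_majorant by metis
  let ?F = "\<lambda>L u. \<Sum>n<L. complex_of_real (g2 n u) * E m u"
  let ?G = "\<lambda>u. \<Sum>n. complex_of_real (g2 n u) * E m u"
  have "uniform_limit {0..1} ?F ?G sequentially"
    by (rule Weierstrass_m_test[OF _ majorant_summable[of C 1]]) (use C in \<open>auto simp: norm_mult\<close>)
  moreover have "continuous_on {0..1} (?F L)" for L
    unfolding g2_def by (intro continuous_intros)
  ultimately obtain I J where I: "\<And>L. (?F L has_integral I L) {0..1}" and J: "(?G has_integral J) {0..1}"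
    and lim: "I \<longlonglongrightarrow> J"
    by (rule uniform_limit_integral) auto
  have "I L = integral {- real L..real L} (gE m)" for L
    using integral_unique[OF I[of L]] integral_partial_sum[of m L] by simp
  moreover have "2 * p / a * J = fourier_coeff Psi m"
  proof -
    have "complex_of_real (Psi u) * E m u = complex_of_real (2 * p / a) * ?G u" for u
    proof -
      have "summable (\<lambda>n. complex_of_real (g2 n u))"
        using g2_summable[of u] by (simp add: summable_complex_of_real)
      from suminf_mult2[OF this, of "E m u"] show ?thesis
        unfolding Psi_def using suminf_of_real[OF g2_summable[of u], where 'a=complex] by simp
    qed
    then have "fourier_coeff Psi m = integral {0..1} (\<lambda>u. complex_of_real (2 * p / a) * ?G u)"
      by (simp add: fourier_coeff_def E_def[symmetric])
    also have "\<dots> = complex_of_real (2 * p / a) * J"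
      using J by (intro integral_unique has_integral_mult_right)
    finally show ?thesis by simp
  qed
  moreover have "(\<lambda>L. 2 * p / a * I L) \<longlonglongrightarrow> 2 * p / a * J"
    by (intro tendsto_intros lim)
  ultimately show ?thesis by simp
qed

definition mellin_integrand :: "int \<Rightarrow> real \<Rightarrow> complex" where
  "mellin_integrand m y = complex_of_real (v j y) *
     complex_of_real y powr (complex_of_real \<rho> + \<i> * complex_of_real (2 * pi / ln lam) * of_int m)"

text \<open>Under \<open>y = lam powr x\<close> the character \<open>E m x\<close> becomes the
  imaginary power of \<open>y\<close>. One factor \<open>y\<close> of the weight serves as Jacobian,
  which leaves the real exponent \<open>\<rho>\<close> in place of
  \<open>1 + \<rho>\<close>.\<close>

lemma gE_substitution: "gE m x = complex_of_real (lam powr x) * mellin_integrand m (lam powr x)"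
proof -
  define z where "z = complex_of_real \<rho> + \<i> * complex_of_real (2 * pi / ln lam) * of_int m"
  have pos: "0 < lam powr x" using lam_pos by simp
  have "complex_of_real (lam powr x) powr z = exp (z * complex_of_real (x * ln lam))"
    using pos lam_pos by (simp add: powr_def Ln_of_real ln_powr del: of_real_mult)
  also have "z * complex_of_real (x * ln lam) =
      complex_of_real (\<rho> * x * ln lam) + 2 * complex_of_real pi * \<i> * of_int m * complex_of_real x"
    using lam_gt_1 by (simp add: z_def field_simps)
  also have "exp \<dots> = complex_of_real (lam powr (\<rho> * x)) * E m x"
    using lam_pos by (simp only: exp_add exp_of_real E_def) (simp add: powr_def)
  finally have "complex_of_real (lam powr x) powr z = complex_of_real (lam powr (\<rho> * x)) * E m x" .
  moreover have "w_rho x = lam powr x * lam powr (\<rho> * x)"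
    by (simp add: w_rho_def powr_add[symmetric] algebra_simps)
  ultimately show ?thesis
    unfolding gE_def g_def mellin_integrand_def z_def[symmetric] by simp
qed

lemma continuous_on_mellin_integrand: "S \<subseteq> {0<..} \<Longrightarrow> continuous_on S (mellin_integrand m)"
  unfolding mellin_integrand_def
  by (intro continuous_intros continuous_on_v[OF j]) (auto simp: complex_nonpos_Reals_iff)

lemma integral_gE_eq:
  "complex_of_real (ln lam) * integral {- real L..real L} (gE m) =
     (\<integral>y. indicator {lam powr (- real L)..lam powr real L} y *\<^sub>R mellin_integrand m y \<partial>lborel)"
proof -
  let ?c = "lam powr (- real L)" and ?d = "lam powr real L"
  have cd: "0 < ?c" "?c \<le> ?d" using lam_gt_1 by (auto intro: powr_mono)
  have cont: "continuous_on {?c..?d} (mellin_integrand m)"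
    by (rule continuous_on_mellin_integrand) (meson atLeastAtMost_iff greaterThan_iff less_le_trans cd(1) subsetI)
  have "((\<lambda>x. (lam powr x * ln lam) *\<^sub>R mellin_integrand m (lam powr x)) has_integral
      integral {?c..?d} (mellin_integrand m)) {- real L..real L}"
  proof (rule has_integral_substitution[where g = "\<lambda>x. lam powr x"])
    show "?c \<le> ?d" "continuous_on {?c..?d} (mellin_integrand m)" by fact+
    show "(\<lambda>x. lam powr x) ` {- real L..real L} \<subseteq> {?c..?d}"
      using lam_gt_1 by (auto intro!: powr_mono)
    show "((\<lambda>x. lam powr x) has_field_derivative lam powr x * ln lam) (at x within {- real L..real L})" for x
    proof -
      have "(\<lambda>x. lam powr x) = (\<lambda>x. exp (x * ln lam))" using lam_pos by (simp add: powr_def fun_eq_iff)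
      then show ?thesis by (auto intro!: derivative_eq_intros)
    qed
  qed simp
  moreover have "(\<lambda>x. (lam powr x * ln lam) *\<^sub>R mellin_integrand m (lam powr x)) = (\<lambda>x. complex_of_real (ln lam) * gE m x)"
    by (simp add: gE_substitution scaleR_conv_of_real mult_ac)
  ultimately have "((\<lambda>x. complex_of_real (ln lam) * gE m x) has_integral
      integral {?c..?d} (mellin_integrand m)) {- real L..real L}"
    by (simp only:)
  then have "integral {- real L..real L} (\<lambda>x. complex_of_real (ln lam) * gE m x) = integral {?c..?d} (mellin_integrand m)"
    by (rule integral_unique)
  moreover have "set_integrable lborel {?c..?d} (mellin_integrand m)"
    unfolding set_integrable_def using cont by (intro borel_integrable_compact) auto
  from set_borel_integral_eq_integral(2)[OF this]
  have "integral {?c..?d} (mellin_integrand m) = (\<integral>y. indicator {?c..?d} y *\<^sub>R mellin_integrand m y \<partial>lborel)"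
    by (simp add: set_lebesgue_integral_def)
  ultimately show ?thesis by simp
qed

lemma mellin_integrand_measurable [measurable]: "mellin_integrand m \<in> borel_measurable borel"
  unfolding mellin_integrand_def
  by (intro borel_measurable_times borel_measurable_of_real_powr) (use v_measurable[OF j] in measurable)

text \<open>Bounded near 0 and of order \<open>y powr (\<rho> - 3)\<close> at infinity, where
  \<open>\<rho> < 2\<close> gives integrability.\<close>

lemma mellin_integrand_integrable: "integrable lborel (mellin_integrand m)"
proof -
  obtain C where C: "0 < C" "\<And>y. v j y \<le> C" "\<And>y. 0 < y \<Longrightarrow> y ^ 3 * v j y \<le> C"
    using bound_constant by metis
  have "integrable lborel (\<lambda>t. C * (if \<bar>t\<bar> \<le> 1 then 1 else \<bar>t\<bar> powr (- (3 - \<rho>))))"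
    using rho_less_2 by (intro Bochner_Integration.integrable_mult_right integrable_powr_tail) auto
  then show ?thesis
  proof (rule Bochner_Integration.integrable_bound)
    show "AE y in lborel. norm (mellin_integrand m y) \<le> norm (C * (if \<bar>y\<bar> \<le> 1 then 1 else \<bar>y\<bar> powr (- (3 - \<rho>))))"
    proof (rule AE_I2)
      fix y :: real
      show "norm (mellin_integrand m y) \<le> norm (C * (if \<bar>y\<bar> \<le> 1 then 1 else \<bar>y\<bar> powr (- (3 - \<rho>))))"
      proof (cases "0 < y")
        case False
        \<comment> \<open>At \<open>y = 0\<close> it is the complex power that vanishes, by the
          convention \<open>0 powr z = 0\<close>; for negative \<open>y\<close> it is the
          density.\<close>
        then have "mellin_integrand m y = 0" using v_neg_eq_0[OF j, of y] by (cases "y = 0") (auto simp: mellin_integrand_def)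
        then show ?thesis by simp
      next
        case True
        have "norm (mellin_integrand m y) = v j y * y powr \<rho>"
          using True v_nonneg[OF j, of y] by (simp add: mellin_integrand_def norm_mult norm_powr_real_powr)
        also have "\<dots> \<le> C * (if \<bar>y\<bar> \<le> 1 then 1 else \<bar>y\<bar> powr (- (3 - \<rho>)))"
        proof (cases "y \<le> 1")
          case y: True
          then have "y powr \<rho> \<le> 1" using True rho_pos powr_mono2[of \<rho> y 1] by simp
          then have "v j y * y powr \<rho> \<le> C * 1" using C v_nonneg[OF j, of y] by (intro mult_mono) auto
          then show ?thesis using y True by simp
        next
          case False
          have "y powr \<rho> = y ^ 3 * y powr (- (3 - \<rho>))"
            using True by (simp add: powr_diff powr_realpow flip: powr_numeral)
          then have "v j y * y powr \<rho> = (y ^ 3 * v j y) * y powr (- (3 - \<rho>))" by simp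
          also have "\<dots> \<le> C * y powr (- (3 - \<rho>))" using C True by (intro mult_right_mono) auto
          finally show ?thesis using False True by simp
        qed
        finally show ?thesis using C by simp
      qed
    qed
  qed measurable
qed

text \<open>The windows \<open>{- L..L}\<close> become intervals from \<open>lam powr (- L)\<close>
  to \<open>lam powr L\<close>, which exhaust the positive half-line, so the limit is the full
  Mellin integral.\<close>

lemma fourier_coeff_Psi:
  assumes V: "V \<in> borel_measurable M'" and dens: "distr M' borel V = density lborel (v j)"
  shows "fourier_coeff Psi m = complex_of_real (2 * p / (a * ln lam)) *
     mellin M' V (complex_of_real \<rho> + 1 + \<i> * complex_of_real (2 * pi / ln lam) * of_int m)"
proof -
  let ?z = "complex_of_real \<rho> + \<i> * complex_of_real (2 * pi / ln lam) * of_int m"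
  have pw: "(\<lambda>y. complex_of_real y powr ?z) \<in> borel_measurable borel"
    by (rule borel_measurable_of_real_powr)
  have "mellin M' V (complex_of_real \<rho> + 1 + \<i> * complex_of_real (2 * pi / ln lam) * of_int m) =
      (\<integral>\<omega>. complex_of_real (V \<omega>) powr ?z \<partial>M')"
    by (simp add: mellin_def algebra_simps)
  also have "\<dots> = (\<integral>y. complex_of_real y powr ?z \<partial>distr M' borel V)"
    using V pw by (intro integral_distr[symmetric])
  also have "\<dots> = (\<integral>y. mellin_integrand m y \<partial>lborel)"
    unfolding dens mellin_integrand_def using pw v_measurable[OF j] v_nonneg[OF j]
    by (subst integral_density) (auto simp: scaleR_conv_of_real)
  finally have mellin: "mellin M' V (complex_of_real \<rho> + 1 + \<i> * complex_of_real (2 * pi / ln lam) * of_int m) =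
      (\<integral>y. mellin_integrand m y \<partial>lborel)" .
  have "(\<lambda>L. \<integral>y. indicator {lam powr (- real L)..lam powr real L} y *\<^sub>R mellin_integrand m y \<partial>lborel) \<longlonglongrightarrow>
      (\<integral>y. mellin_integrand m y \<partial>lborel)"
  proof (rule integral_dominated_convergence)
    show "integrable lborel (\<lambda>y. norm (mellin_integrand m y))"
      by (rule integrable_norm[OF mellin_integrand_integrable])
    show "AE y in lborel. norm (indicator {lam powr (- real L)..lam powr real L} y *\<^sub>R mellin_integrand m y) \<le> norm (mellin_integrand m y)" for L
      by (auto simp: indicator_def)
    show "AE y in lborel. (\<lambda>L. indicator {lam powr (- real L)..lam powr real L} y *\<^sub>R mellin_integrand m y) \<longlonglongrightarrow> mellin_integrand m y"
    proof (rule AE_I2)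
      fix y
      show "(\<lambda>L. indicator {lam powr (- real L)..lam powr real L} y *\<^sub>R mellin_integrand m y) \<longlonglongrightarrow> mellin_integrand m y"
      proof (cases "0 < y")
        case False
        then have "mellin_integrand m y = 0" using v_neg_eq_0[OF j, of y] by (cases "y = 0") (auto simp: mellin_integrand_def)
        then show ?thesis by simp
      next
        case True
        obtain N where N: "\<And>n. n \<ge> N \<Longrightarrow> max y (1 / y) \<le> lam ^ n" using eventually_lam_power_ge by blast
        show ?thesis
        proof (rule tendsto_eventually, rule eventually_sequentiallyI[of N])
          fix L assume "N \<le> L"
          then have "y \<le> lam ^ L" "1 / y \<le> lam ^ L" using N[of L] by auto
          moreover have "lam powr (- real L) = 1 / lam ^ L" using lam_pos by (simp add: powr_minus_divide powr_realpow)
          moreover have "1 / lam ^ L \<le> y"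
            using calculation(2) True lam_pos by (simp add: field_simps)
          ultimately have "y \<in> {lam powr (- real L)..lam powr real L}"
            using lam_pos by (simp add: powr_realpow)
          then show "indicator {lam powr (- real L)..lam powr real L} y *\<^sub>R mellin_integrand m y = mellin_integrand m y" by simp
        qed
      qed
    qed
  qed measurable
  then have "(\<lambda>L. 2 * p / (a * ln lam) * (complex_of_real (ln lam) * integral {- real L..real L} (gE m))) \<longlonglongrightarrow>
      complex_of_real (2 * p / (a * ln lam)) * (\<integral>y. mellin_integrand m y \<partial>lborel)"
    unfolding integral_gE_eq by (intro tendsto_mult tendsto_const)
  moreover have "complex_of_real (2 * p / (a * ln lam)) * (complex_of_real (ln lam) * integral {- real L..real L} (gE m)) =
      2 * p / a * integral {- real L..real L} (gE m)" for L
    using lam_gt_1 by simp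
  ultimately have "(\<lambda>L. 2 * p / a * integral {- real L..real L} (gE m)) \<longlonglongrightarrow>
      complex_of_real (2 * p / (a * ln lam)) * (\<integral>y. mellin_integrand m y \<partial>lborel)"
    by simp
  from LIMSEQ_unique[OF fourier_coeff_Psi_limit this] show ?thesis unfolding mellin .
qed

end

theorem theorem2p1:
  fixes p lam a \<rho> chi :: real and j :: nat
    and M :: "'a measure" and \<xi> :: "nat \<Rightarrow> nat \<Rightarrow> 'a \<Rightarrow> nat" and W :: "'a \<Rightarrow> real"
    and M' :: "'b measure" and W' :: "nat \<Rightarrow> 'b \<Rightarrow> real" and V :: "'b \<Rightarrow> real"
  defines "lam \<equiv> 1 + p"
    and "a \<equiv> 1 + 2 * p"
    and "\<rho> \<equiv> ln (1 + 2 * p) / ln (1 + p)"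
    and "chi \<equiv> 2 * pi / ln lam"
  assumes "0 < p" and "p < 1" and "j \<ge> 1"
    \<comment> \<open>the martingale limit of the branching process started from one individual\<close>
    and "prob_space M" and "iid_offspring M p \<xi>"
    and "W \<in> borel_measurable M"
    and "AE \<omega> in M. (\<lambda>n. real (generation_size \<xi> n \<omega>) / lam ^ n) \<longlonglongrightarrow> W \<omega>"
    \<comment> \<open>\<open>V\<close> is the sum of \<open>j\<close> independent copies of \<open>W\<close>\<close>
    and "prob_space M'"
    and "prob_space.indep_vars M' (\<lambda>_. borel) W' {1..j}"
    and "\<And>i. i \<in> {1..j} \<Longrightarrow> distr M' borel (W' i) = distr M borel W"
  defines "V \<equiv> \<lambda>\<omega>. \<Sum>i=1..j. W' i \<omega>"
  shows "\<exists>\<Psi> :: real \<Rightarrow> real.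
           continuous_on UNIV \<Psi> \<and> (\<forall>u. \<Psi> u > 0) \<and> (\<forall>u. \<Psi> (u + 1) = \<Psi> u) \<and>
           (\<forall>m :: int. fourier_coeff \<Psi> m =
              complex_of_real (2 * p / (a * ln lam)) *
                mellin M' V (complex_of_real \<rho> + 1 + \<i> * complex_of_real chi * of_int m)) \<and>
           (\<lambda>k. p_coeff p j k - real k powr (-1 - \<rho>) * \<Psi> (log lam (real k)))
              \<in> o(\<lambda>k. real k powr (-1 - \<rho>))"
proof -
  interpret B: branching p by standard fact+
  have lam: "lam = B.lam" and a: "a = B.a" and rho: "\<rho> = B.\<rho>"
    by (simp_all add: lam_def B.lam_def a_def B.a_def \<rho>_def B.\<rho>_def)
  define N where "N = distr M borel W"
  have N: "real_distribution N"
    unfolding N_def using \<open>prob_space M\<close> \<open>W \<in> borel_measurable M\<close> by (rule prob_space.real_distribution_distr)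
  interpret B: branching_limit_j p "char N" j
  proof unfold_locales
    show "(\<lambda>n. (B.f ^^ n) (iexp (t / B.lam ^ n))) \<longlonglongrightarrow> char N t" for t
      unfolding N_def using assms(8-11) unfolding lam by (rule B.iterate_tendsto_char)
  qed fact
  interpret M': prob_space M' by fact
  have W': "W' i \<in> borel_measurable M'" if "i \<in> {1..j}" for i
    using \<open>M'.indep_vars (\<lambda>_. borel) W' {1..j}\<close> that by (auto simp: M'.indep_vars_def)
  have V: "V \<in> borel_measurable M'"
    unfolding V_def using W' by (intro borel_measurable_sum)
  \<comment> \<open>Independence and equal laws give the \<open>j\<close>-th power, which identifies
    \<open>v j\<close> as the density of \<open>V\<close>.\<close>
  have "char (distr M' borel V) t = char N t ^ j" for t
    unfolding V_def M'.char_distr_sum[OF \<open>M'.indep_vars (\<lambda>_. borel) W' {1..j}\<close>] N_def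
    using assms(14) by simp
  then have dens: "distr M' borel V = density lborel (B.v j)"
    using V \<open>j \<ge> 1\<close> by (intro B.density_v M'.real_distribution_distr) auto
  show ?thesis
  proof (intro exI[of _ B.Psi] conjI allI)
    show "fourier_coeff B.Psi m = complex_of_real (2 * p / (a * ln lam)) *
        mellin M' V (complex_of_real \<rho> + 1 + \<i> * complex_of_real chi * of_int m)" for m
      unfolding chi_def lam a rho by (rule B.fourier_coeff_Psi[OF V dens])
    show "(\<lambda>k. p_coeff p j k - real k powr (-1 - \<rho>) * B.Psi (log lam (real k))) \<in> o(\<lambda>k. real k powr (-1 - \<rho>))"
      unfolding lam rho by (rule B.p_coeff_asymp)
  qed (simp_all add: B.Psi_continuous B.Psi_pos[OF N] B.Psi_periodic)
qed

end
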